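(* Let $\alpha_n$ be the positive real solution of $ue^u=n+1$ (so $\alpha_n=\log n-\log\log n+o(1)$). With $\lambda$ uniformly distributed on $\Pi(n)$, $$E(d(\lambda))=\Big(\frac{\alpha_n-2}{\alpha_n^2}\Big)n^2+O(n\alpha_n^{-1}).$$ Let $S_k(d;n):=\frac{1}{B_n}\sum_{\lambda\in\Pi(n)}\big(d(\lambda)-M(d;n)/B_n\big)^k$, where $M(d;n)=\sum_{\lambda\in\Pi(n)}d(\lambda)$. Then $$S_2(d;n)=\Big(\frac{\alpha_n^2-7\alpha_n+17}{\alpha_n^3(\alpha_n+1)}\Big)n^3+O(n^2\alpha_n^{-1}),$$ $$S_3(d;n)=\Big(-\frac{881}{3}-244\alpha_n+145\alpha_n^2-\frac{83}{3}\alpha_n^3+2\alpha_n^4\Big)\frac{n^4}{\alpha_n^4(\alpha_n+1)^3}+O(n^3\alpha_n^{-1}).$$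
   Context: $\Pi(n)$ is the set of set partitions of $[n]=\{1,\dots,n\}$ and $B_n=|\Pi(n)|$ is the $n$th Bell number. For $\lambda\in\Pi(n)$ with blocks $\mathbf{B}_1,\dots,\mathbf{B}_\ell$, the dimension exponent is $d(\lambda)=\sum_{i=1}^{\ell}(\max\mathbf{B}_i-\min\mathbf{B}_i+1)-n$. Asymptotics are as $n\to\infty$. *)

theory Defs
  imports "HOL-Probability.Probability" "HOL-Library.Landau_Symbols"
begin

definition set_partitions :: "nat \<Rightarrow> nat set set set" where
  "set_partitions n = {P. partition_on {1..n} P}"

definition Bell :: "nat \<Rightarrow> nat" where
  "Bell n = card (set_partitions n)"

definition dim_exponent :: "nat \<Rightarrow> nat set set \<Rightarrow> int" where
  "dim_exponent n P = (\<Sum>B\<in>P. int (Max B) - int (Min B) + 1) - int n"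

definition expect_partitions :: "nat \<Rightarrow> (nat set set \<Rightarrow> real) \<Rightarrow> real" where
  "expect_partitions n f = measure_pmf.expectation (pmf_of_set (set_partitions n)) f"

definition total_stat :: "(nat \<Rightarrow> nat set set \<Rightarrow> int) \<Rightarrow> nat \<Rightarrow> int" where
  "total_stat f n = (\<Sum>P\<in>set_partitions n. f n P)"

definition central_moment :: "nat \<Rightarrow> (nat \<Rightarrow> nat set set \<Rightarrow> int) \<Rightarrow> nat \<Rightarrow> real" where
  "central_moment k f n =
     1 / real (Bell n) *
     (\<Sum>P\<in>set_partitions n.
        (real_of_int (f n P) - real_of_int (total_stat f n) / real (Bell n)) ^ k)"

definition alpha :: "nat \<Rightarrow> real" where
  "alpha n = (THE u. u > 0 \<and> u * exp u = real n + 1)"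

lemma alpha_ex1: "\<exists>!u::real. u > 0 \<and> u * exp u = real n + 1"
proof (rule ex_ex1I)
  have "\<exists>u::real. 0 \<le> u \<and> u \<le> real n + 1 \<and> u * exp u = real n + 1"
  proof (rule IVT')
    have "(real n + 1) * 1 \<le> (real n + 1) * exp (real n + 1)"
      by (intro mult_left_mono) auto
    then show "real n + 1 \<le> (real n + 1) * exp (real n + 1)" by simp
  qed (auto intro!: continuous_intros)
  then show "\<exists>u::real. u > 0 \<and> u * exp u = real n + 1"
    by (metis add_nonneg_pos less_eq_real_def mult_zero_left of_nat_0_le_iff
        order_less_irrefl zero_less_one)
next
  fix u v :: real
  assume u: "u > 0 \<and> u * exp u = real n + 1" and v: "v > 0 \<and> v * exp v = real n + 1"
  have strict: "x * exp x < y * exp y" if "0 < x" "x < y" for x y :: real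
    using that by (intro mult_strict_mono) auto
  show "u = v"
    using strict[of u v] strict[of v u] u v by (cases u v rule: linorder_cases) auto
qed

lemma finite_set_partitions: "finite (set_partitions n)"
  unfolding set_partitions_def by (rule finitely_many_partition_on) simp

end

theory Submission
  imports Defs "HOL-Real_Asymp.Real_Asymp"
begin

text \<open>
  Building a partition element by element and recording only which blocks will be continued, the
  dimension exponent changes by a function of the number of open blocks. Summing out this process
  expresses the moments of the dimension exponent through the law of a random variable \<open>K\<close> which, as in
  Dobinski's formula, has probabilities proportional to \<open>k ^ n / k!\<close>: formally, conditionally on \<open>K\<close> the
  dimension exponent has polynomial cumulants, and its central moments follow from the law of total
  cumulance.

  The law of \<open>K\<close> satisfies the exact identity \<open>E (g K) = E (\<rho> K * g (K - 1))\<close> with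
  \<open>\<rho> k = k * (1 - 1 / k) ^ n\<close>. Monotonicity of \<open>(1 - 1 / k) ^ n\<close> turns it into bounds for all moments of
  \<open>(K - c) / sqrt c\<close> around the centre \<open>c = exp (alpha n) = (n + 1) / alpha n\<close>. Expanding \<open>\<rho>\<close> around \<open>c\<close>
  and testing the identity with powers of \<open>K - c\<close> gives recurrences from which two terms of the expansion
  of the moments in powers of \<open>1 / c\<close> can be read off. In the central moments of the dimension exponent
  the leading powers of \<open>c\<close> cancel; the first surviving term is the main term, and the second one is
  smaller by the factor claimed for the error.
\<close>

section \<open>Extending set partitions\<close>

definition add_to_block :: "'a \<Rightarrow> 'a set set \<Rightarrow> 'a set \<Rightarrow> 'a set set" where
  "add_to_block a P B = insert (insert a B) (P - {B})"

text \<open>Taking \<open>B = {}\<close>, which is never a block, adjoins the singleton \<open>{a}\<close> to \<open>P\<close>.\<close>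

lemma partition_on_add_to_block:
  assumes P: "partition_on A P" and B: "B \<in> insert {} P" and a: "a \<notin> A"
  shows "partition_on (insert a A) (add_to_block a P B)"
proof -
  have sub: "B \<subseteq> A" using B partition_onD1[OF P] by auto
  have "disjnt B (\<Union>(P - {B}))"
    using B partition_onD2[OF P] by (fastforce simp: disjoint_def disjnt_iff)
  then have "disjnt (insert a B) (\<Union>(P - {B}))"
    using a partition_onD1[OF P] by (auto simp: disjnt_iff)
  moreover have "partition_on (A - B) (P - {B})"
    using P B partition_onD3[OF P] partition_on_insert[OF \<open>disjnt B _\<close>, of A]
    by (cases "B = {}") (auto simp: insert_absorb)
  moreover have "insert a A - insert a B = A - B" using a by auto
  ultimately show ?thesis
    unfolding add_to_block_def using sub by (subst partition_on_insert) auto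
qed

lemma partition_on_insertE:
  assumes Q: "partition_on (insert a A) Q" and a: "a \<notin> A"
  obtains P B where "partition_on A P" "B \<in> insert {} P" "Q = add_to_block a P B"
proof -
  obtain C where C: "C \<in> Q" "a \<in> C" using partition_onD1[OF Q] by blast
  define B where "B = C - {a}"
  define R where "R = Q - {C}"
  have C_eq: "C = insert a B" and Q_eq: "Q = insert C R" using C by (auto simp: B_def R_def)
  have disj: "disjnt C (\<Union>R)"
    using C partition_onD2[OF Q] by (fastforce simp: R_def disjoint_def disjnt_iff)
  have "insert a A - C = A - B" using a C_eq by auto
  then have R: "partition_on (A - B) R" and "B \<subseteq> A"
    using Q a partition_on_insert[OF disj, of "insert a A"] by (auto simp: Q_eq B_def)
  show ?thesis
  proof (cases "B = {}")
    case True
    then show ?thesis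
      using that[of R "{}"] R partition_onD3[OF R] by (simp add: add_to_block_def Q_eq C_eq)
  next
    case False
    have "disjnt B (\<Union>R)" using disj by (auto simp: C_eq disjnt_iff)
    moreover have "B \<notin> R" using False calculation by (auto simp: disjnt_iff)
    ultimately show ?thesis
      using that[of "insert B R" B] False R \<open>B \<subseteq> A\<close> partition_on_insert[of B R A]
      by (simp add: add_to_block_def Q_eq C_eq)
  qed
qed

lemma add_to_block_inject:
  assumes "partition_on A P" "B \<in> insert {} P" "partition_on A P'" "B' \<in> insert {} P'" "a \<notin> A"
    and eq: "add_to_block a P B = add_to_block a P' B'"
  shows "P = P' \<and> B = B'"
proof -
  have a: "a \<notin> D" if "D \<in> insert {} P \<union> insert {} P'" for D
    using that assms(1,3,5) by (auto dest: partition_onD1)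
  have "insert a B \<in> add_to_block a P' B'" unfolding eq[symmetric] by (simp add: add_to_block_def)
  then have "insert a B = insert a B'" using a[of "insert a B"] by (auto simp: add_to_block_def)
  then have B: "B = B'" using a[of B] a[of B'] assms by (metis UnCI insert_ident)
  then have "P - {B} = P' - {B}"
    using eq a[of "insert a B"] by (metis DiffD1 UnCI add_to_block_def insertCI insert_ident)
  moreover have "{} \<notin> P" "{} \<notin> P'" using assms partition_onD3 by auto
  ultimately have "P = P'" using B assms(2,4) by (metis Diff_empty Diff_insert0 insertE insert_Diff)
  with B show ?thesis by simp
qed

lemma sum_partition_on_insert:
  assumes A: "finite A" and a: "a \<notin> A"
  shows "(\<Sum>Q | partition_on (insert a A) Q. F Q) =
    (\<Sum>P | partition_on A P. \<Sum>B\<in>insert {} P. F (add_to_block a P B))"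
proof -
  let ?S = "SIGMA P:{P. partition_on A P}. insert {} P"
  have "bij_betw (\<lambda>(P, B). add_to_block a P B) ?S {Q. partition_on (insert a A) Q}"
    unfolding bij_betw_def
  proof (intro conjI equalityI subsetI)
    show "inj_on (\<lambda>(P, B). add_to_block a P B) ?S"
      using a by (auto intro!: inj_onI dest: add_to_block_inject[rotated 5])
    show "Q \<in> {Q. partition_on (insert a A) Q}" if "Q \<in> (\<lambda>(P, B). add_to_block a P B) ` ?S" for Q
      using that a by (auto intro: partition_on_add_to_block)
    show "Q \<in> (\<lambda>(P, B). add_to_block a P B) ` ?S" if "Q \<in> {Q. partition_on (insert a A) Q}" for Q
      using that a by (auto elim!: partition_on_insertE)
  qed
  then have "(\<Sum>Q | partition_on (insert a A) Q. F Q) = (\<Sum>(P, B)\<in>?S. F (add_to_block a P B))"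
    by (subst sum.reindex_bij_betw[symmetric]) (auto simp: case_prod_unfold)
  also have "\<dots> = (\<Sum>P | partition_on A P. \<Sum>B\<in>insert {} P. F (add_to_block a P B))"
    using A finite_elements by (subst sum.Sigma) (auto simp: finitely_many_partition_on)
  finally show ?thesis .
qed

section \<open>Counting open blocks\<close>

text \<open>Blocks in the set \<open>U\<close> are open: they will receive further elements, so they are counted as
  if they extended to \<open>n\<close>. This makes the statistic grow by a function of \<open>card U\<close> alone when \<open>n + 1\<close>
  is inserted.\<close>

definition block_length :: "nat \<Rightarrow> nat set set \<Rightarrow> nat set \<Rightarrow> real" where
  "block_length n U B = (if B \<in> U then real n else real (Max B)) - real (Min B) + 1"

definition partial_dim :: "nat \<Rightarrow> nat set set \<Rightarrow> nat set set \<Rightarrow> real" where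
  "partial_dim n P U = (\<Sum>B\<in>P. block_length n U B) - real n"

definition open_sum :: "nat \<Rightarrow> (real \<Rightarrow> nat \<Rightarrow> real) \<Rightarrow> real" where
  "open_sum n f = (\<Sum>P\<in>set_partitions n. \<Sum>U\<in>Pow P. f (partial_dim n P U) (card U))"

lemma sum_Pow_insert:
  assumes "finite A" "a \<notin> A"
  shows "(\<Sum>U\<in>Pow (insert a A). f U) = (\<Sum>U\<in>Pow A. f U + f (insert a U))"
proof -
  have "(\<Sum>U\<in>Pow (insert a A). f U) = sum f (Pow A) + sum f (insert a ` Pow A)"
    unfolding Pow_insert by (rule sum.union_disjoint) (use assms in auto)
  also have "sum f (insert a ` Pow A) = (\<Sum>U\<in>Pow A. f (insert a U))"
    by (rule sum.reindex_cong[OF _ refl refl]) (use assms in \<open>auto intro!: inj_onI\<close>)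
  finally show ?thesis by (simp add: sum.distrib)
qed

lemma sum_Pow_marked_element:
  fixes f :: "'a set \<Rightarrow> 'b::semiring_1"
  assumes "finite A"
  shows "(\<Sum>a\<in>A. \<Sum>U\<in>Pow (A - {a}). f (insert a U)) = (\<Sum>U\<in>Pow A. of_nat (card U) * f U)"
proof -
  have "(\<Sum>a\<in>A. \<Sum>U\<in>Pow (A - {a}). f (insert a U)) =
      (\<Sum>(a, U)\<in>(SIGMA a:A. Pow (A - {a})). f (insert a U))"
    by (rule sum.Sigma) (use assms in auto)
  also have "\<dots> = (\<Sum>(U, a)\<in>(SIGMA U:Pow A. U). f U)"
    by (rule sum.reindex_bij_witness[of _ "\<lambda>(U, a). (a, U - {a})" "\<lambda>(a, U). (insert a U, a)"])
       (auto simp: insert_absorb)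
  also have "\<dots> = (\<Sum>U\<in>Pow A. \<Sum>a\<in>U. f U)"
    by (rule sum.Sigma[symmetric]) (use assms finite_subset in auto)
  finally show ?thesis by simp
qed

lemma set_partitionsD:
  assumes "P \<in> set_partitions n"
  shows "partition_on {1..n} P" "finite P" "{} \<notin> P" "\<And>B. B \<in> insert {} P \<Longrightarrow> finite B \<and> B \<subseteq> {1..n}"
proof -
  show p: "partition_on {1..n} P" using assms by (simp add: set_partitions_def)
  show "finite P" using finite_elements[OF _ p] by simp
  show "{} \<notin> P" by (rule partition_onD3[OF p])
  show "finite B \<and> B \<subseteq> {1..n}" if "B \<in> insert {} P" for B
    using partition_onD1[OF p] that by (auto intro: finite_subset)
qed

lemma block_length_insert_Suc:
  assumes "finite B" "B \<subseteq> {1..n}"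
  shows "block_length (Suc n) U (insert (Suc n) B) = real (Suc n) - (if B = {} then real n else real (Min B) - 1)"
proof -
  have "Max (insert (Suc n) B) = Suc n" using assms by (intro Max_eqI) auto
  moreover have "Min (insert (Suc n) B) = Min B" if "B \<noteq> {}"
    using assms that by (subst Min_insert) (force simp: min_def dest: Min_in)+
  ultimately show ?thesis by (auto simp: block_length_def)
qed

lemma partial_dim_add_to_block:
  assumes P: "P \<in> set_partitions n" and B: "B \<in> insert {} P" and U: "U \<subseteq> P - {B}"
    and W: "W = U \<or> W = insert (insert (Suc n) B) U"
  shows "partial_dim (Suc n) (add_to_block (Suc n) P B) W = partial_dim n P (insert B U) + card U"
proof -
  note D = set_partitionsD[OF P]
  let ?C = "insert (Suc n) B" and ?Q = "P - {B}"
  have C: "?C \<notin> P" using D(4)[of ?C] by auto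
  have "(\<Sum>D\<in>?Q. block_length (Suc n) W D) = (\<Sum>D\<in>?Q. block_length n (insert B U) D + of_bool (D \<in> U))"
    using C W by (intro sum.cong) (auto simp: block_length_def)
  also have "\<dots> = (\<Sum>D\<in>?Q. block_length n (insert B U) D) + card U"
    using U D(2) by (simp add: sum.distrib sum.If_cases of_bool_def Int_absorb1)
  finally have Q: "(\<Sum>D\<in>?Q. block_length (Suc n) W D) = (\<Sum>D\<in>?Q. block_length n (insert B U) D) + card U" .
  have "partial_dim (Suc n) (add_to_block (Suc n) P B) W =
      (\<Sum>D\<in>?Q. block_length n (insert B U) D) + card U - (if B = {} then real n else real (Min B) - 1)"
    unfolding partial_dim_def add_to_block_def
    using C D(2) Q block_length_insert_Suc[of B n W] D(4)[OF B] by simp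
  moreover have "(\<Sum>D\<in>P. block_length n (insert B U) D) = (\<Sum>D\<in>?Q. block_length n (insert B U) D) +
      (if B = {} then 0 else real n - real (Min B) + 1)"
    using B D(2,3) by (auto simp: sum.remove[of P B] block_length_def intro!: sum.cong)
  ultimately show ?thesis by (simp add: partial_dim_def)
qed

lemma sum_open_add_to_block:
  assumes P: "P \<in> set_partitions n" and B: "B \<in> insert {} P"
  shows "(\<Sum>W\<in>Pow (add_to_block (Suc n) P B). f (partial_dim (Suc n) (add_to_block (Suc n) P B) W) (card W)) =
    (\<Sum>U\<in>Pow (P - {B}). f (partial_dim n P (insert B U) + card U) (card U) +
      f (partial_dim n P (insert B U) + card U) (Suc (card U)))"
proof -
  have C: "insert (Suc n) B \<notin> P" using set_partitionsD(4)[OF P, of "insert (Suc n) B"] by auto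
  have "finite U \<and> insert (Suc n) B \<notin> U" if "U \<subseteq> P - {B}" for U
    using that C set_partitionsD(2)[OF P] finite_subset by blast
  then show ?thesis
    using C set_partitionsD(2)[OF P] partial_dim_add_to_block[OF P B]
    unfolding add_to_block_def by (subst sum_Pow_insert) (auto intro!: sum.cong)
qed

lemma open_sum_0: "open_sum 0 f = f 0 0"
  by (simp add: open_sum_def set_partitions_def partition_on_empty partial_dim_def)

lemma open_sum_Suc:
  "open_sum (Suc n) f = open_sum n (\<lambda>d j. f (d + j) j + f (d + j) (Suc j)
      + real j * (f (d + j - 1) (j - 1) + f (d + j - 1) j))"
proof -
  define g where "g P U = f (partial_dim n P U + card U) (card U)
      + f (partial_dim n P U + card U) (Suc (card U))" for P U
  define h where "h P U = f (partial_dim n P U + card U - 1) (card U - 1)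
      + f (partial_dim n P U + card U - 1) (card U)" for P U
  have "{1..Suc n} = insert (Suc n) {1..n}" by auto
  then have "open_sum (Suc n) f = (\<Sum>P\<in>set_partitions n. \<Sum>B\<in>insert {} P.
      \<Sum>W\<in>Pow (add_to_block (Suc n) P B). f (partial_dim (Suc n) (add_to_block (Suc n) P B) W) (card W))"
    by (simp add: open_sum_def set_partitions_def sum_partition_on_insert)
  also have "\<dots> = (\<Sum>P\<in>set_partitions n. (\<Sum>U\<in>Pow P. g P U) + (\<Sum>U\<in>Pow P. real (card U) * h P U))"
  proof (rule sum.cong[OF refl])
    fix P assume P: "P \<in> set_partitions n"
    note D = set_partitionsD[OF P]
    let ?s = "\<lambda>B. \<Sum>W\<in>Pow (add_to_block (Suc n) P B). f (partial_dim (Suc n) (add_to_block (Suc n) P B) W) (card W)"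
    have "partial_dim n P (insert {} U) = partial_dim n P U" for U
      using D(3) by (auto simp: partial_dim_def block_length_def intro!: sum.cong)
    then have "?s {} = (\<Sum>U\<in>Pow P. g P U)"
      using D(3) by (simp add: sum_open_add_to_block[OF P] g_def)
    moreover have "?s B = (\<Sum>U\<in>Pow (P - {B}). h P (insert B U))" if B: "B \<in> P" for B
    proof -
      have "card (insert B U) = Suc (card U)" if "U \<subseteq> P - {B}" for U
        using that D(2) finite_subset by (subst card_insert_disjoint) auto
      then show ?thesis
        using B by (subst sum_open_add_to_block[OF P]) (auto simp: h_def intro!: sum.cong)
    qed
    ultimately show "(\<Sum>B\<in>insert {} P. ?s B) = (\<Sum>U\<in>Pow P. g P U) + (\<Sum>U\<in>Pow P. real (card U) * h P U)"
      using D(2,3) sum_Pow_marked_element[OF D(2), of "h P"] by simp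
  qed
  finally show ?thesis by (simp add: open_sum_def g_def h_def sum.distrib)
qed

lemma sum_dim_exponent_eq_open_sum:
  "(\<Sum>P\<in>set_partitions n. g (real_of_int (dim_exponent n P))) = open_sum n (\<lambda>d j. if j = 0 then g d else 0)"
  unfolding open_sum_def
proof (rule sum.cong[OF refl])
  fix P assume P: "P \<in> set_partitions n"
  note D = set_partitionsD[OF P]
  have "(\<Sum>U\<in>Pow P. if card U = 0 then g (partial_dim n P U) else 0) =
     (\<Sum>U\<in>Pow P. if U = {} then g (partial_dim n P {}) else 0)"
    using D(2) by (intro sum.cong) (auto dest: finite_subset)
  also have "\<dots> = g (partial_dim n P {})" using D(2) by (simp add: sum.delta)
  also have "partial_dim n P {} = real_of_int (dim_exponent n P)"
    by (simp add: partial_dim_def block_length_def dim_exponent_def)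
  finally show "g (real_of_int (dim_exponent n P)) =
    (\<Sum>U\<in>Pow P. if card U = 0 then g (partial_dim n P U) else 0)" by simp
qed

section \<open>Asymptotic scales\<close>

text \<open>Orders are measured in powers of a small parameter \<open>e\<close>; powers of \<open>L\<close> are regarded as
  negligible and are not recorded.\<close>

locale asymptotic_scale =
  fixes F :: "'a filter" and L e :: "'a \<Rightarrow> real"
  assumes eventually_L_ge_1: "\<forall>\<^sub>F z in F. 1 \<le> L z"
    and eventually_e_bounds: "\<forall>\<^sub>F z in F. 0 < e z \<and> e z \<le> 1"
begin

definition of_order :: "int \<Rightarrow> ('a \<Rightarrow> real) \<Rightarrow> bool" where
  "of_order k f \<longleftrightarrow> (\<exists>p. f \<in> O[F](\<lambda>z. L z ^ p * e z powi k))"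

lemma of_orderI: "f \<in> O[F](\<lambda>z. L z ^ p * e z powi k) \<Longrightarrow> of_order k f"
  by (auto simp: of_order_def)

lemma scale_bigo:
  assumes "p \<le> q" "j \<le> i"
  shows "(\<lambda>z. L z ^ p * e z powi i) \<in> O[F](\<lambda>z. L z ^ q * e z powi j)"
proof (rule landau_o.big.mult)
  show "(\<lambda>z. L z ^ p) \<in> O[F](\<lambda>z. L z ^ q)"
    by (rule bigoI[of _ 1], rule eventually_mono[OF eventually_L_ge_1])
       (use assms(1) in \<open>auto intro!: power_increasing\<close>)
  show "(\<lambda>z. e z powi i) \<in> O[F](\<lambda>z. e z powi j)"
    by (rule bigoI[of _ 1], rule eventually_mono[OF eventually_e_bounds])
       (use assms(2) in \<open>auto intro!: power_int_decreasing\<close>)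
qed

lemma of_order_mono: "of_order i f \<Longrightarrow> j \<le> i \<Longrightarrow> of_order j f"
  unfolding of_order_def using scale_bigo[OF order_refl] landau_o.big_trans by blast

lemma of_order_add:
  assumes "of_order k f" "of_order k g"
  shows "of_order k (\<lambda>z. f z + g z)"
proof -
  from assms obtain p q where "f \<in> O[F](\<lambda>z. L z ^ p * e z powi k)" "g \<in> O[F](\<lambda>z. L z ^ q * e z powi k)"
    by (auto simp: of_order_def)
  then have "f \<in> O[F](\<lambda>z. L z ^ (p + q) * e z powi k)" "g \<in> O[F](\<lambda>z. L z ^ (p + q) * e z powi k)"
    by (auto elim: landau_o.big_trans intro!: scale_bigo)
  then show ?thesis by (intro of_orderI sum_in_bigo)
qed

lemma of_order_mult:
  assumes "of_order i f" "of_order j g" "k \<le> i + j"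
  shows "of_order k (\<lambda>z. f z * g z)"
proof -
  from assms obtain p q where "f \<in> O[F](\<lambda>z. L z ^ p * e z powi i)" "g \<in> O[F](\<lambda>z. L z ^ q * e z powi j)"
    by (auto simp: of_order_def)
  then have "(\<lambda>z. f z * g z) \<in> O[F](\<lambda>z. L z ^ p * e z powi i * (L z ^ q * e z powi j))"
    by (rule landau_o.big.mult)
  also have "(\<lambda>z. L z ^ p * e z powi i * (L z ^ q * e z powi j)) \<in> \<Theta>[F](\<lambda>z. L z ^ (p + q) * e z powi (i + j))"
    by (rule bigthetaI_cong, use eventually_e_bounds in eventually_elim)
       (simp add: power_add power_int_add mult_ac)
  finally have "of_order (i + j) (\<lambda>z. f z * g z)" by (rule of_orderI)
  then show ?thesis using assms(3) by (rule of_order_mono)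
qed

lemma of_order_mult_order_0: "of_order 0 f \<Longrightarrow> of_order k g \<Longrightarrow> of_order k (\<lambda>z. f z * g z)"
  by (rule of_order_mult) auto

lemma of_order_bigo_1: "f \<in> O[F](\<lambda>_. 1) \<Longrightarrow> of_order 0 f"
  by (rule of_orderI[where p = 0]) simp

lemma of_order_const: "of_order 0 (\<lambda>_. c)"
  by (rule of_order_bigo_1) simp

lemma of_order_zero: "of_order k (\<lambda>_. 0)"
  by (rule of_orderI) simp

lemma of_order_minus: "of_order k f \<Longrightarrow> of_order k (\<lambda>z. - f z)"
  by (simp add: of_order_def)

lemma of_order_diff: "of_order k f \<Longrightarrow> of_order k g \<Longrightarrow> of_order k (\<lambda>z. f z - g z)"
  using of_order_add[of k f "\<lambda>z. - g z"] by (simp add: of_order_minus)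

lemma of_order_power: "of_order i f \<Longrightarrow> k \<le> int m * i \<Longrightarrow> of_order k (\<lambda>z. f z ^ m)"
proof (rule of_order_mono)
  assume "of_order i f"
  then show "of_order (int m * i) (\<lambda>z. f z ^ m)"
    by (induction m) (auto intro: of_order_const of_order_mult simp: algebra_simps)
qed

lemma of_order_sum: "(\<And>x. x \<in> A \<Longrightarrow> of_order k (f x)) \<Longrightarrow> of_order k (\<lambda>z. \<Sum>x\<in>A. f x z)"
  by (induction A rule: infinite_finite_induct) (auto intro: of_order_zero of_order_add)

lemma of_order_divide: "of_order k f \<Longrightarrow> of_order k (\<lambda>z. f z / c)"
  using of_order_mult_order_0[OF of_order_const[of "1 / c"]] by simp

lemma of_order_L: "of_order 0 L"
  by (rule of_orderI[where p = 1]) simp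

lemma of_order_e_powi: "of_order k (\<lambda>z. e z powi k)"
  by (rule of_orderI[where p = 0]) simp

lemma of_order_cong:
  assumes "of_order k f" "\<forall>\<^sub>F z in F. f z = g z"
  shows "of_order k g"
  using assms unfolding of_order_def by (simp add: landau_o.big.in_cong)

lemma of_order_bound:
  assumes "of_order k g" "\<forall>\<^sub>F z in F. \<bar>f z\<bar> \<le> C * \<bar>g z\<bar>"
  shows "of_order k f"
proof -
  have "f \<in> O[F](g)" using assms(2) by (intro bigoI[of _ C]) simp
  then show ?thesis using assms(1) unfolding of_order_def by (blast intro: landau_o.big_trans)
qed

lemma of_order_trivial_scale:
  assumes "of_order i f" "\<forall>\<^sub>F z in F. 1 \<le> C * (L z * e z)"
  shows "of_order k f"
proof -
  define m where "m = nat (k - i)"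
  have "of_order (int m * 1) (\<lambda>z. (C * (L z * e z)) ^ m)"
    using of_order_e_powi[of 1]
    by (intro of_order_power[where i = 1] of_order_mult_order_0 of_order_const of_order_L) auto
  from of_order_mult[OF assms(1) this, of k] have "of_order k (\<lambda>z. f z * (C * (L z * e z)) ^ m)"
    by (simp add: m_def)
  then show ?thesis
  proof (rule of_order_bound[where C = 1])
    show "\<forall>\<^sub>F z in F. \<bar>f z\<bar> \<le> 1 * \<bar>f z * (C * (L z * e z)) ^ m\<bar>"
      using assms(2)
    proof eventually_elim
      case (elim z)
      then have "\<bar>f z\<bar> * 1 \<le> \<bar>f z\<bar> * (C * (L z * e z)) ^ m" by (intro mult_left_mono one_le_power) auto
      also have "\<dots> = \<bar>f z * (C * (L z * e z)) ^ m\<bar>" using elim by (simp add: abs_mult)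
      finally show ?case by simp
    qed
  qed
qed

lemma asymptotic_scale_restrict: "G \<le> F \<Longrightarrow> asymptotic_scale G L e"
  using eventually_L_ge_1 eventually_e_bounds by (auto simp: asymptotic_scale_def intro: filter_leD)

lemma of_order_restrict: "of_order k f \<Longrightarrow> G \<le> F \<Longrightarrow> asymptotic_scale.of_order G L e k f"
  by (auto simp: of_order_def asymptotic_scale.of_order_def[OF asymptotic_scale_restrict]
      intro: landau_o.big.filter_mono)

lemma of_order_sup:
  assumes "asymptotic_scale G L e" "of_order k f" "asymptotic_scale.of_order G L e k f"
  shows "asymptotic_scale.of_order (sup F G) L e k f"
proof -
  interpret G: asymptotic_scale G L e by (rule assms(1))
  interpret sup: asymptotic_scale "sup F G" L e
    using eventually_L_ge_1 eventually_e_bounds G.eventually_L_ge_1 G.eventually_e_bounds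
    by unfold_locales (auto simp: eventually_sup)
  obtain p q where "f \<in> O[F](\<lambda>z. L z ^ p * e z powi k)" "f \<in> O[G](\<lambda>z. L z ^ q * e z powi k)"
    using assms by (auto simp: of_order_def G.of_order_def)
  then have "f \<in> O[F](\<lambda>z. L z ^ (p + q) * e z powi k)" "f \<in> O[G](\<lambda>z. L z ^ (p + q) * e z powi k)"
    by (auto elim: landau_o.big_trans intro!: scale_bigo G.scale_bigo)
  then show ?thesis by (intro sup.of_orderI landau_o.big.sup)
qed

definition approx :: "int \<Rightarrow> ('a \<Rightarrow> real) \<Rightarrow> ('a \<Rightarrow> real) \<Rightarrow> bool" where
  "approx k f g \<longleftrightarrow> of_order k (\<lambda>z. f z - g z)"

lemma approxI: "of_order k r \<Longrightarrow> \<forall>\<^sub>F z in F. f z = g z + r z \<Longrightarrow> approx k f g"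
  unfolding approx_def by (erule of_order_cong) (auto elim: eventually_mono)

lemma approx_refl: "approx k f f"
  by (simp add: approx_def of_order_zero)

lemma approx_trans [trans]: "approx k f g \<Longrightarrow> approx k g h \<Longrightarrow> approx k f h"
  using of_order_add[of k "\<lambda>z. f z - g z" "\<lambda>z. g z - h z"] by (simp add: approx_def)

lemma approx_mono: "approx i f g \<Longrightarrow> j \<le> i \<Longrightarrow> approx j f g"
  unfolding approx_def by (rule of_order_mono)

lemma approx_add: "approx k f f' \<Longrightarrow> approx k g g' \<Longrightarrow> approx k (\<lambda>z. f z + g z) (\<lambda>z. f' z + g' z)"
  using of_order_add[of k "\<lambda>z. f z - f' z" "\<lambda>z. g z - g' z"] by (simp add: approx_def algebra_simps)

lemma approx_diff: "approx k f f' \<Longrightarrow> approx k g g' \<Longrightarrow> approx k (\<lambda>z. f z - g z) (\<lambda>z. f' z - g' z)"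
  using of_order_diff[of k "\<lambda>z. f z - f' z" "\<lambda>z. g z - g' z"] by (simp add: approx_def algebra_simps)

lemma approx_mult_left:
  "of_order i h \<Longrightarrow> approx j f g \<Longrightarrow> k \<le> i + j \<Longrightarrow> approx k (\<lambda>z. h z * f z) (\<lambda>z. h z * g z)"
  using of_order_mult[of i h j "\<lambda>z. f z - g z" k] by (simp add: approx_def algebra_simps)

lemma approx_mult:
  assumes "approx k f f'" "approx k g g'" "of_order 0 f" "of_order 0 g'"
  shows "approx k (\<lambda>z. f z * g z) (\<lambda>z. f' z * g' z)"
proof -
  have "of_order k (\<lambda>z. f z * (g z - g' z) + g' z * (f z - f' z))"
    using assms by (intro of_order_add of_order_mult_order_0) (auto simp: approx_def)
  then show ?thesis by (simp add: approx_def algebra_simps)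
qed

lemma approx_divide: "approx k f g \<Longrightarrow> approx k (\<lambda>z. f z / c) (\<lambda>z. g z / c)"
  using approx_mult_left[OF of_order_const[of "1 / c"], of k f g k] by simp

lemma approx_of_order: "approx k f g \<Longrightarrow> of_order k g \<Longrightarrow> of_order k f"
  using of_order_add[of k "\<lambda>z. f z - g z" g] by (simp add: approx_def)

lemma approx_exp_taylor:
  assumes X: "of_order 1 X" and bounded: "\<forall>\<^sub>F z in F. \<bar>X z\<bar> \<le> C"
  shows "approx (int (Suc m)) (\<lambda>z. exp (X z)) (\<lambda>z. \<Sum>i\<le>m. X z ^ i / fact i)"
  unfolding approx_def
proof (rule of_order_bound)
  show "of_order (int (Suc m)) (\<lambda>z. X z ^ Suc m)" by (rule of_order_power[OF X]) simp
  show "\<forall>\<^sub>F z in F. \<bar>exp (X z) - (\<Sum>i\<le>m. X z ^ i / fact i)\<bar> \<le> exp C / fact m * \<bar>X z ^ Suc m\<bar>"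
    using bounded
  proof eventually_elim
    case (elim z)
    have "\<bar>exp (X z) - (\<Sum>i\<le>m. X z ^ i / fact i)\<bar> \<le> exp \<bar>X z\<bar> * \<bar>X z\<bar> ^ Suc m / fact m"
      using Taylor_exp_field[of "X z" m] by simp
    also have "\<dots> \<le> exp C * \<bar>X z\<bar> ^ Suc m / fact m"
      using elim by (intro divide_right_mono mult_right_mono) auto
    finally show ?case by (simp add: power_abs abs_mult)
  qed
qed

context
  fixes X X1 X2 X3 X4 :: "'a \<Rightarrow> real"
  assumes X: "approx 5 X (\<lambda>z. X1 z + X2 z + X3 z + X4 z)"
    and orders: "of_order 1 X1" "of_order 2 X2" "of_order 3 X3" "of_order 4 X4"
begin

private lemmas weaken = of_order_mono[OF orders(2), of 1, simplified] of_order_mono[OF orders(3), of 1, simplified]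
  of_order_mono[OF orders(4), of 1, simplified] of_order_mono[OF orders(3), of 2, simplified]
  of_order_mono[OF orders(4), of 2, simplified]

private lemmas mult = of_order_mult[OF orders(1)] of_order_mult[OF orders(2)] of_order_mult[OF orders(3)]
  of_order_mult[OF orders(4)]

lemma of_order_1_graded_sum: "of_order 1 X" "of_order 1 (\<lambda>z. X1 z + X2 z + X3 z + X4 z)"
proof -
  show sum: "of_order 1 (\<lambda>z. X1 z + X2 z + X3 z + X4 z)" by (intro of_order_add orders weaken)
  show "of_order 1 X" by (rule approx_of_order[OF approx_mono[OF X] sum]) simp
qed

lemma approx_graded_square: "approx 5 (\<lambda>z. X z ^ 2) (\<lambda>z. X1 z ^ 2 + 2 * X1 z * X2 z + X2 z ^ 2 + 2 * X1 z * X3 z)"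
proof (rule approxI)
  show "of_order 5 (\<lambda>z. (X z - (X1 z + X2 z + X3 z + X4 z)) * (X z + (X1 z + X2 z + X3 z + X4 z))
      + X4 z * (2 * (X1 z + X2 z + X3 z) + X4 z) + X3 z * (2 * X2 z + X3 z))"
    by (intro of_order_add of_order_mult[OF X[unfolded approx_def], of 1] mult(4)[of 1] mult(3)[of 2]
        of_order_mult_order_0[OF of_order_const] of_order_1_graded_sum(1) orders weaken) simp_all
qed (auto intro!: always_eventually simp: power2_eq_square algebra_simps)

lemma of_order_graded_square:
  "of_order 2 (\<lambda>z. X1 z ^ 2 + 2 * X1 z * X2 z + X2 z ^ 2 + 2 * X1 z * X3 z)"
  "of_order 3 (\<lambda>z. 2 * X1 z * X2 z + X2 z ^ 2 + 2 * X1 z * X3 z)"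
proof -
  have "of_order 3 (\<lambda>z. 2 * (X1 z * X2 z) + X2 z * X2 z + 2 * (X1 z * X3 z))"
    by (intro of_order_add of_order_mult_order_0[OF of_order_const] mult(1)[of 2] mult(2)[of 1]
        orders weaken) simp_all
  then show higher: "of_order 3 (\<lambda>z. 2 * X1 z * X2 z + X2 z ^ 2 + 2 * X1 z * X3 z)"
    by (simp add: power2_eq_square mult.assoc)
  have "of_order 2 (\<lambda>z. X1 z ^ 2)" by (rule of_order_power[OF orders(1)]) simp
  from of_order_add[OF this of_order_mono[OF higher]]
  show "of_order 2 (\<lambda>z. X1 z ^ 2 + 2 * X1 z * X2 z + X2 z ^ 2 + 2 * X1 z * X3 z)"
    by (simp add: add.assoc)
qed

lemma approx_graded_cube: "approx 5 (\<lambda>z. X z ^ 3) (\<lambda>z. X1 z ^ 3 + 3 * X1 z ^ 2 * X2 z)"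
proof (rule approx_trans)
  define Q where "Q z = X1 z ^ 2 + 2 * X1 z * X2 z + X2 z ^ 2 + 2 * X1 z * X3 z" for z
  have Q: "of_order 2 Q" "of_order 3 (\<lambda>z. Q z - X1 z ^ 2)"
    using of_order_graded_square by (simp_all add: Q_def[abs_def] add.assoc)
  show "approx 5 (\<lambda>z. X z ^ 3) (\<lambda>z. X z * Q z)"
    using approx_mult_left[OF of_order_1_graded_sum(1) approx_graded_square, of 5]
    by (simp add: Q_def power3_eq_cube power2_eq_square mult.assoc)
  show "approx 5 (\<lambda>z. X z * Q z) (\<lambda>z. X1 z ^ 3 + 3 * X1 z ^ 2 * X2 z)"
  proof (rule approxI)
    show "of_order 5 (\<lambda>z. (X z - (X1 z + X2 z + X3 z + X4 z)) * Q z + X1 z * (X2 z * X2 z + 2 * (X1 z * X3 z))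
        + X2 z * (Q z - X1 z ^ 2) + X3 z * Q z + X4 z * Q z)"
      by (intro of_order_add of_order_mult[OF X[unfolded approx_def], of 2] mult(1)[of 4] mult(1)[of 3]
          mult(2)[of 3] mult(2)[of 2] mult(3)[of 2] mult(4)[of 2] of_order_mult_order_0[OF of_order_const]
          Q orders weaken) simp_all
  qed (auto intro!: always_eventually simp: Q_def power2_eq_square power3_eq_cube algebra_simps)
qed

lemma approx_graded_fourth: "approx 5 (\<lambda>z. X z ^ 4) (\<lambda>z. X1 z ^ 4)"
proof (rule approxI)
  let ?Q = "\<lambda>z. X1 z ^ 2 + 2 * X1 z * X2 z + X2 z ^ 2 + 2 * X1 z * X3 z"
  have "of_order 2 (\<lambda>z. X z ^ 2)" by (rule of_order_power[OF of_order_1_graded_sum(1)]) simp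
  moreover have "of_order 2 (\<lambda>z. X1 z ^ 2)" by (rule of_order_power[OF orders(1)]) simp
  ultimately show "of_order 5 (\<lambda>z. (X z ^ 2 - ?Q z) * (X z ^ 2 + ?Q z)
      + (2 * X1 z * X2 z + X2 z ^ 2 + 2 * X1 z * X3 z) * (?Q z + X1 z ^ 2))"
    by (intro of_order_add of_order_mult[OF approx_graded_square[unfolded approx_def], of 2]
        of_order_mult[OF of_order_graded_square(2), of 2] of_order_graded_square(1)) simp_all
qed (auto intro!: always_eventually simp: algebra_simps power2_eq_square power4_eq_xxxx)

lemma approx_exp:
  assumes "\<forall>\<^sub>F z in F. \<bar>X z\<bar> \<le> C"
  shows "approx 5 (\<lambda>z. exp (X z)) (\<lambda>z. 1 + X1 z + (X2 z + X1 z ^ 2 / 2) + (X3 z + X1 z * X2 z + X1 z ^ 3 / 6)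
    + (X4 z + X1 z * X3 z + X2 z ^ 2 / 2 + X1 z ^ 2 * X2 z / 2 + X1 z ^ 4 / 24))"
proof (rule approx_trans)
  show "approx 5 (\<lambda>z. exp (X z)) (\<lambda>z. \<Sum>i\<le>4. X z ^ i / fact i)"
    using approx_exp_taylor[OF of_order_1_graded_sum(1) assms, of 4] by simp
  have "(\<lambda>z. \<Sum>i\<le>4. X z ^ i / fact i) = (\<lambda>z. 1 + X z + X z ^ 2 / 2 + X z ^ 3 / 6 + X z ^ 4 / 24)"
    by (simp add: eval_nat_numeral fact_numeral)
  moreover have "approx 5 (\<lambda>z. 1 + X z + X z ^ 2 / 2 + X z ^ 3 / 6 + X z ^ 4 / 24)
    (\<lambda>z. 1 + (X1 z + X2 z + X3 z + X4 z) + (X1 z ^ 2 + 2 * X1 z * X2 z + X2 z ^ 2 + 2 * X1 z * X3 z) / 2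
      + (X1 z ^ 3 + 3 * X1 z ^ 2 * X2 z) / 6 + X1 z ^ 4 / 24)"
    by (intro approx_add approx_divide approx_refl X approx_graded_square approx_graded_cube approx_graded_fourth)
  ultimately show "approx 5 (\<lambda>z. \<Sum>i\<le>4. X z ^ i / fact i) (\<lambda>z. 1 + X1 z + (X2 z + X1 z ^ 2 / 2)
      + (X3 z + X1 z * X2 z + X1 z ^ 3 / 6) + (X4 z + X1 z * X3 z + X2 z ^ 2 / 2
        + X1 z ^ 2 * X2 z / 2 + X1 z ^ 4 / 24))"
    by (simp add: add_divide_distrib add_ac mult_ac)
qed

end

end

section \<open>The Dobinski functional\<close>

interpretation poly: asymptotic_scale top "\<lambda>x::real. 1 + \<bar>x\<bar>" "\<lambda>_. 1"
  by unfold_locales auto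

abbreviation poly_bounded :: "(real \<Rightarrow> real) \<Rightarrow> bool" where
  "poly_bounded \<equiv> poly.of_order 0"

lemma poly_bounded_iff: "poly_bounded f \<longleftrightarrow> (\<exists>C p. C > 0 \<and> (\<forall>x. \<bar>f x\<bar> \<le> C * (1 + \<bar>x\<bar>) ^ p))"
  by (auto simp: poly.of_order_def bigo_def eventually_top power_abs abs_of_nonneg)

lemma poly_bounded_ident: "poly_bounded (\<lambda>x. x)"
  by (rule poly.of_order_bound[OF poly.of_order_L, of _ 1]) (simp add: eventually_top)

lemma poly_bounded_shift:
  assumes "poly_bounded f"
  shows "poly_bounded (\<lambda>x. f (x + a))"
proof -
  obtain C p where C: "C > 0" "\<And>x. \<bar>f x\<bar> \<le> C * (1 + \<bar>x\<bar>) ^ p"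
    using assms by (auto simp: poly_bounded_iff)
  have "\<bar>f (x + a)\<bar> \<le> (C * (1 + \<bar>a\<bar>) ^ p) * (1 + \<bar>x\<bar>) ^ p" for x
  proof -
    have "\<bar>f (x + a)\<bar> \<le> C * (1 + \<bar>x + a\<bar>) ^ p" by (rule C)
    also have "\<dots> \<le> C * ((1 + \<bar>a\<bar>) * (1 + \<bar>x\<bar>)) ^ p"
      using C(1) by (intro mult_left_mono power_mono order_trans[OF add_left_mono[OF abs_triangle_ineq]])
        (auto simp: algebra_simps)
    finally show ?thesis by (simp add: power_mult_distrib mult.assoc)
  qed
  then show ?thesis using C(1) unfolding poly_bounded_iff
    by (intro exI[of _ "C * (1 + \<bar>a\<bar>) ^ p"] exI[of _ p]) (auto simp: zero_less_mult_iff)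
qed

lemma poly_bounded_shift_minus: "poly_bounded f \<Longrightarrow> poly_bounded (\<lambda>x. f (x - a))"
  using poly_bounded_shift[of f "- a"] by simp

lemmas poly_bounded_intros = poly_bounded_ident poly.of_order_const poly.of_order_add
  poly.of_order_diff poly.of_order_minus poly.of_order_mult_order_0 poly.of_order_sum
  poly.of_order_power[where i = 0 and k = 0, simplified]

definition dobinski_sum :: "(real \<Rightarrow> real) \<Rightarrow> real" where
  "dobinski_sum f = (\<Sum>k. f (real k) / fact k)"

lemma power_le_fact_mult_exp:
  fixes x :: real
  assumes "0 \<le> x"
  shows "x ^ p \<le> fact p * exp x"
proof -
  have exp: "(\<lambda>m. x ^ m / fact m) sums exp x"
    using exp_converges[of x] by (simp add: divide_inverse mult.commute)
  have "(\<Sum>m\<in>{p}. x ^ m / fact m) \<le> (\<Sum>m. x ^ m / fact m)"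
    using exp assms by (intro sum_le_suminf) (auto simp: sums_iff)
  then have "x ^ p / fact p \<le> exp x" using exp by (simp add: sums_iff)
  then show ?thesis by (simp add: divide_le_eq mult.commute)
qed

lemma summable_dobinski_sum:
  assumes "poly_bounded f"
  shows "summable (\<lambda>k. f (real k) / fact k)"
proof -
  obtain C p where C: "C > 0" "\<And>x. \<bar>f x\<bar> \<le> C * (1 + \<bar>x\<bar>) ^ p"
    using assms by (auto simp: poly_bounded_iff)
  have "summable (\<lambda>k. C * fact p * exp 1 * (exp 1 ^ k / fact k) :: real)"
    using summable_exp[of "exp 1 :: real"]
    by (intro summable_mult) (simp add: divide_inverse mult.commute)
  then show ?thesis
  proof (rule summable_comparison_test')
    fix k :: nat
    have "\<bar>f (real k)\<bar> \<le> C * (1 + real k) ^ p" using C(2)[of "real k"] by simp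
    also have "\<dots> \<le> C * (fact p * exp (1 + real k))"
      using C(1) by (intro mult_left_mono power_le_fact_mult_exp) auto
    also have "\<dots> = C * fact p * exp 1 * exp 1 ^ k" by (simp add: exp_add exp_of_nat_mult[symmetric])
    finally show "norm (f (real k) / fact k) \<le> C * fact p * exp 1 * (exp 1 ^ k / fact k)"
      by (simp add: divide_right_mono)
  qed
qed

lemma dobinski_sum_cong: "(\<And>k. f (real k) = g (real k)) \<Longrightarrow> dobinski_sum f = dobinski_sum g"
  by (simp add: dobinski_sum_def)

lemma dobinski_sum_add:
  "poly_bounded f \<Longrightarrow> poly_bounded g \<Longrightarrow> dobinski_sum (\<lambda>x. f x + g x) = dobinski_sum f + dobinski_sum g"
  unfolding dobinski_sum_def by (simp add: add_divide_distrib suminf_add summable_dobinski_sum)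

lemma dobinski_sum_cmult: "poly_bounded f \<Longrightarrow> dobinski_sum (\<lambda>x. c * f x) = c * dobinski_sum f"
  unfolding dobinski_sum_def using suminf_mult[OF summable_dobinski_sum, of f c] by simp

lemma dobinski_sum_diff:
  "poly_bounded f \<Longrightarrow> poly_bounded g \<Longrightarrow> dobinski_sum (\<lambda>x. f x - g x) = dobinski_sum f - dobinski_sum g"
  using dobinski_sum_add[of f "\<lambda>x. - 1 * g x"] dobinski_sum_cmult[of g "- 1"]
  by (simp add: poly.of_order_minus)

lemma dobinski_sum_sum:
  "(\<And>i. i \<in> I \<Longrightarrow> poly_bounded (f i)) \<Longrightarrow> dobinski_sum (\<lambda>x. \<Sum>i\<in>I. f i x) = (\<Sum>i\<in>I. dobinski_sum (f i))"
  by (induction I rule: infinite_finite_induct)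
     (simp_all add: dobinski_sum_add poly.of_order_sum, simp_all add: dobinski_sum_def)

lemma dobinski_sum_mono:
  assumes "poly_bounded f" "poly_bounded g" "\<And>k. f (real k) \<le> g (real k)"
  shows "dobinski_sum f \<le> dobinski_sum g"
  unfolding dobinski_sum_def using assms
  by (intro suminf_le summable_dobinski_sum divide_right_mono) auto

lemma dobinski_sum_one: "dobinski_sum (\<lambda>_. 1) = exp 1"
  unfolding dobinski_sum_def exp_def by (simp add: divide_inverse)

lemma dobinski_sum_shift:
  assumes "poly_bounded f"
  shows "dobinski_sum (\<lambda>x. x * f (x - 1)) = dobinski_sum f"
proof -
  have "poly_bounded (\<lambda>x. x * f (x - 1))" by (intro poly_bounded_intros poly_bounded_shift_minus assms)
  from suminf_split_head[OF summable_dobinski_sum[OF this]]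
  have "dobinski_sum (\<lambda>x. x * f (x - 1)) = (\<Sum>k. real (Suc k) * f (real (Suc k) - 1) / fact (Suc k))"
    by (simp add: dobinski_sum_def)
  also have "\<dots> = dobinski_sum f"
    unfolding dobinski_sum_def
  proof (rule suminf_cong)
    fix k
    have "real (Suc k) - 1 = real k" by simp
    then show "real (Suc k) * f (real (Suc k) - 1) / fact (Suc k) = f (real k) / fact k"
      by (simp only: fact_Suc) (simp del: of_nat_Suc)
  qed
  finally show ?thesis .
qed

definition fwd_diff :: "(real \<Rightarrow> real) \<Rightarrow> real \<Rightarrow> real" where
  "fwd_diff f x = f (x + 1) - f x"

lemma poly_bounded_fwd_diff: "poly_bounded f \<Longrightarrow> poly_bounded ((fwd_diff ^^ m) f)"
  by (induction m) (auto simp: fwd_diff_def[abs_def]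
      intro!: poly_bounded_intros intro: poly_bounded_shift poly_bounded_shift_minus)

lemma fwd_diff_funpow_Suc: "(fwd_diff ^^ Suc j) f x = (fwd_diff ^^ j) f (x + 1) - (fwd_diff ^^ j) f x"
  by (simp add: fwd_diff_def)

lemma fwd_diff_funpow_mult:
  "(fwd_diff ^^ j) (\<lambda>x. x * f x) x = x * (fwd_diff ^^ j) f x + real j * (fwd_diff ^^ (j - 1)) f (x + 1)"
proof (induction j arbitrary: x)
  case (Suc j)
  have "(fwd_diff ^^ Suc j) (\<lambda>x. x * f x) x =
      (x + 1) * (fwd_diff ^^ j) f (x + 1) - x * (fwd_diff ^^ j) f x
      + real j * ((fwd_diff ^^ (j - 1)) f (x + 1 + 1) - (fwd_diff ^^ (j - 1)) f (x + 1))"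
    by (simp only: fwd_diff_funpow_Suc Suc.IH) (simp add: algebra_simps)
  also have "real j * ((fwd_diff ^^ (j - 1)) f (x + 1 + 1) - (fwd_diff ^^ (j - 1)) f (x + 1)) =
      real j * (fwd_diff ^^ j) f (x + 1)"
    by (cases j) (simp, simp only: fwd_diff_funpow_Suc diff_Suc_1)
  finally show ?case by (simp only: fwd_diff_funpow_Suc) (simp add: algebra_simps)
qed simp

text \<open>Conjugate by a shift of the operator whose eigenfunctions are the Charlier polynomials.\<close>

definition charlier_op :: "(real \<Rightarrow> real) \<Rightarrow> real \<Rightarrow> real" where
  "charlier_op f x = (x - 1) * (f x - f (x - 1)) - (f (x + 1) - f x)"

lemma poly_bounded_charlier_op: "poly_bounded f \<Longrightarrow> poly_bounded ((charlier_op ^^ m) f)"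
  by (induction m) (auto simp: charlier_op_def[abs_def]
      intro!: poly_bounded_intros intro: poly_bounded_shift poly_bounded_shift_minus)

lemma fwd_diff_funpow_charlier_op:
  "(fwd_diff ^^ j) (charlier_op f) x = charlier_op ((fwd_diff ^^ j) f) x + real j * (fwd_diff ^^ j) f x"
proof (induction j arbitrary: x)
  case (Suc j)
  have shifts: "x + 1 - 1 = x" "x - 1 + 1 = x" by simp_all
  show ?case
    unfolding fwd_diff_funpow_Suc[of j "charlier_op f"] Suc.IH charlier_op_def[of "(fwd_diff ^^ _) f"]
    unfolding fwd_diff_funpow_Suc shifts
    by (simp add: algebra_simps)
qed simp

lemma dobinski_sum_charlier_op:
  assumes f: "poly_bounded f"
  shows "dobinski_sum (\<lambda>x. x * charlier_op f x) = 0"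
proof -
  note intros = poly_bounded_intros poly_bounded_shift[OF f] poly_bounded_shift_minus[OF f] f
  have "dobinski_sum (\<lambda>x. x * charlier_op f x) =
      dobinski_sum (\<lambda>x. x * (x * f x - f (x + 1)) - x * ((x - 1) * f (x - 1)))"
    by (simp add: charlier_op_def algebra_simps)
  also have "\<dots> = dobinski_sum (\<lambda>x. x * (x * f x - f (x + 1))) - dobinski_sum (\<lambda>x. x * f x)"
    using dobinski_sum_shift[of "\<lambda>x. x * f x"] by (subst dobinski_sum_diff) (simp_all add: intros)
  also have "dobinski_sum (\<lambda>x. x * (x * f x - f (x + 1))) =
      dobinski_sum (\<lambda>x. x * (x * f x)) - dobinski_sum (\<lambda>x. x * f (x + 1))"
    by (simp add: right_diff_distrib) (intro dobinski_sum_diff intros)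
  also have "dobinski_sum (\<lambda>x. x * (x * f x)) = dobinski_sum (\<lambda>x. (x + 1) * f (x + 1))"
    using dobinski_sum_shift[of "\<lambda>x. (x + 1) * f (x + 1)"] by (simp add: intros)
  also have "\<dots> = dobinski_sum (\<lambda>x. x * f (x + 1)) + dobinski_sum (\<lambda>x. f (x + 1))"
    by (simp add: distrib_right) (intro dobinski_sum_add intros)
  also have "dobinski_sum (\<lambda>x. f (x + 1)) = dobinski_sum (\<lambda>x. x * f x)"
    using dobinski_sum_shift[of "\<lambda>x. f (x + 1)"] by (simp add: intros)
  finally show ?thesis by simp
qed

lemma dobinski_sum_shift_mult:
  "poly_bounded f \<Longrightarrow> dobinski_sum (\<lambda>x. f (x + 1)) = dobinski_sum (\<lambda>x. x * f x)"
  using dobinski_sum_shift[OF poly_bounded_shift, of f 1] by simp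

lemma dobinski_sum_fwd_diff_Suc:
  assumes "poly_bounded g"
  shows "dobinski_sum ((fwd_diff ^^ j) g) + dobinski_sum ((fwd_diff ^^ Suc j) g) =
    dobinski_sum (\<lambda>x. x * (fwd_diff ^^ j) g x)"
proof -
  have g: "poly_bounded ((fwd_diff ^^ j) g)" by (rule poly_bounded_fwd_diff[OF assms])
  have "dobinski_sum ((fwd_diff ^^ Suc j) g) =
      dobinski_sum (\<lambda>x. (fwd_diff ^^ j) g (x + 1)) - dobinski_sum ((fwd_diff ^^ j) g)"
    unfolding fwd_diff_funpow_Suc by (intro dobinski_sum_diff poly_bounded_shift g)
  then show ?thesis using dobinski_sum_shift_mult[OF g] by simp
qed

lemma dobinski_sum_fwd_diff_mult:
  assumes "poly_bounded f"
  shows "dobinski_sum ((fwd_diff ^^ j) (\<lambda>x. x * f x)) =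
    dobinski_sum (\<lambda>x. x * (fwd_diff ^^ j) f x) + real j * dobinski_sum (\<lambda>x. x * (fwd_diff ^^ (j - 1)) f x)"
proof -
  note f = poly_bounded_fwd_diff[OF assms]
  have "dobinski_sum ((fwd_diff ^^ j) (\<lambda>x. x * f x)) =
      dobinski_sum (\<lambda>x. x * (fwd_diff ^^ j) f x) + dobinski_sum (\<lambda>x. real j * (fwd_diff ^^ (j - 1)) f (x + 1))"
    unfolding fwd_diff_funpow_mult by (intro dobinski_sum_add poly_bounded_intros poly_bounded_shift f)
  also have "dobinski_sum (\<lambda>x. real j * (fwd_diff ^^ (j - 1)) f (x + 1)) =
      real j * dobinski_sum (\<lambda>x. (fwd_diff ^^ (j - 1)) f (x + 1))"
    by (intro dobinski_sum_cmult poly_bounded_shift f)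
  finally show ?thesis by (simp only: dobinski_sum_shift_mult[OF f])
qed

lemma dobinski_sum_fwd_diff_charlier_op:
  assumes "poly_bounded f"
  shows "dobinski_sum (\<lambda>x. x * (fwd_diff ^^ j) ((charlier_op ^^ m) f) x) =
    real j ^ m * dobinski_sum (\<lambda>x. x * (fwd_diff ^^ j) f x)"
proof (induction m)
  case (Suc m)
  define h where "h = (charlier_op ^^ m) f"
  have h: "poly_bounded h" unfolding h_def by (rule poly_bounded_charlier_op[OF assms])
  have "dobinski_sum (\<lambda>x. x * (fwd_diff ^^ j) (charlier_op h) x) =
      dobinski_sum (\<lambda>x. x * charlier_op ((fwd_diff ^^ j) h) x + real j * (x * (fwd_diff ^^ j) h x))"
    by (simp add: fwd_diff_funpow_charlier_op algebra_simps)
  also have "\<dots> = dobinski_sum (\<lambda>x. x * charlier_op ((fwd_diff ^^ j) h) x) +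
      real j * dobinski_sum (\<lambda>x. x * (fwd_diff ^^ j) h x)"
    using poly_bounded_charlier_op[OF poly_bounded_fwd_diff[OF h], of 1] poly_bounded_fwd_diff[OF h]
    by (simp add: dobinski_sum_add dobinski_sum_cmult poly_bounded_intros)
  finally show ?case
    using Suc dobinski_sum_charlier_op[OF poly_bounded_fwd_diff[OF h, of j]] by (simp add: h_def)
qed simp

section \<open>Moments of the dimension exponent\<close>

lemma open_sum_cmult: "open_sum n (\<lambda>d j. c * f d j) = c * open_sum n f"
  by (simp add: open_sum_def sum_distrib_left)

lemma open_sum_sum: "open_sum n (\<lambda>d j. \<Sum>i\<in>I. f i d j) = (\<Sum>i\<in>I. open_sum n (f i))"
  unfolding open_sum_def sum.swap[of _ I] by (simp add: sum.swap[of _ I])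

text \<open>Replacing the number \<open>j\<close> of open blocks by a sum over \<open>j\<close>-th differences turns multiplication
  by \<open>j\<close> into \<open>charlier_op\<close>. For \<open>g = 1\<close> only the closed partitions, those with \<open>j = 0\<close>, contribute.\<close>

definition open_moment :: "nat \<Rightarrow> nat \<Rightarrow> (real \<Rightarrow> real) \<Rightarrow> real" where
  "open_moment i n g = open_sum n (\<lambda>d j. d ^ i * dobinski_sum ((fwd_diff ^^ j) g))"

lemma open_moment_0_index: "open_moment i 0 g = 0 ^ i * dobinski_sum g"
  by (simp add: open_moment_def open_sum_0)

lemma open_moment_Suc:
  assumes g: "poly_bounded g"
  shows "open_moment i (Suc n) g =
    (\<Sum>m\<le>i. real (i choose m) * open_moment (i - m) n (\<lambda>x. x * (charlier_op ^^ m) g x))"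
proof -
  define l where "l j = dobinski_sum (\<lambda>x. x * (fwd_diff ^^ j) g x)" for j
  have l: "dobinski_sum ((fwd_diff ^^ j) g) + dobinski_sum ((fwd_diff ^^ Suc j) g) = l j" for j
    unfolding l_def by (rule dobinski_sum_fwd_diff_Suc[OF g])
  have power: "real j ^ m * l j + real j * (real j - 1) ^ m * l (j - 1) =
      dobinski_sum ((fwd_diff ^^ j) (\<lambda>x. x * (charlier_op ^^ m) g x))" for j m
    unfolding dobinski_sum_fwd_diff_mult[OF poly_bounded_charlier_op[OF g]]
      dobinski_sum_fwd_diff_charlier_op[OF g] l_def[symmetric] by (cases j) simp_all
  have "(d + real j) ^ i * l j + real j * (d + (real j - 1)) ^ i * l (j - 1) =
      (\<Sum>m\<le>i. real (i choose m) * (d ^ (i - m) * (real j ^ m * l j + real j * (real j - 1) ^ m * l (j - 1))))"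
    for d j
    unfolding add.commute[of d] binomial_ring
    by (simp add: sum_distrib_left sum_distrib_right sum.distrib[symmetric] algebra_simps)
  note binomial = this[unfolded power]
  have "(d + real j) ^ i * dobinski_sum ((fwd_diff ^^ j) g)
      + (d + real j) ^ i * dobinski_sum ((fwd_diff ^^ Suc j) g)
      + real j * ((d + real j - 1) ^ i * dobinski_sum ((fwd_diff ^^ (j - 1)) g)
        + (d + real j - 1) ^ i * dobinski_sum ((fwd_diff ^^ j) g)) =
      (d + real j) ^ i * l j + real j * (d + (real j - 1)) ^ i * l (j - 1)" for d j
    unfolding l[symmetric] by (cases j) (simp_all add: algebra_simps)
  then show ?thesis
    unfolding open_moment_def open_sum_Suc binomial by (simp only: binomial open_sum_sum open_sum_cmult)
qed

lemma sum_dim_exponent_power: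
  "(\<Sum>P\<in>set_partitions n. real_of_int (dim_exponent n P) ^ i) = open_moment i n (\<lambda>_. 1) / exp 1"
proof -
  have "dobinski_sum ((fwd_diff ^^ j) (\<lambda>_. 1)) = (if j = 0 then exp 1 else 0)" for j
  proof -
    have "(fwd_diff ^^ Suc m) (\<lambda>_. 1) = (\<lambda>_. 0)" for m
      by (induction m) (auto simp: fwd_diff_def[abs_def])
    then show ?thesis
      by (cases j) (simp_all only: dobinski_sum_one funpow_0 if_True nat.distinct if_False,
          simp_all add: dobinski_sum_def)
  qed
  then have "open_moment i n (\<lambda>_. 1) = open_sum n (\<lambda>d j. exp 1 * (if j = 0 then d ^ i else 0))"
    unfolding open_moment_def by (auto simp: fun_eq_iff intro!: arg_cong[of _ _ "open_sum n"])
  also have "\<dots> = exp 1 * (\<Sum>P\<in>set_partitions n. real_of_int (dim_exponent n P) ^ i)"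
    unfolding open_sum_cmult by (simp only: sum_dim_exponent_eq_open_sum[where g = "\<lambda>d. d ^ i"])
  finally show ?thesis by simp
qed

text \<open>The formulas solve the recurrence \<open>moment_op_add_1\<close>; the last one is meaningful only for the third
  moment, \<open>i = 0\<close>.\<close>

fun moment_op :: "nat \<Rightarrow> real \<Rightarrow> (real \<Rightarrow> real) \<Rightarrow> real \<Rightarrow> real" where
  "moment_op 0 N g x = g x"
| "moment_op (Suc 0) N g x = x * g (x + 1) + (N*x - x^2 + 2*x) * g x - (x^2 - x) * g (x - 1)"
| "moment_op (Suc (Suc 0)) N g x =
     (x^2 + 1/2*x) * g (x + 2) + (2*N*x^2 - 2*x^3 + 2*x^2 - x) * g (x + 1)
     + (N^2*x^2 - 2*N*x^3 + 4*N*x^2 - 4*N*x + N + x^4 - 11/2*x^3 + 3/2*x^2 - 5/2*x) * g x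
     + (- 2*N*x^3 + 2*N*x^2 + 2*x^4 - 4*x^3 + x^2 + x) * g (x - 1)
     + (x^4 - 7/2*x^3 + 7/2*x^2 - x) * g (x - 2)"
| "moment_op (Suc (Suc (Suc i))) N g x =
     (x^3 + 3/2*x^2 + 1/3*x) * g (x + 3)
     + (3*N*x^3 + 3/2*N*x^2 - 3*x^4 - 3/2*x^3 - 9/2*x^2 - 3/2*x) * g (x + 2)
     + (3*N^2*x^3 - 6*N*x^4 + 6*N*x^3 - 15*N*x^2 + 3*N*x + 3*x^5 - 15/2*x^4 - 3*x^3 - 6*x^2 + 4*x) * g (x + 1)
     + (N^3*x^3 - 3*N^2*x^4 + 6*N^2*x^3 - 12*N^2*x^2 + 3*N^2*x + 3*N*x^5 - 33/2*N*x^4 + 33/2*N*x^3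
        - 33/2*N*x^2 + N - x^6 + 21/2*x^5 - 7/3*x^4 + 9/2*x^3 + 58/3*x^2 - 19/6*x) * g x
     + (- 3*N^2*x^4 + 3*N^2*x^3 + 6*N*x^5 - 12*N*x^4 + 15*N*x^3 - 12*N*x^2 + 3*N*x - 3*x^6 + 21/2*x^5
        - 9/2*x^4 + 9/2*x^3 - 17/2*x^2 + x) * g (x - 1)
     + (3*N*x^5 - 21/2*N*x^4 + 21/2*N*x^3 - 3*N*x^2 - 3*x^6 + 21/2*x^5 - 6*x^4 - 12*x^3 + 27/2*x^2
        - 3*x) * g (x - 2)
     + (- 1*x^6 + 15/2*x^5 - 61/3*x^4 + 49/2*x^3 - 38/3*x^2 + 2*x) * g (x - 3)"

lemma nat_le_3_cases:
  fixes i :: nat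
  assumes "i \<le> 3"
  obtains "i = 0" | "i = Suc 0" | "i = Suc (Suc 0)" | "i = Suc (Suc (Suc 0))"
  using assms by linarith

lemma poly_bounded_moment_op:
  assumes "i \<le> 3" and g: "poly_bounded g"
  shows "poly_bounded (moment_op i N g)"
  using assms(1)
  by (cases rule: nat_le_3_cases)
     (simp_all only: moment_op.simps[abs_def] poly_bounded_intros poly_bounded_shift[OF g]
       poly_bounded_shift_minus[OF g] g)

lemma moment_op_add_1:
  assumes "i \<le> 3"
  shows "x * moment_op i (N + 1) g x =
    (\<Sum>m\<le>i. real (i choose m) * moment_op (i - m) N (\<lambda>x. x * (charlier_op ^^ m) g x) x)"
proof -
  have shifts: "y + 1 - 1 = y" "y - 1 + 1 = y" "y + 1 + 1 = y + 2" "y - 1 - 1 = y - 2" "y + 2 + 1 = y + 3"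
     "y + 2 - 1 = y + 1" "y - 2 + 1 = y - 1" "y - 2 - 1 = y - 3" "y + 1 - 2 = y - 1" "y + 1 + 2 = y + 3"
     "y - 1 - 2 = y - 3" "y - 1 + 2 = y + 1" for y :: real by simp_all
  show ?thesis
    using assms
  proof (cases rule: nat_le_3_cases)
    case 1
    then show ?thesis by simp
  next
    case 2
    have sum: "(\<Sum>m\<le>i. real (i choose m) * moment_op (i - m) N (\<lambda>x. x * (charlier_op ^^ m) g x) x) =
        moment_op (Suc 0) N (\<lambda>x. x * g x) x + x * charlier_op g x"
      unfolding 2 by (simp del: moment_op.simps(2))
    show ?thesis unfolding sum unfolding 2 moment_op.simps charlier_op_def by algebra
  next
    case 3
    have sum: "(\<Sum>m\<le>i. real (i choose m) * moment_op (i - m) N (\<lambda>x. x * (charlier_op ^^ m) g x) x) =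
        moment_op (Suc (Suc 0)) N (\<lambda>x. x * g x) x + 2 * moment_op (Suc 0) N (\<lambda>x. x * charlier_op g x) x
        + x * charlier_op (charlier_op g) x"
      unfolding 3 by (simp del: moment_op.simps(2,3))
    show ?thesis unfolding sum unfolding 3 moment_op.simps charlier_op_def shifts by algebra
  next
    case 4
    have sum: "(\<Sum>m\<le>i. real (i choose m) * moment_op (i - m) N (\<lambda>x. x * (charlier_op ^^ m) g x) x) =
        moment_op (Suc (Suc (Suc 0))) N (\<lambda>x. x * g x) x
        + 3 * moment_op (Suc (Suc 0)) N (\<lambda>x. x * charlier_op g x) x
        + 3 * moment_op (Suc 0) N (\<lambda>x. x * charlier_op (charlier_op g) x) x
        + x * charlier_op (charlier_op (charlier_op g)) x"
      unfolding 4 by (simp del: moment_op.simps(2-4))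
    show ?thesis unfolding sum unfolding 4 moment_op.simps charlier_op_def shifts by algebra
  qed
qed

lemma dobinski_sum_telescope:
  assumes "poly_bounded f" "\<And>x. h x = f x - x * f (x - 1)"
  shows "dobinski_sum h = 0"
proof -
  have "h = (\<lambda>x. f x - x * f (x - 1))" using assms(2) by auto
  then have "dobinski_sum h = dobinski_sum f - dobinski_sum (\<lambda>x. x * f (x - 1))"
    using assms(1) by (simp add: dobinski_sum_diff poly_bounded_intros poly_bounded_shift_minus)
  then show ?thesis by (simp add: dobinski_sum_shift[OF assms(1)])
qed

lemma dobinski_sum_moment_op_0:
  assumes "i \<le> 3" and g: "poly_bounded g"
  shows "dobinski_sum (moment_op i 0 g) = 0 ^ i * dobinski_sum g"
proof -
  note intros = poly_bounded_intros poly_bounded_shift[OF g] poly_bounded_shift_minus[OF g] g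
  have shifts: "x - 1 + 1 = x" "x - 1 + 2 = x + 1" "x - 1 + 3 = x + 2" "x - 1 - 1 = x - 2" "x - 1 - 2 = x - 3"
    for x :: real by simp_all
  note expand = moment_op.simps shifts mult_zero_left mult_zero_right power_zero_numeral
  show ?thesis
    using assms(1)
  proof (cases rule: nat_le_3_cases)
    case 1
    then show ?thesis by (simp add: moment_op.simps[abs_def])
  next
    case 2
    have "dobinski_sum (moment_op (Suc 0) 0 g) = 0"
      by (rule dobinski_sum_telescope[of "\<lambda>x. x * g (x + 1) + x * g x"])
         (intro intros, simp only: expand, algebra)
    then show ?thesis by (simp add: 2)
  next
    case 3
    have "dobinski_sum (moment_op (Suc (Suc 0)) 0 g) = 0"
      by (rule dobinski_sum_telescope[of "\<lambda>x. (x^2 + 1/2*x) * g (x + 2) + (- 1*x^3 + 1/2*x^2 - 1/2*x) * g (x + 1)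
            + (- 2*x^3 - 3*x^2 - 1/2*x) * g x + (- 1*x^3 + 1/2*x^2 + 1/2*x) * g (x - 1)"])
         (intro intros, simp only: expand, algebra)
    then show ?thesis by (simp add: 3)
  next
    case 4
    have "dobinski_sum (moment_op (Suc (Suc (Suc 0))) 0 g) = 0"
      by (rule dobinski_sum_telescope[of "\<lambda>x. (x^3 + 3/2*x^2 + 1/3*x) * g (x + 3)
            + (- 2*x^4 - 3*x^3 - 25/6*x^2 - 4/3*x) * g (x + 2) + (x^5 - 5/2*x^4 - 61/6*x^3 + 13/6*x) * g (x + 1)
            + (3*x^5 + 15/2*x^4 + 10*x^3 + 6*x^2 + 4/3*x) * g x
            + (3*x^5 + 11/2*x^4 - 9/2*x^3 - 25/6*x^2 + 1/6*x) * g (x - 1)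
            + (x^5 - 5/2*x^4 + 1/3*x^3 + 3/2*x^2 - 1/3*x) * g (x - 2)"])
         (intro intros, simp only: expand, algebra)
    then show ?thesis by (simp add: 4)
  qed
qed

lemma open_moment_eq_dobinski_sum:
  assumes "i \<le> 3" "poly_bounded g"
  shows "open_moment i n g = dobinski_sum (\<lambda>x. x ^ n * moment_op i (real n) g x)"
  using assms
proof (induction n arbitrary: i g)
  case 0
  then show ?case by (simp add: open_moment_0_index dobinski_sum_moment_op_0)
next
  case (Suc n)
  let ?h = "\<lambda>m x. x * (charlier_op ^^ m) g x"
  have h: "poly_bounded (?h m)" for m
    using Suc.prems by (intro poly_bounded_intros poly_bounded_charlier_op)
  have "open_moment i (Suc n) g = (\<Sum>m\<le>i. real (i choose m) *
      dobinski_sum (\<lambda>x. x ^ n * moment_op (i - m) (real n) (?h m) x))"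
    using Suc h by (simp add: open_moment_Suc)
  also have "\<dots> = dobinski_sum (\<lambda>x. \<Sum>m\<le>i. real (i choose m) * (x ^ n * moment_op (i - m) (real n) (?h m) x))"
    using Suc.prems h by (simp add: dobinski_sum_sum dobinski_sum_cmult poly_bounded_intros poly_bounded_moment_op)
  also have "\<dots> = dobinski_sum (\<lambda>x. x ^ Suc n * moment_op i (real (Suc n)) g x)"
  proof (rule dobinski_sum_cong)
    fix k
    have "real k ^ Suc n * moment_op i (real (Suc n)) g k = real k ^ n * (real k * moment_op i (real n + 1) g k)"
      by (simp add: add.commute)
    then show "(\<Sum>m\<le>i. real (i choose m) * (real k ^ n * moment_op (i - m) (real n) (?h m) k)) =
        real k ^ Suc n * moment_op i (real (Suc n)) g k"
      unfolding moment_op_add_1[OF Suc.prems(1)] sum_distrib_left by (simp only: mult.left_commute)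
  qed
  finally show ?case .
qed

text \<open>The expectation of \<open>f\<close> when \<open>k\<close> has probability proportional to \<open>k ^ n / k!\<close>.\<close>

definition mean :: "nat \<Rightarrow> (real \<Rightarrow> real) \<Rightarrow> real" where
  "mean n f = dobinski_sum (\<lambda>x. x ^ n * f x) / dobinski_sum (\<lambda>x. x ^ n)"

lemma Bell_eq_dobinski_sum: "real (Bell n) = dobinski_sum (\<lambda>x. x ^ n) / exp 1"
  using sum_dim_exponent_power[where n = n and i = 0] open_moment_eq_dobinski_sum[of 0 "\<lambda>_. 1" n]
  by (simp add: Bell_def poly.of_order_const)

lemma Bell_pos: "Bell n > 0"
proof -
  have "set_partitions n \<noteq> {}"
    using partition_on_singletons[of "{1..n}"] unfolding set_partitions_def by blast
  then show ?thesis by (simp add: Bell_def card_gt_0_iff finite_set_partitions)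
qed

lemma dobinski_sum_power_pos: "dobinski_sum (\<lambda>x. x ^ n) > 0"
proof -
  have "dobinski_sum (\<lambda>x. x ^ n) = exp 1 * real (Bell n)" by (simp add: Bell_eq_dobinski_sum)
  then show ?thesis using Bell_pos[of n] by simp
qed

lemma mean_add: "poly_bounded f \<Longrightarrow> poly_bounded g \<Longrightarrow> mean n (\<lambda>x. f x + g x) = mean n f + mean n g"
  by (simp add: mean_def distrib_left dobinski_sum_add poly_bounded_intros add_divide_distrib)

lemma mean_diff: "poly_bounded f \<Longrightarrow> poly_bounded g \<Longrightarrow> mean n (\<lambda>x. f x - g x) = mean n f - mean n g"
  by (simp add: mean_def right_diff_distrib dobinski_sum_diff poly_bounded_intros diff_divide_distrib)

lemma mean_cmult: "poly_bounded f \<Longrightarrow> mean n (\<lambda>x. c * f x) = c * mean n f"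
  by (simp add: mean_def mult.left_commute[of _ c] dobinski_sum_cmult poly_bounded_intros)

lemma mean_const: "mean n (\<lambda>_. c) = c"
  using mean_cmult[OF poly.of_order_const, of n c 1] dobinski_sum_power_pos[of n] by (simp add: mean_def)

lemma mean_sum: "(\<And>i. i \<in> I \<Longrightarrow> poly_bounded (f i)) \<Longrightarrow> mean n (\<lambda>x. \<Sum>i\<in>I. f i x) = (\<Sum>i\<in>I. mean n (f i))"
  by (simp add: mean_def sum_distrib_left dobinski_sum_sum poly_bounded_intros sum_divide_distrib)

lemmas mean_linear = mean_add mean_diff mean_cmult mean_const

lemma mean_mono:
  assumes "poly_bounded f" "poly_bounded g" "n > 0" "\<And>k. k > 0 \<Longrightarrow> f (real k) \<le> g (real k)"
  shows "mean n f \<le> mean n g"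
proof -
  have "real k ^ n * f (real k) \<le> real k ^ n * g (real k)" for k
    using assms(3,4) by (cases "k = 0") (auto intro: mult_left_mono simp: power_0_left)
  then have "dobinski_sum (\<lambda>x. x ^ n * f x) \<le> dobinski_sum (\<lambda>x. x ^ n * g x)"
    using assms(1,2) by (intro dobinski_sum_mono poly_bounded_intros)
  then show ?thesis
    unfolding mean_def using dobinski_sum_power_pos[of n] by (simp add: divide_right_mono)
qed

lemma mean_abs_le:
  assumes "poly_bounded f" "poly_bounded g" "n > 0" "\<And>k. k > 0 \<Longrightarrow> \<bar>f (real k)\<bar> \<le> g (real k)"
  shows "\<bar>mean n f\<bar> \<le> mean n g"
proof -
  have "f (real k) \<le> g (real k)" "- 1 * g (real k) \<le> f (real k)" if "k > 0" for k
    using assms(4)[OF that] by auto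
  then have "mean n f \<le> mean n g" "mean n (\<lambda>x. - 1 * g x) \<le> mean n f"
    using assms(1-3) by (auto intro!: mean_mono poly_bounded_intros simp del: mult_minus1)
  then show ?thesis using mean_cmult[OF assms(2), of n "- 1"] by simp
qed

text \<open>The cumulants of the dimension exponent, conditionally on the random variable \<open>k\<close> averaged by
  \<open>mean\<close>.\<close>

definition dim_cumulant_1 :: "real \<Rightarrow> real \<Rightarrow> real" where
  "dim_cumulant_1 N x = N*x - 2*x^2 + 4*x"

definition dim_cumulant_2 :: "real \<Rightarrow> real \<Rightarrow> real" where
  "dim_cumulant_2 N x = x^3 - 7*x^2 - (4*N + 3)*x + N"

definition dim_cumulant_3 :: "real \<Rightarrow> real \<Rightarrow> real" where
  "dim_cumulant_3 N x = - 5/3*x^4 + 20*x^3 + (18*N + 116/3)*x^2 - (6*N + 1/3)*x + N"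

lemmas dim_cumulant_defs = dim_cumulant_1_def dim_cumulant_2_def dim_cumulant_3_def

lemma poly_bounded_dim_cumulant:
  "poly_bounded (dim_cumulant_1 N)" "poly_bounded (dim_cumulant_2 N)" "poly_bounded (dim_cumulant_3 N)"
  unfolding dim_cumulant_defs[abs_def] by (intro poly_bounded_intros)+

lemma moment_op_one:
  "moment_op (Suc 0) N (\<lambda>_. 1) x = dim_cumulant_1 N x"
  "moment_op (Suc (Suc 0)) N (\<lambda>_. 1) x = dim_cumulant_1 N x ^ 2 + dim_cumulant_2 N x"
  "moment_op (Suc (Suc (Suc 0))) N (\<lambda>_. 1) x =
    dim_cumulant_1 N x ^ 3 + 3 * dim_cumulant_1 N x * dim_cumulant_2 N x + dim_cumulant_3 N x"
  unfolding moment_op.simps dim_cumulant_defs by algebra+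

lemma average_dim_exponent_power:
  "(\<Sum>P\<in>set_partitions n. real_of_int (dim_exponent n P)) / Bell n = mean n (dim_cumulant_1 n)"
  "(\<Sum>P\<in>set_partitions n. real_of_int (dim_exponent n P) ^ 2) / Bell n =
    mean n (\<lambda>x. dim_cumulant_1 n x ^ 2 + dim_cumulant_2 n x)"
  "(\<Sum>P\<in>set_partitions n. real_of_int (dim_exponent n P) ^ 3) / Bell n =
    mean n (\<lambda>x. dim_cumulant_1 n x ^ 3 + 3 * dim_cumulant_1 n x * dim_cumulant_2 n x + dim_cumulant_3 n x)"
proof -
  have "(\<Sum>P\<in>set_partitions n. real_of_int (dim_exponent n P) ^ i) / Bell n = mean n (moment_op i n (\<lambda>_. 1))"
    if "i \<le> 3" for i
    using that by (simp add: sum_dim_exponent_power open_moment_eq_dobinski_sum poly.of_order_const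
        Bell_eq_dobinski_sum mean_def)
  from this[of "Suc 0"] this[of "Suc (Suc 0)"] this[of "Suc (Suc (Suc 0))"] show
    "(\<Sum>P\<in>set_partitions n. real_of_int (dim_exponent n P)) / Bell n = mean n (dim_cumulant_1 n)"
    "(\<Sum>P\<in>set_partitions n. real_of_int (dim_exponent n P) ^ 2) / Bell n =
      mean n (\<lambda>x. dim_cumulant_1 n x ^ 2 + dim_cumulant_2 n x)"
    "(\<Sum>P\<in>set_partitions n. real_of_int (dim_exponent n P) ^ 3) / Bell n =
      mean n (\<lambda>x. dim_cumulant_1 n x ^ 3 + 3 * dim_cumulant_1 n x * dim_cumulant_2 n x + dim_cumulant_3 n x)"
    by (simp_all only: moment_op_one[abs_def] numeral_3_eq_3 numeral_2_eq_2 power_one_right) simp_all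
qed

lemma average_dim_exponent_cubic:
  "(\<Sum>P\<in>set_partitions n. a3 * real_of_int (dim_exponent n P) ^ 3 + a2 * real_of_int (dim_exponent n P) ^ 2
      + a1 * real_of_int (dim_exponent n P) + a0) / Bell n =
   mean n (\<lambda>x. a3 * (dim_cumulant_1 n x ^ 3 + 3 * dim_cumulant_1 n x * dim_cumulant_2 n x + dim_cumulant_3 n x)
      + a2 * (dim_cumulant_1 n x ^ 2 + dim_cumulant_2 n x) + a1 * dim_cumulant_1 n x + a0)"
proof -
  have B: "real (Bell n) \<noteq> 0" using Bell_pos[of n] by simp
  note sums = average_dim_exponent_power[of n, unfolded nonzero_divide_eq_eq[OF B]]
  have "card (set_partitions n) = Bell n" by (simp add: Bell_def)
  then show ?thesis
    using B by (simp add: sum.distrib sums mean_linear poly_bounded_intros poly_bounded_dim_cumulant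
        add_divide_distrib flip: sum_distrib_left)
qed

lemma expect_dim_exponent:
  "expect_partitions n (\<lambda>P. real_of_int (dim_exponent n P)) = mean n (dim_cumulant_1 n)"
proof -
  have "set_partitions n \<noteq> {}" using Bell_pos[of n] by (auto simp: Bell_def)
  then show ?thesis
    using average_dim_exponent_power(1)[of n] unfolding expect_partitions_def Bell_def
    by (simp add: integral_pmf_of_set finite_set_partitions)
qed

definition dim_dev :: "nat \<Rightarrow> real \<Rightarrow> real" where
  "dim_dev n x = dim_cumulant_1 n x - mean n (dim_cumulant_1 n)"

lemma poly_bounded_dim_dev: "poly_bounded (dim_dev n)"
  unfolding dim_dev_def[abs_def] by (intro poly_bounded_intros poly_bounded_dim_cumulant)

text \<open>The law of total cumulance.\<close>

lemma central_moment_dim_exponent: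
  "central_moment 2 dim_exponent n = mean n (\<lambda>x. dim_dev n x ^ 2) + mean n (dim_cumulant_2 n)"
  "central_moment 3 dim_exponent n =
    mean n (\<lambda>x. dim_dev n x ^ 3) + 3 * mean n (\<lambda>x. dim_dev n x * dim_cumulant_2 n x) + mean n (dim_cumulant_3 n)"
proof -
  define m where "m = mean n (dim_cumulant_1 n)"
  note intros = poly_bounded_intros poly_bounded_dim_cumulant poly_bounded_dim_dev
  have "(\<Sum>P\<in>set_partitions n. real_of_int (dim_exponent n P)) / Bell n = m"
    unfolding m_def by (rule average_dim_exponent_power)
  then have central: "central_moment k dim_exponent n =
      (\<Sum>P\<in>set_partitions n. (real_of_int (dim_exponent n P) - m) ^ k) / Bell n" for k
    by (simp add: central_moment_def total_stat_def)
  have power: "(d - m) ^ 2 = 0 * d ^ 3 + 1 * d ^ 2 + (- 2 * m) * d + m ^ 2" for d :: real by algebra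
  have "central_moment 2 dim_exponent n = mean n (\<lambda>x. dim_dev n x ^ 2 + dim_cumulant_2 n x)"
    unfolding central power average_dim_exponent_cubic dim_dev_def m_def[symmetric]
    by (rule arg_cong[of _ _ "mean n"], rule ext) algebra
  then show "central_moment 2 dim_exponent n = mean n (\<lambda>x. dim_dev n x ^ 2) + mean n (dim_cumulant_2 n)"
    by (simp add: mean_add intros)
  have power: "(d - m) ^ 3 = 1 * d ^ 3 + (- 3 * m) * d ^ 2 + (3 * m ^ 2) * d + - (m ^ 3)" for d :: real by algebra
  have "central_moment 3 dim_exponent n =
      mean n (\<lambda>x. dim_dev n x ^ 3 + 3 * (dim_dev n x * dim_cumulant_2 n x) + dim_cumulant_3 n x)"
    unfolding central power average_dim_exponent_cubic dim_dev_def m_def[symmetric]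
    by (rule arg_cong[of _ _ "mean n"], rule ext) algebra
  then show "central_moment 3 dim_exponent n = mean n (\<lambda>x. dim_dev n x ^ 3)
      + 3 * mean n (\<lambda>x. dim_dev n x * dim_cumulant_2 n x) + mean n (dim_cumulant_3 n)"
    by (simp add: mean_linear intros)
qed

section \<open>Concentration of the Dobinski weights\<close>

lemma alpha_pos: "alpha n > 0" and alpha_eq: "alpha n * exp (alpha n) = real n + 1"
  using theI'[OF alpha_ex1[of n]] unfolding alpha_def by auto

lemma alpha_ge:
  assumes "a * exp a \<le> real n + 1" shows "a \<le> alpha n"
proof (rule ccontr)
  assume "\<not> a \<le> alpha n"
  then have "alpha n * exp (alpha n) < a * exp a"
    using alpha_pos[of n] by (intro mult_strict_mono) auto
  then show False using assms alpha_eq[of n] by simp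
qed

lemma filterlim_alpha: "filterlim alpha at_top sequentially"
  unfolding filterlim_at_top
proof
  fix a :: real
  have "\<forall>\<^sub>F n in sequentially. a * exp a \<le> real n + 1" by real_asymp
  then show "\<forall>\<^sub>F n in sequentially. a \<le> alpha n"
    by eventually_elim (rule alpha_ge)
qed

lemma eventually_alpha: "eventually P at_top \<Longrightarrow> \<forall>\<^sub>F n in sequentially. P (alpha n)"
  using filterlim_alpha unfolding filterlim_iff by blast

lemma alpha_asymptotics: "(\<lambda>n. alpha n - (ln (real n) - ln (ln (real n)))) \<longlonglongrightarrow> 0"
proof -
  have ln_eq: "ln (real n + 1) = alpha n + ln (alpha n)" for n
    using alpha_pos[of n] by (simp flip: alpha_eq add: ln_mult)
  have "((\<lambda>x::real. ln x - ln (x + ln x)) \<longlongrightarrow> 0) at_top" by real_asymp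
  from filterlim_compose[OF this filterlim_alpha]
  have "(\<lambda>n. ln (alpha n) - ln (ln (real n + 1))) \<longlonglongrightarrow> 0" by (simp add: ln_eq)
  moreover have "(\<lambda>n. ln (real n + 1) - ln (real n)) \<longlonglongrightarrow> 0" by real_asymp
  moreover have "(\<lambda>n. ln (ln (real n)) - ln (ln (real n + 1))) \<longlonglongrightarrow> 0" by real_asymp
  ultimately have "(\<lambda>n. (ln (real n + 1) - ln (real n)) - (ln (alpha n) - ln (ln (real n + 1)))
      + (ln (ln (real n)) - ln (ln (real n + 1)))) \<longlonglongrightarrow> 0 - 0 + 0"
    by (intro tendsto_intros)
  moreover have "(ln (real n + 1) - ln (real n)) - (ln (alpha n) - ln (ln (real n + 1)))
      + (ln (ln (real n)) - ln (ln (real n + 1))) = alpha n - (ln (real n) - ln (ln (real n)))" for n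
    using ln_eq[of n] by linarith
  ultimately show ?thesis by (simp only: diff_self add_0)
qed

definition cen :: "nat \<Rightarrow> real" where
  "cen n = exp (alpha n)"

definition eps :: "nat \<Rightarrow> real" where
  "eps n = exp (- alpha n / 2)"

definition dev :: "nat \<Rightarrow> real \<Rightarrow> real" where
  "dev n x = (x - cen n) * eps n"

lemma cen_gt_1: "cen n > 1" using alpha_pos[of n] by (simp add: cen_def)

lemma cen_nonzero: "cen n \<noteq> 0" by (simp add: cen_def)

lemma real_eq_alpha_cen: "real n = alpha n * cen n - 1"
  by (simp add: cen_def alpha_eq)

lemma eps_pos: "eps n > 0" by (simp add: eps_def)

lemma eps_le_1: "eps n \<le> 1" using alpha_pos[of n] by (simp add: eps_def)

lemma cen_eps: "cen n * eps n ^ 2 = 1"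
proof -
  have "eps n ^ 2 = exp (- alpha n)"
    unfolding eps_def exp_of_nat_mult[symmetric] by simp
  then show ?thesis by (simp add: cen_def flip: exp_add)
qed

lemma poly_bounded_dev: "poly_bounded (dev n)"
  unfolding dev_def[abs_def] by (intro poly_bounded_intros)

text \<open>For real \<open>x \<ge> 1\<close> this is the ratio \<open>w (x - 1) / w x\<close> of consecutive Dobinski weights
  \<open>w k = k ^ n / k!\<close>.\<close>

definition ratio :: "nat \<Rightarrow> real \<Rightarrow> real" where
  "ratio n x = (if x < 1 then 0 else x * (1 - 1 / x) ^ n)"

lemma ratio_bounds: "0 \<le> ratio n x" "ratio n x \<le> \<bar>x\<bar>"
proof -
  show "0 \<le> ratio n x" by (auto simp: ratio_def divide_le_eq_1)
  show "ratio n x \<le> \<bar>x\<bar>"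
  proof (cases "x < 1")
    case False
    then have "(1 - 1 / x) ^ n \<le> 1" by (intro power_le_one) (auto simp: divide_le_eq_1)
    then show ?thesis using False by (simp add: ratio_def mult_le_cancel_left2)
  qed (simp add: ratio_def)
qed

lemma poly_bounded_ratio: "poly_bounded (ratio n)"
  by (rule poly.of_order_bound[OF poly_bounded_ident, of _ 1]) (use ratio_bounds in \<open>auto simp: eventually_top\<close>)

lemmas poly_bounded_dev_intros = poly_bounded_intros poly_bounded_dev poly_bounded_ratio

lemma mean_ratio:
  assumes "poly_bounded g" "n > 0"
  shows "mean n (\<lambda>x. ratio n x * g (x - 1)) = mean n g"
proof -
  have "dobinski_sum (\<lambda>x. x ^ n * (ratio n x * g (x - 1))) = dobinski_sum (\<lambda>x. x * ((x - 1) ^ n * g (x - 1)))"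
  proof (rule dobinski_sum_cong)
    fix k :: nat
    show "real k ^ n * (ratio n (real k) * g (real k - 1)) = real k * ((real k - 1) ^ n * g (real k - 1))"
    proof (cases "k = 0")
      case False
      then have "real k ^ n * (1 - 1 / real k) ^ n = (real k - 1) ^ n"
        by (simp add: power_mult_distrib[symmetric] right_diff_distrib)
      then show ?thesis using False by (simp add: ratio_def mult_ac)
    qed (use assms in simp)
  qed
  also have "\<dots> = dobinski_sum (\<lambda>x. x ^ n * g x)"
    using dobinski_sum_shift[of "\<lambda>x. x ^ n * g x"] assms by (simp add: poly_bounded_intros)
  finally show ?thesis by (simp add: mean_def)
qed

lemma mean_ratio_dev:
  assumes "n > 0"
  shows "mean n (\<lambda>x. ratio n x * dev n x ^ j) = mean n (\<lambda>x. (dev n x + eps n) ^ j)"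
proof -
  have shift: "dev n (x - 1) + eps n = dev n x" for x by (simp add: dev_def algebra_simps)
  have "poly_bounded (\<lambda>x. (dev n x + eps n) ^ j)" by (intro poly_bounded_dev_intros)
  from mean_ratio[OF this assms] show ?thesis unfolding shift .
qed

lemma ratio_slope:
  assumes "x \<ge> 1" "c > 1"
  shows "ratio n c * (x - c)\<^sup>2 \<le> (ratio n x - ratio n c) * (x - c) * c"
proof -
  define f where "f = (\<lambda>x::real. (1 - 1 / x) ^ n)"
  have mono: "f a \<le> f b" if "1 \<le> a" "a \<le> b" for a b
    unfolding f_def using that by (intro power_mono) (auto simp: field_simps)
  have r: "ratio n x = x * f x" "ratio n c = c * f c" using assms by (auto simp: ratio_def f_def)
  have "0 \<le> (f x - f c) * (x - c)"
    using mono[of x c] mono[of c x] assms by (cases "x \<le> c") (auto intro: mult_nonpos_nonpos)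
  then have "0 \<le> x * c * ((f x - f c) * (x - c))"
    using assms by (intro mult_nonneg_nonneg[OF mult_nonneg_nonneg]) auto
  also have "\<dots> = (ratio n x - ratio n c) * (x - c) * c - ratio n c * (x - c)\<^sup>2"
    unfolding r by (simp add: algebra_simps power2_eq_square)
  finally show ?thesis by simp
qed

lemma eventually_ratio_cen: "\<forall>\<^sub>F n in sequentially. \<bar>1 - ratio n (cen n)\<bar> \<le> eps n / 8"
proof -
  have "\<forall>\<^sub>F a::real in at_top. \<bar>1 - exp (a + (a * exp a - 1) * ln (1 - exp (- a)))\<bar> \<le> exp (- a / 2) / 8"
    by real_asymp
  from eventually_alpha[OF this] show ?thesis
  proof eventually_elim
    case (elim n)
    have inverse: "1 / cen n = exp (- alpha n)" by (simp add: cen_def exp_minus inverse_eq_divide)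
    then have "1 - 1 / cen n > 0" using alpha_pos[of n] by simp
    then have "ratio n (cen n) = exp (alpha n + real n * ln (1 - 1 / cen n))"
      using cen_gt_1[of n] by (simp add: ratio_def exp_add exp_of_nat_mult) (simp add: cen_def)
    also have "\<dots> = exp (alpha n + (alpha n * exp (alpha n) - 1) * ln (1 - exp (- alpha n)))"
      unfolding inverse real_eq_alpha_cen by (simp add: cen_def)
    finally show ?case using elim by (simp add: eps_def)
  qed
qed

lemma one_plus_power_le:
  fixes u :: real
  assumes "0 \<le> u"
  shows "(1 + u) ^ q \<le> 2 ^ q * (1 + u ^ q)"
proof -
  have "(1 + u) ^ q \<le> (2 * max 1 u) ^ q" using assms by (intro power_mono) auto
  also have "\<dots> = 2 ^ q * max 1 u ^ q" by (rule power_mult_distrib)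
  also have "max 1 u ^ q \<le> 1 + u ^ q" using assms by (auto simp: max_def)
  finally show ?thesis by simp
qed

lemma abs_power_add_diff_le:
  fixes u e :: real
  assumes "0 \<le> e" "e \<le> 1"
  shows "\<bar>(u + e) ^ Suc q - u ^ Suc q\<bar> \<le> e * (real (Suc q) * 2 ^ q * (1 + \<bar>u\<bar> ^ q))"
proof -
  have "\<bar>(u + e) ^ Suc q - u ^ Suc q\<bar> = \<bar>(u + e - u) * (\<Sum>p<Suc q. (u + e) ^ p * u ^ (q - p))\<bar>"
    by (simp only: diff_power_eq_sum)
  also have "\<dots> = e * \<bar>\<Sum>p<Suc q. (u + e) ^ p * u ^ (q - p)\<bar>"
    using assms by (simp add: abs_mult del: sum.lessThan_Suc)
  also have "\<dots> \<le> e * (\<Sum>p<Suc q. (1 + \<bar>u\<bar>) ^ q)"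
  proof (intro mult_left_mono order_trans[OF sum_abs] sum_mono)
    fix p assume "p \<in> {..<Suc q}"
    then have q: "p + (q - p) = q" by simp
    have "\<bar>(u + e) ^ p * u ^ (q - p)\<bar> \<le> (1 + \<bar>u\<bar>) ^ p * (1 + \<bar>u\<bar>) ^ (q - p)"
      unfolding abs_mult power_abs using assms by (intro mult_mono power_mono) auto
    then show "\<bar>(u + e) ^ p * u ^ (q - p)\<bar> \<le> (1 + \<bar>u\<bar>) ^ q"
      unfolding power_add[symmetric] q .
  qed (use assms in auto)
  also have "\<dots> = e * (real (Suc q) * (1 + \<bar>u\<bar>) ^ q)" by simp
  also have "\<dots> \<le> e * (real (Suc q) * (2 ^ q * (1 + \<bar>u\<bar> ^ q)))"
    using assms one_plus_power_le[of "\<bar>u\<bar>" q] by (intro mult_left_mono) auto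
  finally show ?thesis by (simp only: mult.assoc)
qed

lemma abs_power_le:
  fixes u :: real
  assumes "j \<le> 2 * m"
  shows "\<bar>u\<bar> ^ j \<le> 1 + u ^ (2 * m)"
proof (cases "\<bar>u\<bar> \<le> 1")
  case True
  then have "\<bar>u\<bar> ^ j \<le> 1" by (intro power_le_one) auto
  then show ?thesis by (simp add: power_mult add_increasing2)
next
  case False
  then have "\<bar>u\<bar> ^ j \<le> \<bar>u\<bar> ^ (2 * m)" using assms by (intro power_increasing) auto
  then show ?thesis by (simp add: power_even_abs)
qed

lemma ratio_cen_dev_power_le:
  assumes "x \<ge> 1"
  shows "ratio n (cen n) * dev n x ^ (2 * Suc m) \<le> (ratio n x - ratio n (cen n)) * dev n x ^ Suc (2 * m) / eps n"
proof -
  let ?c = "cen n" and ?r = "ratio n (cen n)"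
  have power_even_Suc: "dev n x ^ (2 * Suc m) = dev n x ^ 2 * dev n x ^ (2 * m)"
    by (simp add: power2_eq_square)
  have dev: "dev n x ^ 2 = (x - ?c)\<^sup>2 * eps n ^ 2" "dev n x / eps n = (x - ?c) * ?c * eps n ^ 2"
    using eps_pos[of n] cen_eps[of n] by (simp_all add: dev_def power_mult_distrib mult.assoc)
  have "?r * (x - ?c)\<^sup>2 \<le> (ratio n x - ?r) * (x - ?c) * ?c"
    by (rule ratio_slope[OF assms cen_gt_1])
  then have "(?r * (x - ?c)\<^sup>2) * (eps n ^ 2 * dev n x ^ (2 * m)) \<le>
      ((ratio n x - ?r) * (x - ?c) * ?c) * (eps n ^ 2 * dev n x ^ (2 * m))"
    by (intro mult_right_mono) (auto simp: power_mult)
  moreover have "?r * dev n x ^ (2 * Suc m) = (?r * (x - ?c)\<^sup>2) * (eps n ^ 2 * dev n x ^ (2 * m))"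
    unfolding power_even_Suc dev(1) by (simp only: mult_ac)
  moreover have "(ratio n x - ?r) * dev n x ^ Suc (2 * m) / eps n =
      (ratio n x - ?r) * (dev n x / eps n) * dev n x ^ (2 * m)" by simp
  ultimately show ?thesis unfolding dev by (simp only: mult_ac)
qed

lemma mean_dev_add_eps_power_le:
  assumes "n > 0"
  shows "mean n (\<lambda>x. (dev n x + eps n) ^ Suc (2 * m)) - mean n (\<lambda>x. dev n x ^ Suc (2 * m)) \<le>
    eps n * (real (Suc (2 * m)) * 2 ^ (2 * m) * (1 + mean n (\<lambda>x. dev n x ^ (2 * m))))"
proof -
  let ?u = "dev n" and ?e = "eps n" and ?K = "real (Suc (2 * m)) * 2 ^ (2 * m)"
  have "mean n (\<lambda>x. (?u x + ?e) ^ Suc (2 * m)) - mean n (\<lambda>x. ?u x ^ Suc (2 * m)) =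
      mean n (\<lambda>x. (?u x + ?e) ^ Suc (2 * m) - ?u x ^ Suc (2 * m))"
    by (simp only: mean_linear poly_bounded_dev_intros)
  also have "\<dots> \<le> mean n (\<lambda>x. ?e * (?K * (1 + ?u x ^ (2 * m))))"
  proof (rule mean_mono)
    show "(?u k + ?e) ^ Suc (2 * m) - ?u k ^ Suc (2 * m) \<le> ?e * (?K * (1 + ?u k ^ (2 * m)))" for k :: nat
      using abs_power_add_diff_le[OF less_imp_le[OF eps_pos[of n]] eps_le_1[of n], of "?u k" "2 * m"]
      unfolding power_even_abs[OF dvd_triv_left] by linarith
  qed (use assms in \<open>auto intro!: poly_bounded_dev_intros\<close>)
  also have "\<dots> = ?e * (?K * (1 + mean n (\<lambda>x. ?u x ^ (2 * m))))"
    by (simp only: mean_linear poly_bounded_dev_intros)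
  finally show ?thesis .
qed

lemma abs_odd_dev_moment_le:
  assumes "n > 0"
  shows "\<bar>mean n (\<lambda>x. dev n x ^ Suc (2 * m))\<bar> \<le> 1 + mean n (\<lambda>x. dev n x ^ (2 * Suc m))"
proof -
  have "\<bar>mean n (\<lambda>x. dev n x ^ Suc (2 * m))\<bar> \<le> mean n (\<lambda>x. 1 + dev n x ^ (2 * Suc m))"
    using assms abs_power_le[of "Suc (2 * m)" "Suc m"]
    by (intro mean_abs_le poly_bounded_dev_intros) (auto simp: power_abs simp del: power_Suc)
  then show ?thesis by (simp only: mean_linear poly_bounded_dev_intros)
qed

text \<open>By \<open>ratio_slope\<close> the weight ratio minus its value at the centre has the sign of the deviation
  and at least linear size, so \<open>mean_ratio_dev\<close> bounds each even moment by the preceding one.\<close>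

lemma even_dev_moment_le:
  assumes n: "n > 0" and r: "\<bar>1 - ratio n (cen n)\<bar> \<le> eps n / 8"
  shows "mean n (\<lambda>x. dev n x ^ (2 * Suc m)) \<le>
    2 * (real (Suc (2 * m)) * 2 ^ (2 * m) * (1 + mean n (\<lambda>x. dev n x ^ (2 * m)))) + 1"
proof -
  let ?u = "dev n" and ?e = "eps n" and ?r = "ratio n (cen n)"
  define A where "A = mean n (\<lambda>x. ?u x ^ (2 * Suc m))"
  define B where "B = mean n (\<lambda>x. ?u x ^ Suc (2 * m))"
  define K where "K = real (Suc (2 * m)) * 2 ^ (2 * m) * (1 + mean n (\<lambda>x. ?u x ^ (2 * m)))"
  have e: "0 < ?e" "?e \<le> 1" using eps_pos eps_le_1 by auto
  have "?r * A = mean n (\<lambda>x. ?r * ?u x ^ (2 * Suc m))"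
    unfolding A_def by (simp only: mean_linear poly_bounded_dev_intros)
  also have "\<dots> \<le> mean n (\<lambda>x. 1 / ?e * (ratio n x * ?u x ^ Suc (2 * m) - ?r * ?u x ^ Suc (2 * m)))"
    using n ratio_cen_dev_power_le by (intro mean_mono poly_bounded_dev_intros) (auto simp: left_diff_distrib)
  also have "\<dots> = 1 / ?e * (mean n (\<lambda>x. (?u x + ?e) ^ Suc (2 * m)) - ?r * B)"
    unfolding B_def mean_ratio_dev[OF n, symmetric] by (simp only: mean_linear poly_bounded_dev_intros)
  also have "\<dots> = 1 / ?e * (mean n (\<lambda>x. (?u x + ?e) ^ Suc (2 * m)) - B) + (1 - ?r) / ?e * B"
    by (simp add: diff_divide_distrib left_diff_distrib right_diff_distrib)
  also have "\<dots> \<le> K + 1 / 8 * (1 + A)"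
  proof (rule add_mono)
    show "1 / ?e * (mean n (\<lambda>x. (?u x + ?e) ^ Suc (2 * m)) - B) \<le> K"
      using mean_dev_add_eps_power_le[OF n, of m] e by (simp add: B_def K_def divide_le_eq mult.commute)
    have "(1 - ?r) / ?e * B \<le> \<bar>(1 - ?r) / ?e\<bar> * \<bar>B\<bar>" by (metis abs_ge_self abs_mult)
    also have "\<dots> \<le> 1 / 8 * (1 + A)"
      using r e abs_odd_dev_moment_le[OF n, of m]
      by (intro mult_mono) (auto simp: A_def B_def divide_le_eq simp del: power_Suc)
    finally show "(1 - ?r) / ?e * B \<le> 1 / 8 * (1 + A)" .
  qed
  finally have bound: "?r * A \<le> K + 1 / 8 * (1 + A)" .
  have "mean n (\<lambda>_. 0) \<le> A"
    unfolding A_def using n by (intro mean_mono poly_bounded_dev_intros zero_le_even_power) auto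
  then have "0 \<le> A" by (simp add: mean_const)
  moreover have "7 / 8 \<le> ?r" using r e by linarith
  ultimately have "7 / 8 * A \<le> ?r * A" by (intro mult_right_mono)
  then show ?thesis using bound \<open>0 \<le> A\<close> unfolding A_def[symmetric] K_def[symmetric] by argo
qed

lemma even_dev_moments_bounded: "\<exists>C. \<forall>\<^sub>F n in sequentially. mean n (\<lambda>x. dev n x ^ (2 * m)) \<le> C"
proof (induction m)
  case 0
  then show ?case by (intro exI[of _ 1]) (simp add: mean_const)
next
  case (Suc m)
  then obtain C where "\<forall>\<^sub>F n in sequentially. mean n (\<lambda>x. dev n x ^ (2 * m)) \<le> C" by blast
  then have "\<forall>\<^sub>F n in sequentially.
      mean n (\<lambda>x. dev n x ^ (2 * Suc m)) \<le> 2 * (real (Suc (2 * m)) * 2 ^ (2 * m) * (1 + C)) + 1"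
    using eventually_ratio_cen eventually_gt_at_top[of 0]
  proof eventually_elim
    case (elim n)
    have "mean n (\<lambda>x. dev n x ^ (2 * Suc m)) \<le>
        2 * (real (Suc (2 * m)) * 2 ^ (2 * m) * (1 + mean n (\<lambda>x. dev n x ^ (2 * m)))) + 1"
      by (rule even_dev_moment_le[OF elim(3,2)])
    also have "\<dots> \<le> 2 * (real (Suc (2 * m)) * 2 ^ (2 * m) * (1 + C)) + 1"
      using elim(1) by (intro add_right_mono mult_left_mono) auto
    finally show ?case .
  qed
  then show ?case by blast
qed

section \<open>Expansion of the weight ratio\<close>

interpretation seq: asymptotic_scale sequentially alpha eps
  using eventually_alpha[OF eventually_ge_at_top] eps_pos eps_le_1 by unfold_locales auto

lemma seq_of_order_cen: "seq.of_order (- 2) cen"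
proof -
  have "cen = (\<lambda>n. eps n powi (- 2))"
    using cen_eps eps_pos by (auto simp: power_int_minus field_simps less_imp_neq[symmetric])
  then show ?thesis using seq.of_order_e_powi[of "- 2"] by simp
qed

lemma seq_of_order_inverse_cen: "seq.of_order 2 (\<lambda>n. 1 / cen n)"
proof -
  have "1 / cen n = eps n powi 2" for n
    using cen_eps[of n] cen_gt_1[of n] by (simp add: field_simps)
  then show ?thesis using seq.of_order_e_powi[of 2] by simp
qed

text \<open>Bounds along this filter are uniform in the second component.\<close>

definition pairs :: "(nat \<times> real) filter" where
  "pairs = filtercomap fst sequentially"

lemma eventually_pairs: "eventually P pairs \<longleftrightarrow> (\<forall>\<^sub>F n in sequentially. \<forall>x. P (n, x))"
  unfolding pairs_def eventually_filtercomap eventually_sequentially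
  by (auto; metis fst_conv order_refl)

definition pair_size :: "nat \<times> real \<Rightarrow> real" where
  "pair_size = (\<lambda>(n, x). alpha n * (1 + \<bar>dev n x\<bar>))"

lemma alpha_le_pair_size: "alpha n \<le> pair_size (n, x)"
  using alpha_pos[of n] by (simp add: pair_size_def)

interpretation pair: asymptotic_scale pairs pair_size "\<lambda>z. eps (fst z)"
proof
  show "\<forall>\<^sub>F z in pairs. 1 \<le> pair_size z"
    unfolding eventually_pairs using eventually_alpha[OF eventually_ge_at_top[of 1]]
    by eventually_elim (use alpha_le_pair_size order_trans in blast)
qed (simp add: eps_pos eps_le_1)

lemma pair_of_order_fst:
  assumes "seq.of_order k f"
  shows "pair.of_order k (\<lambda>z. f (fst z))"
proof -
  obtain p where "f \<in> O(\<lambda>n. alpha n ^ p * eps n powi k)" using assms by (auto simp: seq.of_order_def)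
  then have "(\<lambda>z. f (fst z)) \<in> O[pairs](\<lambda>z. alpha (fst z) ^ p * eps (fst z) powi k)"
    by (rule landau_o.big.compose) (simp add: pairs_def filterlim_filtercomap)
  moreover have "(\<lambda>z. alpha (fst z) ^ p * eps (fst z) powi k) \<in> O[pairs](\<lambda>z. pair_size z ^ p * eps (fst z) powi k)"
    using alpha_le_pair_size alpha_pos eps_pos
    by (intro bigoI[of _ 1]) (auto simp: abs_mult power_int_abs less_imp_le intro!: always_eventually
        mult_right_mono power_mono order_trans[OF _ abs_ge_self])
  ultimately show ?thesis by (blast intro: pair.of_orderI landau_o.big_trans)
qed

lemma pair_of_order_dev: "pair.of_order 0 (\<lambda>(n, x). dev n x)"
proof (rule pair.of_order_bound[OF pair.of_order_L, of _ 1])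
  show "\<forall>\<^sub>F z in pairs. \<bar>case z of (n, x) \<Rightarrow> dev n x\<bar> \<le> 1 * \<bar>pair_size z\<bar>"
    unfolding eventually_pairs using eventually_alpha[OF eventually_ge_at_top[of 1]]
  proof (eventually_elim, intro allI)
    fix n x assume "1 \<le> alpha n"
    then have "1 * \<bar>dev n x\<bar> \<le> alpha n * (1 + \<bar>dev n x\<bar>)" by (intro mult_mono) auto
    then show "\<bar>case (n, x) of (n, x) \<Rightarrow> dev n x\<bar> \<le> 1 * \<bar>pair_size (n, x)\<bar>" by (simp add: pair_size_def)
  qed
qed

lemma abs_mean_le_dev_moment:
  assumes "poly_bounded f" "n > 0" "c \<ge> 0" and bound: "\<And>x. \<bar>f x\<bar> \<le> c * (1 + \<bar>dev n x\<bar>) ^ p"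
  shows "\<bar>mean n f\<bar> \<le> c * 2 ^ p * (2 + mean n (\<lambda>x. dev n x ^ (2 * p)))"
proof -
  have "\<bar>f x\<bar> \<le> c * 2 ^ p * (2 + dev n x ^ (2 * p))" for x
  proof -
    have "\<bar>f x\<bar> \<le> c * (2 ^ p * (1 + \<bar>dev n x\<bar> ^ p))"
      using assms(3) by (intro order_trans[OF bound] mult_left_mono one_plus_power_le) auto
    also have "\<dots> \<le> c * (2 ^ p * (2 + dev n x ^ (2 * p)))"
      using assms(3) abs_power_le[of p p "dev n x"] by (intro mult_left_mono) auto
    finally show ?thesis by (simp only: mult.assoc)
  qed
  then have "\<bar>mean n f\<bar> \<le> mean n (\<lambda>x. c * 2 ^ p * (2 + dev n x ^ (2 * p)))"
    using assms(1,2) by (intro mean_abs_le poly_bounded_dev_intros) auto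
  also have "\<dots> = c * 2 ^ p * (2 + mean n (\<lambda>x. dev n x ^ (2 * p)))"
    by (simp only: mean_linear poly_bounded_dev_intros)
  finally show ?thesis .
qed

lemma seq_of_order_mean:
  assumes f: "pair.of_order k f" and poly: "\<And>n. poly_bounded (\<lambda>x. f (n, x))"
  shows "seq.of_order k (\<lambda>n. mean n (\<lambda>x. f (n, x)))"
proof -
  obtain p where "f \<in> O[pairs](\<lambda>z. pair_size z ^ p * eps (fst z) powi k)"
    using f by (auto simp: pair.of_order_def)
  then obtain C where C: "C > 0" "\<forall>\<^sub>F z in pairs. norm (f z) \<le> C * norm (pair_size z ^ p * eps (fst z) powi k)"
    by (rule landau_o.bigE)
  obtain D where D: "\<forall>\<^sub>F n in sequentially. mean n (\<lambda>x. dev n x ^ (2 * p)) \<le> D"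
    using even_dev_moments_bounded by blast
  have "(\<lambda>n. mean n (\<lambda>x. f (n, x))) \<in> O(\<lambda>n. alpha n ^ p * eps n powi k)"
  proof (rule bigoI)
    show "\<forall>\<^sub>F n in sequentially. norm (mean n (\<lambda>x. f (n, x))) \<le>
        C * 2 ^ p * (2 + D) * norm (alpha n ^ p * eps n powi k)"
      using C(2)[unfolded eventually_pairs] D eventually_gt_at_top[of 0]
    proof eventually_elim
      case (elim n)
      define c where "c = C * (alpha n ^ p * eps n powi k)"
      have c: "c \<ge> 0" using C(1) alpha_pos[of n] eps_pos[of n] by (simp add: c_def)
      have "\<bar>f (n, x)\<bar> \<le> c * (1 + \<bar>dev n x\<bar>) ^ p" for x
        using elim(1)[rule_format, of x] alpha_pos[of n] eps_pos[of n]
        by (simp add: pair_size_def c_def power_mult_distrib abs_mult mult_ac)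
      then have "\<bar>mean n (\<lambda>x. f (n, x))\<bar> \<le> c * 2 ^ p * (2 + mean n (\<lambda>x. dev n x ^ (2 * p)))"
        using c elim(3) poly by (intro abs_mean_le_dev_moment)
      also have "\<dots> \<le> c * 2 ^ p * (2 + D)" using elim(2) c by (intro mult_left_mono) auto
      finally show ?case using alpha_pos[of n] eps_pos[of n] by (simp add: c_def abs_mult mult_ac)
    qed
  qed
  then show ?thesis by (rule seq.of_orderI)
qed

definition rel_dev :: "nat \<Rightarrow> real \<Rightarrow> real" where
  "rel_dev n x = (x - cen n) / cen n"

lemma rel_dev_eq: "rel_dev n x = eps n * dev n x"
proof -
  have "eps n * dev n x = (x - cen n) * (cen n * eps n ^ 2) / cen n"
    using cen_gt_1[of n] by (simp add: dev_def power2_eq_square)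
  then show ?thesis by (simp add: cen_eps rel_dev_def)
qed

lemma eq_cen_rel_dev: "x = cen n * (1 + rel_dev n x)"
  using cen_gt_1[of n] by (simp add: rel_dev_def field_simps)

lemma poly_bounded_rel_dev: "poly_bounded (rel_dev n)"
  unfolding rel_dev_eq[abs_def] by (intro poly_bounded_dev_intros)

lemma pair_of_order_rel_dev: "pair.of_order 1 (\<lambda>(n, x). rel_dev n x)"
  using pair.of_order_mult[OF pair.of_order_e_powi[of 1] pair_of_order_dev, of 1]
  by (simp add: rel_dev_eq case_prod_unfold)

lemma ln_taylor:
  fixes x :: real
  assumes "\<bar>x\<bar> \<le> 1 / 2"
  shows "\<bar>ln (1 + x) - (\<Sum>i<m. - ((- x) ^ Suc i / real (Suc i)))\<bar> \<le> 2 * \<bar>x\<bar> ^ Suc m"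
proof -
  define f where "f = (\<lambda>x::real. ln (1 + x) - (\<Sum>i<m. - ((- x) ^ Suc i / real (Suc i))))"
  have deriv: "(f has_field_derivative (- y) ^ m / (1 + y)) (at y within S)" if "1 + y > 0" for y S
  proof -
    have "((\<lambda>x. - ((- x) ^ Suc i / real (Suc i))) has_field_derivative (- y) ^ i) (at y within S)" for i
      by (auto intro!: derivative_eq_intros simp del: power_Suc of_nat_Suc)
    moreover have "((\<lambda>x. ln (1 + x)) has_field_derivative 1 / (1 + y)) (at y within S)"
      using that by (auto intro!: derivative_eq_intros)
    ultimately have "(f has_field_derivative 1 / (1 + y) - (\<Sum>i<m. (- y) ^ i)) (at y within S)"
      unfolding f_def by (intro DERIV_diff DERIV_sum)
    also have "1 / (1 + y) - (\<Sum>i<m. (- y) ^ i) = (- y) ^ m / (1 + y)"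
      using that sum_gp_strict[of "- y" m] by (simp add: field_simps)
    finally show ?thesis .
  qed
  have "norm (f x - f 0) \<le> (2 * \<bar>x\<bar> ^ m) * norm (x - 0)"
  proof (rule field_differentiable_bound[of "{- \<bar>x\<bar>..\<bar>x\<bar>}"])
    fix y assume "y \<in> {- \<bar>x\<bar>..\<bar>x\<bar>}"
    then have y: "\<bar>y\<bar> \<le> \<bar>x\<bar>" "1 + y \<ge> 1 / 2" using assms by auto
    show "(f has_field_derivative (- y) ^ m / (1 + y)) (at y within {- \<bar>x\<bar>..\<bar>x\<bar>})"
      using y by (intro deriv) auto
    have "\<bar>y\<bar> ^ m / (1 + y) \<le> \<bar>x\<bar> ^ m / (1 / 2)"
      using y by (intro frac_le power_mono) auto
    then show "norm ((- y) ^ m / (1 + y)) \<le> 2 * \<bar>x\<bar> ^ m" using y by (simp add: power_abs)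
  qed auto
  then show ?thesis by (simp add: f_def mult_ac)
qed

definition near :: "(nat \<times> real) filter" where
  "near = inf pairs (principal {(n, x). alpha n * \<bar>rel_dev n x\<bar> \<le> 1 / 2})"

definition far :: "(nat \<times> real) filter" where
  "far = inf pairs (principal {(n, x). alpha n * \<bar>rel_dev n x\<bar> > 1 / 2})"

lemma near_le_pairs: "near \<le> pairs" and far_le_pairs: "far \<le> pairs" and sup_near_far: "sup near far = pairs"
proof -
  have "pairs \<le> sup near far"
    unfolding near_def far_def by (auto simp: le_filter_def eventually_sup eventually_inf_principal
        elim: eventually_elim2)
  then show "sup near far = pairs" by (auto simp: near_def far_def intro: antisym)
qed (auto simp: near_def far_def)

interpretation near: asymptotic_scale near pair_size "\<lambda>z. eps (fst z)"
  by (rule pair.asymptotic_scale_restrict[OF near_le_pairs])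

interpretation far: asymptotic_scale far pair_size "\<lambda>z. eps (fst z)"
  by (rule pair.asymptotic_scale_restrict[OF far_le_pairs])

lemma far_of_order:
  assumes "pair.of_order i f"
  shows "far.of_order k f"
proof (rule far.of_order_trivial_scale)
  show "far.of_order i f" by (rule pair.of_order_restrict[OF assms far_le_pairs])
  have "1 \<le> 2 * (pair_size (n, x) * eps n)" if "alpha n * \<bar>rel_dev n x\<bar> > 1 / 2" for n x
    using that alpha_pos[of n] eps_pos[of n]
    by (simp add: pair_size_def rel_dev_eq abs_mult algebra_simps add_increasing)
  then show "\<forall>\<^sub>F z in far. 1 \<le> 2 * (pair_size z * eps (fst z))"
    by (auto simp: far_def eventually_inf_principal intro!: always_eventually)
qed

text \<open>The Taylor polynomial of \<open>ratio n (cen n * (1 + v))\<close> in \<open>v\<close> and \<open>d = 1 / cen n\<close>, where \<open>v\<close>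
  has weight 1 and \<open>d\<close> weight 2, truncated after weight 4.\<close>

definition ratio_poly :: "real \<Rightarrow> real \<Rightarrow> real \<Rightarrow> real" where
  "ratio_poly a d v = 1 + (1 - a/2) * d + (1 - 5/6*a + a^2/8) * d^2
     + ((1 + a) + (3/2*a - a^2/2) * d) * v + (a^2/2 + (3/2*a^2 - 3/2*a - a^3/4) * d) * v^2
     + (a^3/6 - a^2/2) * v^3 + (a^4/24 - a^3/3 + a^2/2) * v^4"

lemma poly_bounded_ratio_poly: "poly_bounded (\<lambda>x. ratio_poly a d (rel_dev n x))"
  unfolding ratio_poly_def divide_inverse by (intro poly_bounded_intros poly_bounded_rel_dev)

lemma eventually_near:
  assumes "eventually P at_top"
  shows "\<forall>\<^sub>F z in near. P (alpha (fst z)) \<and> alpha (fst z) * \<bar>rel_dev (fst z) (snd z)\<bar> \<le> 1 / 2"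
  unfolding near_def eventually_inf_principal eventually_pairs
  using eventually_alpha[OF assms] by eventually_elim auto

lemma eventually_near_bounds:
  "\<forall>\<^sub>F z in near. 1 \<le> alpha (fst z) \<and> alpha (fst z) * (1 / cen (fst z)) \<le> 1 / 4
     \<and> alpha (fst z) * \<bar>rel_dev (fst z) (snd z)\<bar> \<le> 1 / 2 \<and> \<bar>rel_dev (fst z) (snd z)\<bar> \<le> 1 / 2"
proof -
  have "\<forall>\<^sub>F a::real in at_top. 1 \<le> a \<and> a * (1 / exp a) \<le> 1 / 4"
    by (intro eventually_conj eventually_ge_at_top) real_asymp
  from eventually_near[OF this] show ?thesis
  proof eventually_elim
    case (elim z)
    then have "1 * \<bar>rel_dev (fst z) (snd z)\<bar> \<le> alpha (fst z) * \<bar>rel_dev (fst z) (snd z)\<bar>"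
      by (intro mult_right_mono) auto
    with elim show ?case by (auto simp: cen_def)
  qed
qed

lemma ratio_eq_exp:
  fixes n x
  defines "v \<equiv> rel_dev n x" and "d \<equiv> 1 / cen n"
  assumes "\<bar>v\<bar> \<le> 1 / 2" "d \<le> 1 / 4"
  shows "ratio n x = exp (alpha n + ln (1 + v) + (alpha n / d - 1) * ln (1 - d * (1 / (1 + v))))"
proof -
  have c: "cen n > 0" using cen_gt_1[of n] by simp
  have v: "1 + v \<ge> 1 / 2" using assms(3) by linarith
  have x: "x = cen n * (1 + v)" unfolding v_def by (rule eq_cen_rel_dev)
  then have inverse: "d * (1 / (1 + v)) = 1 / x" by (simp add: d_def)
  have "cen n \<ge> 4" using assms(4) c by (simp add: d_def field_simps)
  then have "4 * (1 / 2) \<le> cen n * (1 + v)" using v by (intro mult_mono) auto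
  then have x2: "x \<ge> 2" using x by simp
  have "exp (alpha n + ln (1 + v)) = x" using v by (simp add: x exp_add cen_def)
  moreover have "exp (real n * ln (1 - 1 / x)) = (1 - 1 / x) ^ n"
    using x2 by (simp add: exp_of_nat_mult)
  ultimately have "ratio n x = exp (alpha n + ln (1 + v) + real n * ln (1 - 1 / x))"
    using x2 by (simp add: ratio_def exp_add)
  moreover have "real n = alpha n / d - 1" by (simp add: real_eq_alpha_cen d_def)
  ultimately show "ratio n x = exp (alpha n + ln (1 + v) + (alpha n / d - 1) * ln (1 - d * (1 / (1 + v))))"
    by (simp only: inverse)
qed

context
  fixes A T V J X :: "nat \<times> real \<Rightarrow> real"
  defines "A \<equiv> \<lambda>z. alpha (fst z)" and "T \<equiv> \<lambda>z. 1 / cen (fst z)" and "V \<equiv> \<lambda>z. rel_dev (fst z) (snd z)"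
    and "J \<equiv> \<lambda>z. 1 / (1 + V z)" and "X \<equiv> \<lambda>z. A z + ln (1 + V z) + (A z / T z - 1) * ln (1 - T z * J z)"
begin

lemma near_bounds:
  "\<forall>\<^sub>F z in near. 1 \<le> A z \<and> 0 < T z \<and> A z * T z \<le> 1 / 4 \<and> T z \<le> 1 / 4 \<and> A z * \<bar>V z\<bar> \<le> 1 / 2 \<and> \<bar>V z\<bar> \<le> 1 / 2
    \<and> 0 < J z \<and> J z \<le> 2 \<and> J z * (1 + V z) = 1 \<and> 0 < T z * J z \<and> T z * J z \<le> 1 / 2"
  using eventually_near_bounds
proof eventually_elim
  case (elim z)
  have T: "0 < T z" using cen_gt_1[of "fst z"] by (simp add: T_def)
  have A: "1 \<le> A z" and AT: "A z * T z \<le> 1 / 4" and V: "\<bar>V z\<bar> \<le> 1 / 2" using elim by (auto simp: A_def T_def V_def)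
  have "1 * T z \<le> A z * T z" using A T by (intro mult_right_mono) auto
  then have T_le: "T z \<le> 1 / 4" using AT by linarith
  have "1 + V z \<ge> 1 / 2" using V by linarith
  then have J: "0 < J z" "J z \<le> 2" "J z * (1 + V z) = 1" by (auto simp: J_def field_simps)
  have "T z * J z \<le> 1 / 4 * 2" using J T T_le by (intro mult_mono) auto
  then show ?case using elim T T_le A AT V J by (auto simp: A_def V_def)
qed

lemma near_of_order:
  "near.of_order 0 A" "near.of_order 2 T" "near.of_order 1 V" "near.of_order 0 J"
proof -
  note restrict = pair.of_order_restrict[OF _ near_le_pairs]
  show "near.of_order 0 A" unfolding A_def by (intro restrict pair_of_order_fst seq.of_order_L)
  show "near.of_order 2 T" unfolding T_def by (intro restrict pair_of_order_fst seq_of_order_inverse_cen)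
  show "near.of_order 1 V"
    unfolding V_def using restrict[OF pair_of_order_rel_dev] by (simp add: case_prod_unfold)
  show "near.of_order 0 J"
    by (rule near.of_order_bigo_1, rule bigoI[of _ 2]) (use near_bounds in eventually_elim, auto)
qed

lemma near_of_order_monomial:
  assumes "near.of_order 0 h" "k \<le> 2 * int i + int j"
  shows "near.of_order k (\<lambda>z. h z * T z ^ i * V z ^ j)"
  by (rule near.of_order_mult[of "2 * int i" _ "int j"], rule near.of_order_mult_order_0)
     (use assms in \<open>auto intro!: near.of_order_power[OF near_of_order(2)]
       near.of_order_power[OF near_of_order(3)]\<close>)

lemmas near_of_order_0_intros = near_of_order(1,4) near.of_order_mono[OF near_of_order(3), of 0, simplified]
  near.of_order_const near.of_order_add near.of_order_diff near.of_order_minus near.of_order_divide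
  near.of_order_mult_order_0
  near.of_order_power[where i = 0 and k = 0, simplified]

lemma near_approx_inverse:
  assumes "near.of_order 0 h"
  shows "near.approx 5 (\<lambda>z. h z * J z) (\<lambda>z. h z * (1 - V z + V z ^ 2 - V z ^ 3 + V z ^ 4))" (is ?thesis1)
    and "near.approx 5 (\<lambda>z. h z * T z * J z) (\<lambda>z. h z * T z * (1 - V z + V z ^ 2))" (is ?thesis2)
    and "near.approx 5 (\<lambda>z. h z * T z * J z ^ 2) (\<lambda>z. h z * T z * (1 - 2 * V z + 3 * V z ^ 2))" (is ?thesis3)
proof -
  have J_eq: "\<forall>\<^sub>F z in near. J z * (1 + V z) = 1" using near_bounds by eventually_elim auto
  note monomial = near_of_order_monomial[OF near.of_order_mult_order_0[OF assms]]
  show ?thesis1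
  proof (rule near.approxI)
    show "near.of_order 5 (\<lambda>z. h z * (- 1 * J z) * T z ^ 0 * V z ^ 5)"
      by (intro monomial near_of_order_0_intros) simp
    show "\<forall>\<^sub>F z in near. h z * J z = h z * (1 - V z + V z ^ 2 - V z ^ 3 + V z ^ 4)
        + h z * (- 1 * J z) * T z ^ 0 * V z ^ 5"
      using J_eq by eventually_elim algebra
  qed
  show ?thesis2
  proof (rule near.approxI)
    show "near.of_order 5 (\<lambda>z. h z * (- 1 * J z) * T z ^ 1 * V z ^ 3)"
      by (intro monomial near_of_order_0_intros) simp
    show "\<forall>\<^sub>F z in near. h z * T z * J z = h z * T z * (1 - V z + V z ^ 2) + h z * (- 1 * J z) * T z ^ 1 * V z ^ 3"
      using J_eq by eventually_elim algebra
  qed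
  show ?thesis3
  proof (rule near.approxI)
    show "near.of_order 5 (\<lambda>z. h z * (- 1 * (4 + 3 * V z) * J z ^ 2) * T z ^ 1 * V z ^ 3)"
      by (intro monomial near_of_order_0_intros) simp
    show "\<forall>\<^sub>F z in near. h z * T z * J z ^ 2 = h z * T z * (1 - 2 * V z + 3 * V z ^ 2)
        + h z * (- 1 * (4 + 3 * V z) * J z ^ 2) * T z ^ 1 * V z ^ 3"
      using J_eq by eventually_elim algebra
  qed
qed

lemma near_approx_inverse_power:
  assumes "near.of_order 0 h"
  shows "near.approx 5 (\<lambda>z. h z * T z ^ 2 * J z ^ m) (\<lambda>z. h z * T z ^ 2)"
proof (induction m)
  case (Suc m)
  have "near.approx 5 (\<lambda>z. h z * T z ^ 2 * J z ^ Suc m) (\<lambda>z. h z * T z ^ 2 * J z ^ m)"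
  proof (rule near.approxI)
    show "near.of_order 5 (\<lambda>z. h z * (- 1 * J z ^ Suc m) * T z ^ 2 * V z ^ 1)"
      by (intro near_of_order_monomial near.of_order_mult_order_0 assms near_of_order_0_intros) simp
    show "\<forall>\<^sub>F z in near. h z * T z ^ 2 * J z ^ Suc m =
        h z * T z ^ 2 * J z ^ m + h z * (- 1 * J z ^ Suc m) * T z ^ 2 * V z ^ 1"
      using near_bounds
    proof eventually_elim
      case (elim z)
      then have "h z * T z ^ 2 * J z ^ m * (J z * (1 + V z)) = h z * T z ^ 2 * J z ^ m" by simp
      then show ?case by (simp add: algebra_simps)
    qed
  qed
  then show ?case using Suc by (rule near.approx_trans)
qed (simp add: near.approx_refl)

lemma near_approx_ln: "near.approx 5 (\<lambda>z. ln (1 + V z)) (\<lambda>z. V z - V z ^ 2 / 2 + V z ^ 3 / 3 - V z ^ 4 / 4)"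
  unfolding near.approx_def
proof (rule near.of_order_bound[where C = 2])
  show "near.of_order 5 (\<lambda>z. V z ^ 5)" by (rule near.of_order_power[OF near_of_order(3)]) simp
  show "\<forall>\<^sub>F z in near. \<bar>ln (1 + V z) - (V z - V z ^ 2 / 2 + V z ^ 3 / 3 - V z ^ 4 / 4)\<bar> \<le> 2 * \<bar>V z ^ 5\<bar>"
    using near_bounds
  proof eventually_elim
    case (elim z)
    then show ?case using ln_taylor[of "V z" 4] by (simp add: eval_nat_numeral abs_mult algebra_simps)
  qed
qed

lemma near_approx_ln_inverse:
  "near.approx 5 (\<lambda>z. (A z / T z - 1) * ln (1 - T z * J z))
    (\<lambda>z. T z * J z + T z ^ 2 * J z ^ 2 / 2 - (A z * J z + A z * T z * J z ^ 2 / 2 + A z * T z ^ 2 * J z ^ 3 / 3))"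
proof (rule near.approxI)
  define R where "R z = ln (1 - T z * J z) + (T z * J z + (T z * J z) ^ 2 / 2 + (T z * J z) ^ 3 / 3)" for z
  have "near.of_order 5 (\<lambda>z. (A z / T z - 1) * R z)"
  proof (rule near.of_order_bound)
    show "near.of_order 5 (\<lambda>z. A z * J z ^ 4 * T z ^ 3 * V z ^ 0)"
      by (intro near_of_order_monomial near_of_order_0_intros) simp
    show "\<forall>\<^sub>F z in near. \<bar>(A z / T z - 1) * R z\<bar> \<le> 2 * \<bar>A z * J z ^ 4 * T z ^ 3 * V z ^ 0\<bar>"
      using near_bounds
    proof eventually_elim
      case (elim z)
      have "\<bar>R z\<bar> \<le> 2 * \<bar>T z * J z\<bar> ^ 4"
        using ln_taylor[of "- (T z * J z)" 3] elim by (simp add: R_def eval_nat_numeral abs_mult algebra_simps)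
      moreover have "\<bar>A z / T z - 1\<bar> \<le> A z / T z" using elim by (auto simp: abs_if field_simps)
      ultimately have "\<bar>(A z / T z - 1) * R z\<bar> \<le> A z / T z * (2 * \<bar>T z * J z\<bar> ^ 4)"
        unfolding abs_mult[of "A z / T z - 1"] using elim by (intro mult_mono) auto
      also have "\<dots> = 2 * \<bar>A z * J z ^ 4 * T z ^ 3 * V z ^ 0\<bar>"
        using elim by (simp add: abs_mult power_mult_distrib power_abs eval_nat_numeral)
      finally show ?case .
    qed
  qed
  moreover have "near.of_order 5 (\<lambda>z. 1/3 * J z ^ 3 * T z ^ 3 * V z ^ 0)"
    by (intro near_of_order_monomial near_of_order_0_intros) simp
  ultimately show "near.of_order 5 (\<lambda>z. (A z / T z - 1) * R z + 1/3 * J z ^ 3 * T z ^ 3 * V z ^ 0)"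
    by (rule near.of_order_add)
  show "\<forall>\<^sub>F z in near. (A z / T z - 1) * ln (1 - T z * J z) =
      T z * J z + T z ^ 2 * J z ^ 2 / 2 - (A z * J z + A z * T z * J z ^ 2 / 2 + A z * T z ^ 2 * J z ^ 3 / 3)
      + ((A z / T z - 1) * R z + 1/3 * J z ^ 3 * T z ^ 3 * V z ^ 0)"
    using near_bounds by eventually_elim (simp add: R_def field_simps eval_nat_numeral)
qed

lemma log_ratio_bounded: "\<forall>\<^sub>F z in near. \<bar>X z\<bar> \<le> 5"
  using near_bounds
proof eventually_elim
  case (elim z)
  have "\<bar>ln (1 + V z) - V z\<bar> \<le> 2 * \<bar>V z\<bar> ^ 2"
    using ln_taylor[of "V z" 1] elim by (simp add: numeral_2_eq_2)
  also have "\<dots> \<le> 2 * (1 / 2) ^ 2" using elim by (intro mult_left_mono power_mono) auto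
  finally have "\<bar>ln (1 + V z) - V z\<bar> \<le> 1 / 2" by (simp add: power2_eq_square)
  then have lnV: "\<bar>ln (1 + V z)\<bar> \<le> 1" using elim by linarith
  define E where "E = ln (1 - T z * J z) + T z * J z"
  have "\<bar>E\<bar> \<le> 2 * (T z * J z) ^ 2" using ln_taylor[of "- (T z * J z)" 1] elim by (simp add: E_def power2_eq_square)
  moreover have "\<bar>A z / T z - 1\<bar> \<le> A z / T z" using elim by (auto simp: abs_if field_simps)
  ultimately have "\<bar>(A z / T z - 1) * E\<bar> \<le> A z / T z * (2 * (T z * J z) ^ 2)"
    unfolding abs_mult using elim by (intro mult_mono) auto
  also have "\<dots> = 2 * ((A z * T z) * J z ^ 2)" using elim by (simp add: power2_eq_square)
  also have "\<dots> \<le> 2 * (1 / 4 * 2 ^ 2)" using elim by (intro mult_left_mono mult_mono power_mono) auto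
  finally have E: "\<bar>(A z / T z - 1) * E\<bar> \<le> 2" by simp
  have "\<bar>A z * V z * J z\<bar> \<le> 1 / 2 * 2" unfolding abs_mult using elim by (intro mult_mono) auto
  moreover have "A z - A z * J z = A z * V z * J z" using elim by algebra
  moreover have "X z = (A z - A z * J z) + ln (1 + V z) + T z * J z + (A z / T z - 1) * E"
    using elim by (simp add: X_def E_def field_simps)
  ultimately show ?case using lnV E elim by linarith
qed

lemma near_approx_log_ratio:
  "near.approx 5 X (\<lambda>z. (1 + A z) * V z
    + (T z - A z * T z / 2 - V z ^ 2 / 2 - A z * V z ^ 2)
    + (V z ^ 3 / 3 + A z * V z ^ 3 - T z * V z + A z * T z * V z)
    + (T z ^ 2 / 2 - A z * T z ^ 2 / 3 + T z * V z ^ 2 - 3 / 2 * (A z * T z * V z ^ 2) - V z ^ 4 / 4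
      - A z * V z ^ 4))"
proof -
  note inverse = near_approx_inverse[OF near_of_order(1)] near_approx_inverse_power[OF near_of_order(1)]
    near_approx_inverse[OF near.of_order_const[of 1], simplified]
    near_approx_inverse_power[OF near.of_order_const[of 1], simplified]
  have "near.approx 5 (\<lambda>z. (A z / T z - 1) * ln (1 - T z * J z))
     (\<lambda>z. T z * (1 - V z + V z ^ 2) + T z ^ 2 / 2 - (A z * (1 - V z + V z ^ 2 - V z ^ 3 + V z ^ 4)
        + A z * T z * (1 - 2 * V z + 3 * V z ^ 2) / 2 + A z * T z ^ 2 / 3))"
    by (rule near.approx_trans[OF near_approx_ln_inverse])
       (intro near.approx_add near.approx_diff near.approx_divide inverse)
  from near.approx_add[OF near_approx_ln this] show ?thesis
    unfolding near.approx_def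
    by (rule near.of_order_cong) (simp add: X_def algebra_simps add_divide_distrib diff_divide_distrib)
qed

lemma log_ratio_terms_of_order:
  "near.of_order 1 (\<lambda>z. (1 + A z) * V z)"
  "near.of_order 2 (\<lambda>z. T z - A z * T z / 2 - V z ^ 2 / 2 - A z * V z ^ 2)"
  "near.of_order 3 (\<lambda>z. V z ^ 3 / 3 + A z * V z ^ 3 - T z * V z + A z * T z * V z)"
  "near.of_order 4 (\<lambda>z. T z ^ 2 / 2 - A z * T z ^ 2 / 3 + T z * V z ^ 2 - 3 / 2 * (A z * T z * V z ^ 2)
    - V z ^ 4 / 4 - A z * V z ^ 4)"
proof -
  have "near.of_order 1 (\<lambda>z. (1 + A z) * T z ^ 0 * V z ^ 1)"
      by (intro near_of_order_monomial near_of_order_0_intros) simp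
  then show "near.of_order 1 (\<lambda>z. (1 + A z) * V z)" by simp
  have "near.of_order 2 (\<lambda>z. (1 - A z / 2) * T z ^ 1 * V z ^ 0 + (- (1 / 2) - A z) * T z ^ 0 * V z ^ 2)"
    by (intro near.of_order_add near_of_order_monomial near_of_order_0_intros) simp_all
  then show "near.of_order 2 (\<lambda>z. T z - A z * T z / 2 - V z ^ 2 / 2 - A z * V z ^ 2)"
    by (simp add: algebra_simps)
  have "near.of_order 3 (\<lambda>z. (1 / 3 + A z) * T z ^ 0 * V z ^ 3 + (A z - 1) * T z ^ 1 * V z ^ 1)"
    by (intro near.of_order_add near_of_order_monomial near_of_order_0_intros) simp_all
  then show "near.of_order 3 (\<lambda>z. V z ^ 3 / 3 + A z * V z ^ 3 - T z * V z + A z * T z * V z)"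
    by (simp add: algebra_simps)
  have "near.of_order 4 (\<lambda>z. (1 / 2 - A z / 3) * T z ^ 2 * V z ^ 0 + (1 - 3 / 2 * A z) * T z ^ 1 * V z ^ 2
      + (- (1 / 4) - A z) * T z ^ 0 * V z ^ 4)"
    by (intro near.of_order_add near_of_order_monomial near_of_order_0_intros) simp_all
  then show "near.of_order 4 (\<lambda>z. T z ^ 2 / 2 - A z * T z ^ 2 / 3 + T z * V z ^ 2
      - 3 / 2 * (A z * T z * V z ^ 2) - V z ^ 4 / 4 - A z * V z ^ 4)"
    by (simp add: algebra_simps)
qed

lemma near_approx_ratio_poly: "near.approx 5 (\<lambda>z. ratio (fst z) (snd z)) (\<lambda>z. ratio_poly (A z) (T z) (V z))"
proof -
  have exp_X: "\<forall>\<^sub>F z in near. exp (X z) = ratio (fst z) (snd z)"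
    using near_bounds
  proof eventually_elim
    case (elim z)
    then show ?case
      using ratio_eq_exp[of "fst z" "snd z"] by (simp only: X_def A_def T_def V_def J_def)
  qed
  from near.approx_exp[OF near_approx_log_ratio log_ratio_terms_of_order log_ratio_bounded] show ?thesis
    unfolding near.approx_def
    by (rule near.of_order_cong)
       (use exp_X in \<open>eventually_elim, simp add: ratio_poly_def field_simps eval_nat_numeral\<close>)
qed

end

lemma pair_approx_ratio_poly:
  "pair.approx 5 (\<lambda>z. ratio (fst z) (snd z))
      (\<lambda>z. ratio_poly (alpha (fst z)) (1 / cen (fst z)) (rel_dev (fst z) (snd z)))"
proof -
  define err where "err z = ratio (fst z) (snd z)
      - ratio_poly (alpha (fst z)) (1 / cen (fst z)) (rel_dev (fst z) (snd z))" for z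
  have "near.of_order 5 err" using near_approx_ratio_poly by (simp add: near.approx_def err_def[abs_def])
  moreover have "far.of_order 5 err"
  proof -
    note pair_orders = pair_of_order_fst[OF seq.of_order_L] pair_of_order_fst[OF seq_of_order_cen]
      pair.of_order_mono[OF pair_of_order_fst[OF seq_of_order_inverse_cen], of 0, simplified]
      pair.of_order_mono[OF pair_of_order_rel_dev[unfolded case_prod_unfold], of 0, simplified]
    note intros = pair_orders pair.of_order_const pair.of_order_add pair.of_order_diff pair.of_order_divide
      pair.of_order_mult_order_0 pair.of_order_power[where i = 0 and k = 0, simplified]
    have "pair.of_order (- 2) (\<lambda>z. cen (fst z) * (1 + rel_dev (fst z) (snd z)))"
      by (rule pair.of_order_mult[OF pair_orders(2), of 0]) (intro intros, simp)
    then have "pair.of_order (- 2) (\<lambda>z. snd z)" by (simp flip: eq_cen_rel_dev)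
    then have "pair.of_order (- 2) (\<lambda>z. ratio (fst z) (snd z))"
      by (rule pair.of_order_bound[where C = 1]) (use ratio_bounds in \<open>auto intro!: always_eventually\<close>)
    moreover have "pair.of_order 0 (\<lambda>z. ratio_poly (alpha (fst z)) (1 / cen (fst z)) (rel_dev (fst z) (snd z)))"
      unfolding ratio_poly_def by (intro intros)
    ultimately have "pair.of_order (- 2) err"
      unfolding err_def[abs_def] by (intro pair.of_order_diff) (auto elim: pair.of_order_mono)
    then show ?thesis by (rule far_of_order)
  qed
  ultimately show ?thesis
    using near.of_order_sup[OF far.asymptotic_scale_axioms]
    by (simp add: sup_near_far pair.approx_def err_def[abs_def])
qed

section \<open>Two-term expansions\<close>

interpretation growth: asymptotic_scale at_top "\<lambda>a::real. a" "\<lambda>_. 1"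
  by unfold_locales (auto intro: eventually_ge_at_top)

abbreviation poly_growth :: "(real \<Rightarrow> real) \<Rightarrow> bool" where
  "poly_growth \<equiv> growth.of_order 0"

lemma seq_of_order_alpha:
  assumes "poly_growth \<phi>"
  shows "seq.of_order 0 (\<lambda>n. \<phi> (alpha n))"
proof -
  obtain p where "\<phi> \<in> O(\<lambda>a. a ^ p)" using assms by (auto simp: growth.of_order_def)
  then have "(\<lambda>n. \<phi> (alpha n)) \<in> O(\<lambda>n. alpha n ^ p)" by (rule landau_o.big.compose[OF _ filterlim_alpha])
  then show ?thesis by (intro seq.of_orderI[where p = p]) simp
qed

lemma poly_growth_cong: "poly_growth \<phi> \<Longrightarrow> (\<And>a. a > 0 \<Longrightarrow> \<phi> a = \<phi>' a) \<Longrightarrow> poly_growth \<phi>'"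
  by (erule growth.of_order_cong) (rule eventually_mono[OF eventually_gt_at_top[of 0]])

text \<open>The variance of the Dobinski weights is asymptotic to \<open>cen n * rel_var (alpha n)\<close>.\<close>

definition rel_var :: "real \<Rightarrow> real" where
  "rel_var a = 1 / (1 + a)"

lemma rel_var_eq: "a > 0 \<Longrightarrow> (1 + a) * rel_var a = 1"
  by (simp add: rel_var_def)

lemma mult_rel_var:
  assumes "a > 0"
  shows "a * rel_var a = 1 - rel_var a" "a * (rel_var a * x) = x - rel_var a * x"
  using rel_var_eq[OF assms] by algebra+

lemmas expand_polynomial = algebra_simps add_divide_distrib diff_divide_distrib eval_nat_numeral

lemma poly_growth_rel_var: "poly_growth rel_var"
  unfolding rel_var_def by (intro growth.of_order_bigo_1) real_asymp

lemmas poly_growth_intros = poly_growth_rel_var growth.of_order_L growth.of_order_const growth.of_order_add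
  growth.of_order_diff
  growth.of_order_minus growth.of_order_divide growth.of_order_mult_order_0
  growth.of_order_power[where i = 0 and k = 0, simplified]

lemma approx_alpha_solve:
  assumes "seq.approx k (\<lambda>n. (1 + alpha n) * f n) (\<lambda>n. (1 + alpha n) * g n)"
  shows "seq.approx k f g"
proof -
  have "rel_var (alpha n) * ((1 + alpha n) * x) = x" for n x
    using rel_var_eq[OF alpha_pos[of n]] by (simp add: mult.commute[of "rel_var _"])
  with seq.approx_mult_left[OF seq_of_order_alpha[OF poly_growth_rel_var] assms, of k] show ?thesis by simp
qed

lemma poly_growth_solve:
  assumes "poly_growth \<phi>" "\<And>a. a > 0 \<Longrightarrow> \<phi> a = (1 + a) * \<psi> a"
  shows "poly_growth \<psi>"
  by (rule poly_growth_cong[OF growth.of_order_mult_order_0[OF poly_growth_rel_var assms(1)]])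
     (simp add: assms(2) rel_var_def)

lemma approx_cen_power_mult:
  assumes "seq.approx k f g" "j + 2 * int p = k"
    and "\<And>n. cen n ^ p * f n = f' n" "\<And>n. cen n ^ p * g n = g' n"
  shows "seq.approx j f' g'"
proof -
  have "seq.approx j (\<lambda>n. cen n ^ p * f n) (\<lambda>n. cen n ^ p * g n)"
    using seq.approx_mult_left[OF seq.of_order_power[OF seq_of_order_cen, of "- 2 * int p"] assms(1)]
      assms(2) by auto
  then show ?thesis by (simp only: assms(3,4))
qed

definition one_term :: "(nat \<Rightarrow> real) \<Rightarrow> (real \<Rightarrow> real) \<Rightarrow> bool" where
  "one_term f \<phi> \<longleftrightarrow> poly_growth \<phi> \<and> seq.approx 1 f (\<lambda>n. \<phi> (alpha n))"

lemma one_term_of_order: "one_term f \<phi> \<Longrightarrow> seq.of_order 0 f"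
  unfolding one_term_def by (blast intro: seq.approx_of_order seq.approx_mono seq_of_order_alpha zero_le_one)

lemma one_term_coeff: "poly_growth \<phi> \<Longrightarrow> one_term (\<lambda>n. \<phi> (alpha n)) \<phi>"
  by (simp add: one_term_def seq.approx_refl)

lemma one_term_const: "one_term (\<lambda>_. c) (\<lambda>_. c)"
  by (rule one_term_coeff[OF growth.of_order_const])

lemma one_term_add: "one_term f \<phi> \<Longrightarrow> one_term g \<psi> \<Longrightarrow> one_term (\<lambda>n. f n + g n) (\<lambda>a. \<phi> a + \<psi> a)"
  by (simp add: one_term_def growth.of_order_add seq.approx_add)

lemma one_term_diff: "one_term f \<phi> \<Longrightarrow> one_term g \<psi> \<Longrightarrow> one_term (\<lambda>n. f n - g n) (\<lambda>a. \<phi> a - \<psi> a)"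
  by (simp add: one_term_def growth.of_order_diff seq.approx_diff)

lemma one_term_mult: "one_term f \<phi> \<Longrightarrow> one_term g \<psi> \<Longrightarrow> one_term (\<lambda>n. f n * g n) (\<lambda>a. \<phi> a * \<psi> a)"
  using one_term_of_order[of f \<phi>]
  by (auto simp: one_term_def intro: growth.of_order_mult_order_0 seq.approx_mult seq_of_order_alpha)

lemma one_term_divide: "one_term f \<phi> \<Longrightarrow> one_term (\<lambda>n. f n / c) (\<lambda>a. \<phi> a / c)"
  by (simp add: one_term_def growth.of_order_divide seq.approx_divide)

lemma one_term_power: "one_term f \<phi> \<Longrightarrow> one_term (\<lambda>n. f n ^ m) (\<lambda>a. \<phi> a ^ m)"
  by (induction m) (simp_all add: one_term_const one_term_mult)

lemma one_term_solve:
  assumes "seq.approx 1 (\<lambda>n. (1 + alpha n) * f n) g" "one_term g \<phi>" "\<And>a. a > 0 \<Longrightarrow> \<phi> a = (1 + a) * \<psi> a"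
  shows "one_term f \<psi>"
proof -
  have "seq.approx 1 (\<lambda>n. (1 + alpha n) * f n) (\<lambda>n. (1 + alpha n) * \<psi> (alpha n))"
    using seq.approx_trans[OF assms(1)] assms(2,3) alpha_pos by (simp add: one_term_def)
  then show ?thesis
    using approx_alpha_solve poly_growth_solve[of \<phi> \<psi>] assms(2,3) by (simp add: one_term_def)
qed

lemmas one_term_intros = one_term_coeff[OF growth.of_order_L] one_term_const one_term_add one_term_diff
  one_term_mult one_term_divide one_term_power

definition two_term :: "(nat \<Rightarrow> real) \<Rightarrow> (real \<Rightarrow> real) \<Rightarrow> (real \<Rightarrow> real) \<Rightarrow> bool" where
  "two_term f \<phi> \<psi> \<longleftrightarrow> poly_growth \<phi> \<and> poly_growth \<psi> \<and>
     seq.approx 3 f (\<lambda>n. \<phi> (alpha n) + \<psi> (alpha n) / cen n)"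

lemma two_termD:
  assumes "two_term f \<phi> \<psi>"
  shows "poly_growth \<phi>" "poly_growth \<psi>"
    and "seq.approx 3 f (\<lambda>n. \<phi> (alpha n) + \<psi> (alpha n) / cen n)"
    and "seq.of_order 0 (\<lambda>n. \<phi> (alpha n) + \<psi> (alpha n) / cen n)"
    and "seq.of_order 0 f"
proof -
  show g: "poly_growth \<phi>" "poly_growth \<psi>" and f: "seq.approx 3 f (\<lambda>n. \<phi> (alpha n) + \<psi> (alpha n) / cen n)"
    using assms by (simp_all add: two_term_def)
  have "seq.of_order 0 (\<lambda>n. 1 / cen n)" by (rule seq.of_order_mono[OF seq_of_order_inverse_cen]) simp
  from seq.of_order_add[OF seq_of_order_alpha[OF g(1)]
    seq.of_order_mult_order_0[OF seq_of_order_alpha[OF g(2)] this]]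
  show "seq.of_order 0 (\<lambda>n. \<phi> (alpha n) + \<psi> (alpha n) / cen n)" by simp
  with seq.approx_of_order[OF seq.approx_mono[OF f]] show "seq.of_order 0 f" by simp
qed

lemma two_term_coeff: "poly_growth \<phi> \<Longrightarrow> two_term (\<lambda>n. \<phi> (alpha n)) \<phi> (\<lambda>_. 0)"
  by (simp add: two_term_def growth.of_order_const seq.approx_refl)

lemma two_term_const: "two_term (\<lambda>_. c) (\<lambda>_. c) (\<lambda>_. 0)"
  by (rule two_term_coeff[OF growth.of_order_const])

lemma two_term_add:
  assumes "two_term f \<phi> \<psi>" "two_term g \<phi>' \<psi>'"
  shows "two_term (\<lambda>n. f n + g n) (\<lambda>a. \<phi> a + \<phi>' a) (\<lambda>a. \<psi> a + \<psi>' a)"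
  using seq.approx_add[OF two_termD(3)[OF assms(1)] two_termD(3)[OF assms(2)]] two_termD(1,2)[OF assms(1)]
    two_termD(1,2)[OF assms(2)]
  by (simp add: two_term_def growth.of_order_add add_divide_distrib add_ac)

lemma two_term_mult:
  assumes "two_term f \<phi> \<psi>" "two_term g \<phi>' \<psi>'"
  shows "two_term (\<lambda>n. f n * g n) (\<lambda>a. \<phi> a * \<phi>' a) (\<lambda>a. \<phi> a * \<psi>' a + \<psi> a * \<phi>' a)"
proof -
  note f = two_termD[OF assms(1)] and g = two_termD[OF assms(2)]
  have "seq.approx 3 (\<lambda>n. f n * g n)
      (\<lambda>n. (\<phi> (alpha n) + \<psi> (alpha n) / cen n) * (\<phi>' (alpha n) + \<psi>' (alpha n) / cen n))"
    by (rule seq.approx_mult[OF f(3) g(3) f(5) g(4)])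
  also have "seq.approx 3 \<dots>
      (\<lambda>n. \<phi> (alpha n) * \<phi>' (alpha n) + (\<phi> (alpha n) * \<psi>' (alpha n) + \<psi> (alpha n) * \<phi>' (alpha n)) / cen n)"
  proof (rule seq.approxI)
    have "seq.of_order 0 (\<lambda>n. \<psi> (alpha n) * \<psi>' (alpha n))"
      by (intro seq.of_order_mult_order_0 seq_of_order_alpha f g)
    then show "seq.of_order 3 (\<lambda>n. \<psi> (alpha n) * \<psi>' (alpha n) * (1 / cen n) ^ 2)"
      by (rule seq.of_order_mult[OF _ seq.of_order_power[OF seq_of_order_inverse_cen, of 3]]) simp_all
  qed (simp add: ring_distribs add_divide_distrib power2_eq_square mult_ac)
  finally show ?thesis
    using f(1,2) g(1,2) by (simp add: two_term_def growth.of_order_mult_order_0 growth.of_order_add)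
qed

lemma two_term_diff:
  assumes "two_term f \<phi> \<psi>" "two_term g \<phi>' \<psi>'"
  shows "two_term (\<lambda>n. f n - g n) (\<lambda>a. \<phi> a - \<phi>' a) (\<lambda>a. \<psi> a - \<psi>' a)"
  using two_term_add[OF assms(1) two_term_mult[OF two_term_const[of "- 1"] assms(2)]] by simp

lemma two_term_coeff_mult:
  assumes "poly_growth \<theta>" "two_term f \<phi> \<psi>"
  shows "two_term (\<lambda>n. \<theta> (alpha n) * f n) (\<lambda>a. \<theta> a * \<phi> a) (\<lambda>a. \<theta> a * \<psi> a)"
  using two_term_mult[OF two_term_coeff[OF assms(1)] assms(2)] by simp

lemma two_term_power: "two_term f \<phi> \<psi> \<Longrightarrow> two_term (\<lambda>n. f n ^ m) (\<lambda>a. \<phi> a ^ m) (\<lambda>a. real m * \<phi> a ^ (m - 1) * \<psi> a)"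
proof (induction m)
  case (Suc m)
  have "\<phi> a * (real m * \<phi> a ^ (m - 1) * \<psi> a) + \<psi> a * \<phi> a ^ m = real (Suc m) * \<phi> a ^ m * \<psi> a" for a
    by (cases m) (simp_all add: algebra_simps)
  then show ?case using two_term_mult[OF Suc.prems Suc.IH[OF Suc.prems]] by simp
qed (simp add: two_term_const)

lemma two_term_cong:
  assumes "two_term f \<phi> \<psi>" "\<And>a. a > 0 \<Longrightarrow> \<phi> a = \<phi>' a" "\<And>a. a > 0 \<Longrightarrow> \<psi> a = \<psi>' a"
  shows "two_term f \<phi>' \<psi>'"
  using assms(1) poly_growth_cong[of \<phi> \<phi>'] poly_growth_cong[of \<psi> \<psi>'] assms(2,3) alpha_pos
  by (simp add: two_term_def)

lemma two_term_solve:
  assumes "seq.approx 3 (\<lambda>n. (1 + alpha n) * f n) g" "two_term g \<phi> \<psi>"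
    and "\<And>a. a > 0 \<Longrightarrow> \<phi> a = (1 + a) * \<phi>' a" "\<And>a. a > 0 \<Longrightarrow> \<psi> a = (1 + a) * \<psi>' a"
  shows "two_term f \<phi>' \<psi>'"
proof -
  note g = two_termD[OF assms(2)]
  have "\<phi> (alpha n) + \<psi> (alpha n) / cen n = (1 + alpha n) * (\<phi>' (alpha n) + \<psi>' (alpha n) / cen n)" for n
    using assms(3,4) alpha_pos by (simp add: distrib_left)
  with seq.approx_trans[OF assms(1) g(3)]
  have "seq.approx 3 (\<lambda>n. (1 + alpha n) * f n) (\<lambda>n. (1 + alpha n) * (\<phi>' (alpha n) + \<psi>' (alpha n) / cen n))" by simp
  then show ?thesis
    using approx_alpha_solve poly_growth_solve assms(3,4) g(1,2) by (simp add: two_term_def)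
qed

lemma two_term_imp_one_term:
  assumes "two_term f \<phi> \<psi>" shows "one_term f \<phi>"
proof -
  note f = two_termD[OF assms]
  have "seq.of_order 1 (\<lambda>n. \<psi> (alpha n) * (1 / cen n))"
    by (rule seq.of_order_mult_order_0[OF seq_of_order_alpha[OF f(2)]
          seq.of_order_mono[OF seq_of_order_inverse_cen]]) simp
  then have "seq.approx 1 (\<lambda>n. \<phi> (alpha n) + \<psi> (alpha n) / cen n) (\<lambda>n. \<phi> (alpha n))"
    by (rule seq.approxI) simp
  with seq.approx_mono[OF f(3), of 1] have "seq.approx 1 f (\<lambda>n. \<phi> (alpha n))"
    by (simp add: seq.approx_trans)
  with f(1) show ?thesis by (simp add: one_term_def)
qed

lemma one_term_divide_cen:
  assumes "one_term f \<phi>" shows "two_term (\<lambda>n. f n / cen n) (\<lambda>_. 0) \<phi>"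
  using seq.approx_mult_left[OF seq_of_order_inverse_cen, of 1 f "\<lambda>n. \<phi> (alpha n)" 3] assms
  by (simp add: one_term_def two_term_def growth.of_order_const)

lemma two_term_diff_divide_cen:
  assumes "two_term f \<phi> \<psi>" "one_term g \<theta>"
  shows "two_term (\<lambda>n. f n - g n / cen n) \<phi> (\<lambda>a. \<psi> a - \<theta> a)"
  using two_term_diff[OF assms(1) one_term_divide_cen[OF assms(2)]] by simp

lemma two_term_inverse_cen_mult: "one_term f \<phi> \<Longrightarrow> two_term (\<lambda>n. 1 / cen n * f n) (\<lambda>_. 0) \<phi>"
  using one_term_divide_cen[of f \<phi>] by simp

lemmas two_term_inverse_cen = one_term_divide_cen[OF one_term_const[of 1]]

lemmas two_term_alpha = two_term_coeff[OF growth.of_order_L]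

lemma seq_of_order_1_bounded:
  assumes "seq.of_order 1 f" shows "f \<in> O(\<lambda>_. 1)"
proof -
  obtain p where p: "f \<in> O(\<lambda>n. alpha n ^ p * eps n)" using assms by (auto simp: seq.of_order_def)
  have "((\<lambda>x::real. x ^ p * exp (- x / 2)) \<longlongrightarrow> 0) at_top" by real_asymp
  from filterlim_compose[OF this filterlim_alpha]
  have "(\<lambda>n. alpha n ^ p * eps n) \<in> O(\<lambda>_. 1)"
    by (intro bigoI_tendsto[where c = 0]) (auto simp: eps_def)
  with p show ?thesis by (rule landau_o.big_trans)
qed

lemma cen_mult_bigo:
  assumes "two_term f (\<lambda>_. 0) \<psi>" "\<psi> \<in> O(\<lambda>a. a ^ m)"
  shows "(\<lambda>n. cen n * f n) \<in> O(\<lambda>n. alpha n ^ m)"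
proof -
  have "seq.approx 1 (\<lambda>n. cen n * f n) (\<lambda>n. \<psi> (alpha n))"
    by (rule approx_cen_power_mult[OF two_termD(3)[OF assms(1)], of _ 1]) (simp_all add: cen_nonzero)
  then have "(\<lambda>n. cen n * f n - \<psi> (alpha n)) \<in> O(\<lambda>_. 1)"
    unfolding seq.approx_def by (rule seq_of_order_1_bounded)
  also have "(\<lambda>_. 1) \<in> O(\<lambda>n. alpha n ^ m)"
    using seq.scale_bigo[of 0 m 0 0] by simp
  finally have "(\<lambda>n. cen n * f n - \<psi> (alpha n)) \<in> O(\<lambda>n. alpha n ^ m)" .
  from sum_in_bigo(1)[OF this landau_o.big.compose[OF assms(2) filterlim_alpha]] show ?thesis by simp
qed

lemma two_term_n_div_alpha_power: "two_term (\<lambda>n. (real n / alpha n) ^ k / cen n ^ k) (\<lambda>_. 1) (\<lambda>a. - real k / a)"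
proof -
  have "poly_growth (\<lambda>a. 1 / a)" by (intro growth.of_order_bigo_1) real_asymp
  then have "one_term (\<lambda>n. 1 / alpha n) (\<lambda>a. 1 / a)" by (rule one_term_coeff)
  from two_term_diff_divide_cen[OF two_term_const this, of 1]
  have "two_term (\<lambda>n. 1 - 1 / alpha n / cen n) (\<lambda>_. 1) (\<lambda>a. - 1 / a)" by simp
  moreover have "1 - 1 / alpha n / cen n = real n / alpha n / cen n" for n
    using alpha_pos[of n] cen_nonzero[of n] by (simp add: real_eq_alpha_cen diff_divide_distrib)
  ultimately have "two_term (\<lambda>n. real n / alpha n / cen n) (\<lambda>_. 1) (\<lambda>a. - 1 / a)" by simp
  from two_term_power[OF this, of k] show ?thesis by (simp add: power_divide power_mult_distrib)
qed

lemma two_term_bigo: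
  assumes "two_term (\<lambda>n. S n / cen n ^ k) \<phi> \<psi>" "(\<lambda>a. \<psi> a + real k * \<phi> a / a) \<in> O(\<lambda>a. a ^ (k - 2))" "k \<ge> 2"
  shows "(\<lambda>n. S n - \<phi> (alpha n) * (real n / alpha n) ^ k) \<in> O(\<lambda>n. real n ^ (k - 1) * inverse (alpha n))"
proof -
  have k: "Suc (k - 1) = k" "Suc (k - 2) = k - 1" using assms(3) by simp_all
  let ?r = "\<lambda>n. S n / cen n ^ k - \<phi> (alpha n) * ((real n / alpha n) ^ k / cen n ^ k)"
  have "two_term ?r (\<lambda>_. 0) (\<lambda>a. \<psi> a + real k * \<phi> a / a)"
    by (rule two_term_cong[OF two_term_diff[OF assms(1) two_term_coeff_mult[OF two_termD(1)[OF assms(1)]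
          two_term_n_div_alpha_power]]]) simp_all
  then have "(\<lambda>n. cen n * ?r n) \<in> O(\<lambda>n. alpha n ^ (k - 2))"
    using assms(2) by (rule cen_mult_bigo)
  then have "(\<lambda>n. cen n ^ (k - 1) * (cen n * ?r n)) \<in> O(\<lambda>n. cen n ^ (k - 1) * alpha n ^ (k - 2))"
    by (intro landau_o.big.mult) auto
  also have "(\<lambda>n. cen n ^ (k - 1) * (cen n * ?r n)) = (\<lambda>n. S n - \<phi> (alpha n) * (real n / alpha n) ^ k)"
  proof
    fix n
    have "cen n ^ (k - 1) * (cen n * ?r n) = cen n ^ Suc (k - 1) * ?r n" by simp
    then show "cen n ^ (k - 1) * (cen n * ?r n) = S n - \<phi> (alpha n) * (real n / alpha n) ^ k"
      unfolding k by (simp add: cen_nonzero right_diff_distrib)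
  qed
  also have "(\<lambda>n. cen n ^ (k - 1) * alpha n ^ (k - 2)) = (\<lambda>n. (real n + 1) ^ (k - 1) * inverse (alpha n))"
  proof
    fix n
    have "alpha n ^ Suc (k - 2) * inverse (alpha n) = alpha n ^ (k - 2)" using alpha_pos[of n] by simp
    then show "cen n ^ (k - 1) * alpha n ^ (k - 2) = (real n + 1) ^ (k - 1) * inverse (alpha n)"
      unfolding k by (simp add: real_eq_alpha_cen power_mult_distrib)
  qed
  also have "(\<lambda>n. (real n + 1) ^ (k - 1) * inverse (alpha n)) \<in> O(\<lambda>n. real n ^ (k - 1) * inverse (alpha n))"
  proof (intro landau_o.big.mult landau_o.big_power)
    show "(\<lambda>n. real n + 1) \<in> O(real)" by real_asymp
  qed simp
  finally show ?thesis .
qed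

section \<open>Moments of the Dobinski weights\<close>

definition rel_moment :: "nat \<Rightarrow> nat \<Rightarrow> real" where
  "rel_moment j n = mean n (\<lambda>x. rel_dev n x ^ j)"

lemma rel_moment_0: "rel_moment 0 n = 1"
  by (simp add: rel_moment_def mean_const)

lemmas poly_bounded_moment_intros = poly_bounded_dev_intros poly_bounded_rel_dev poly_bounded_ratio_poly

lemma seq_of_order_rel_moment: "seq.of_order (int j) (rel_moment j)"
proof -
  have "pair.of_order (int j) (\<lambda>(n, x). rel_dev n x ^ j)"
    using pair.of_order_power[OF pair_of_order_rel_dev, of "int j" j] by (simp add: case_prod_unfold)
  from seq_of_order_mean[OF this] show ?thesis
    by (simp add: rel_moment_def[abs_def] poly_bounded_moment_intros)
qed

lemma mean_ratio_poly_rel_dev: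
  "seq.approx (int l + 5) (\<lambda>n. mean n (\<lambda>x. (rel_dev n x + 1 / cen n) ^ l))
    (\<lambda>n. mean n (\<lambda>x. ratio_poly (alpha n) (1 / cen n) (rel_dev n x) * rel_dev n x ^ l))"
proof -
  define err where "err = (\<lambda>(n, x). (ratio n x - ratio_poly (alpha n) (1 / cen n) (rel_dev n x))
      * rel_dev n x ^ l)"
  have "pair.of_order (int l + 5) err"
    using pair.of_order_mult[OF pair_approx_ratio_poly[unfolded pair.approx_def]
        pair.of_order_power[OF pair_of_order_rel_dev, of "int l" l]]
    by (simp add: err_def case_prod_unfold)
  then have "seq.of_order (int l + 5) (\<lambda>n. mean n (\<lambda>x. err (n, x)))"
    by (rule seq_of_order_mean) (simp add: err_def poly_bounded_moment_intros)
  then show ?thesis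
    unfolding seq.approx_def
  proof (rule seq.of_order_cong, use eventually_gt_at_top[of 0] in eventually_elim)
    fix n :: nat assume n: "0 < n"
    have "rel_dev n (x - 1) + 1 / cen n = rel_dev n x" for x by (simp add: rel_dev_def diff_divide_distrib)
    then have "mean n (\<lambda>x. (rel_dev n x + 1 / cen n) ^ l) = mean n (\<lambda>x. ratio n x * rel_dev n x ^ l)"
      using mean_ratio[OF _ n, of "\<lambda>x. (rel_dev n x + 1 / cen n) ^ l"] by (simp add: poly_bounded_moment_intros)
    then show "mean n (\<lambda>x. err (n, x)) = mean n (\<lambda>x. (rel_dev n x + 1 / cen n) ^ l) -
        mean n (\<lambda>x. ratio_poly (alpha n) (1 / cen n) (rel_dev n x) * rel_dev n x ^ l)"
      by (simp add: err_def left_diff_distrib mean_diff poly_bounded_moment_intros)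
  qed
qed

definition recurrence_rhs :: "nat \<Rightarrow> real \<Rightarrow> real \<Rightarrow> (nat \<Rightarrow> real) \<Rightarrow> real" where
  "recurrence_rhs l a d V = (\<Sum>i<l. real (l choose i) * d ^ (l - i) * V i)
     - ((1 - a/2) * d + (1 - 5/6*a + a^2/8) * d^2) * V l - (3/2*a - a^2/2) * d * V (l + 1)
     - (a^2/2 + (3/2*a^2 - 3/2*a - a^3/4) * d) * V (l + 2) - (a^3/6 - a^2/2) * V (l + 3)
     - (a^4/24 - a^3/3 + a^2/2) * V (l + 4)"

lemma rel_moment_recurrence:
  "seq.approx (int l + 5) (\<lambda>n. (1 + alpha n) * rel_moment (l + 1) n)
    (\<lambda>n. recurrence_rhs l (alpha n) (1 / cen n) (\<lambda>j. rel_moment j n))"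
  using mean_ratio_poly_rel_dev[of l] unfolding seq.approx_def
proof (rule seq.of_order_cong[OF seq.of_order_minus], intro always_eventually allI)
  fix n
  let ?a = "alpha n" and ?d = "1 / cen n" and ?v = "rel_dev n"
  have "mean n (\<lambda>x. (?v x + ?d) ^ l) = mean n (\<lambda>x. \<Sum>i\<le>l. (real (l choose i) * ?d ^ (l - i)) * ?v x ^ i)"
    by (subst binomial_ring) (simp add: mult_ac)
  also have "\<dots> = (\<Sum>i\<le>l. real (l choose i) * ?d ^ (l - i) * rel_moment i n)"
    unfolding rel_moment_def by (simp only: mean_sum mean_cmult poly_bounded_moment_intros)
  finally have shift: "mean n (\<lambda>x. (?v x + ?d) ^ l) =
      (\<Sum>i<l. real (l choose i) * ?d ^ (l - i) * rel_moment i n) + rel_moment l n"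
    by (simp flip: lessThan_Suc_atMost)
  have "mean n (\<lambda>x. ratio_poly ?a ?d (?v x) * ?v x ^ l) =
    mean n (\<lambda>x. (1 + (1 - ?a/2) * ?d + (1 - 5/6*?a + ?a^2/8) * ?d^2) * ?v x ^ l
      + (1 + ?a + (3/2*?a - ?a^2/2) * ?d) * ?v x ^ (l + 1)
      + (?a^2/2 + (3/2*?a^2 - 3/2*?a - ?a^3/4) * ?d) * ?v x ^ (l + 2)
      + (?a^3/6 - ?a^2/2) * ?v x ^ (l + 3) + (?a^4/24 - ?a^3/3 + ?a^2/2) * ?v x ^ (l + 4))"
    unfolding ratio_poly_def power_add by (rule arg_cong[of _ _ "mean n"], rule ext) algebra
  also have "\<dots> = (1 + (1 - ?a/2) * ?d + (1 - 5/6*?a + ?a^2/8) * ?d^2) * rel_moment l n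
      + (1 + ?a + (3/2*?a - ?a^2/2) * ?d) * rel_moment (l + 1) n
      + (?a^2/2 + (3/2*?a^2 - 3/2*?a - ?a^3/4) * ?d) * rel_moment (l + 2) n
      + (?a^3/6 - ?a^2/2) * rel_moment (l + 3) n + (?a^4/24 - ?a^3/3 + ?a^2/2) * rel_moment (l + 4) n"
    unfolding rel_moment_def by (simp only: mean_linear poly_bounded_moment_intros)
  finally have poly: "mean n (\<lambda>x. ratio_poly ?a ?d (?v x) * ?v x ^ l) = \<dots>" .
  show "- (mean n (\<lambda>x. (?v x + ?d) ^ l) - mean n (\<lambda>x. ratio_poly ?a ?d (?v x) * ?v x ^ l)) =
    (1 + ?a) * rel_moment (l + 1) n - recurrence_rhs l ?a ?d (\<lambda>j. rel_moment j n)"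
    unfolding shift poly recurrence_rhs_def by algebra
qed

lemmas seq_of_order_0_intros = seq.of_order_L seq.of_order_const seq.of_order_add seq.of_order_diff
  seq.of_order_divide seq.of_order_mult_order_0 seq.of_order_power[where i = 0 and k = 0, simplified]

lemma seq_of_order_monomial:
  assumes "seq.of_order 0 h" "k \<le> 2 * int q + int j"
  shows "seq.of_order k (\<lambda>n. h n * (1 / cen n) ^ q * rel_moment j n)"
  by (rule seq.of_order_mult[of "2 * int q" _ "int j"], rule seq.of_order_mult_order_0)
     (use assms in \<open>auto intro!: seq.of_order_power[OF seq_of_order_inverse_cen] seq_of_order_rel_moment\<close>)

lemma rel_moment_recurrence_order_4:
  "seq.approx (int l + 4) (\<lambda>n. (1 + alpha n) * rel_moment (l + 1) n)
    (\<lambda>n. let a = alpha n; d = 1 / cen n; V = \<lambda>j. rel_moment j n in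
      (\<Sum>i<l. real (l choose i) * d ^ (l - i) * V i) - (1 - a/2) * d * V l
      - (3/2*a - a^2/2) * d * V (l + 1) - a^2/2 * V (l + 2) - (a^3/6 - a^2/2) * V (l + 3))"
proof (rule seq.approx_trans[OF seq.approx_mono[OF rel_moment_recurrence]])
  let ?M = "\<lambda>h q j n. h n * (1 / cen n) ^ q * rel_moment j n"
  define r where "r n = - ?M (\<lambda>n. 1 - 5/6 * alpha n + alpha n ^ 2 / 8) 2 l n
    - ?M (\<lambda>n. 3/2 * alpha n ^ 2 - 3/2 * alpha n - alpha n ^ 3 / 4) 1 (l + 2) n
    - ?M (\<lambda>n. alpha n ^ 4 / 24 - alpha n ^ 3 / 3 + alpha n ^ 2 / 2) 0 (l + 4) n" for n
  have "seq.of_order (int l + 4) r"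
    unfolding r_def
    by (intro seq.of_order_minus seq.of_order_diff seq_of_order_monomial seq_of_order_0_intros) auto
  then show "seq.approx (int l + 4) (\<lambda>n. recurrence_rhs l (alpha n) (1 / cen n) (\<lambda>j. rel_moment j n))
    (\<lambda>n. let a = alpha n; d = 1 / cen n; V = \<lambda>j. rel_moment j n in
      (\<Sum>i<l. real (l choose i) * d ^ (l - i) * V i) - (1 - a/2) * d * V l
      - (3/2*a - a^2/2) * d * V (l + 1) - a^2/2 * V (l + 2) - (a^3/6 - a^2/2) * V (l + 3))"
    by (rule seq.approxI) (simp add: recurrence_rhs_def r_def Let_def algebra_simps)
qed simp

lemma sum_binomial_split_last_two:
  fixes d :: real
  shows "(\<Sum>i<l. real (l choose i) * d ^ (l - i) * V i) =
    (\<Sum>i<l - 2. real (l choose i) * d ^ (l - i) * V i) + real (l choose 2) * d ^ 2 * V (l - 2)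
      + real l * d * V (l - 1)"
proof -
  consider "l = 0" | "l = 1" | k where "l = Suc (Suc k)" by (metis One_nat_def not0_implies_Suc)
  then show ?thesis
  proof cases
    case 3
    have "Suc (Suc k) choose k = Suc (Suc k) choose 2" using binomial_symmetric[of k "Suc (Suc k)"] by simp
    then show ?thesis by (simp add: 3 power2_eq_square)
  qed auto
qed

lemma rel_moment_recurrence_order_3:
  "seq.approx (int l + 3) (\<lambda>n. (1 + alpha n) * rel_moment (l + 1) n)
    (\<lambda>n. let a = alpha n; d = 1 / cen n; V = \<lambda>j. rel_moment j n in
      real l * d * V (l - 1) + real (l choose 2) * d ^ 2 * V (l - 2) - (1 - a/2) * d * V l - a^2/2 * V (l + 2))"
proof (rule seq.approx_trans[OF seq.approx_mono[OF rel_moment_recurrence_order_4]])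
  let ?M = "\<lambda>h q j n. h n * (1 / cen n) ^ q * rel_moment j n"
  define r where "r n = (\<Sum>i<l - 2. ?M (\<lambda>_. real (l choose i)) (l - i) i n)
    - ?M (\<lambda>n. 3/2 * alpha n - alpha n ^ 2 / 2) 1 (l + 1) n
    - ?M (\<lambda>n. alpha n ^ 3 / 6 - alpha n ^ 2 / 2) 0 (l + 3) n" for n
  have "seq.of_order (int l + 3) r"
    unfolding r_def
    by (intro seq.of_order_diff seq.of_order_sum seq_of_order_monomial seq_of_order_0_intros) auto
  then show "seq.approx (int l + 3) (\<lambda>n. let a = alpha n; d = 1 / cen n; V = \<lambda>j. rel_moment j n in
      (\<Sum>i<l. real (l choose i) * d ^ (l - i) * V i) - (1 - a/2) * d * V l
      - (3/2*a - a^2/2) * d * V (l + 1) - a^2/2 * V (l + 2) - (a^3/6 - a^2/2) * V (l + 3))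
    (\<lambda>n. let a = alpha n; d = 1 / cen n; V = \<lambda>j. rel_moment j n in
      real l * d * V (l - 1) + real (l choose 2) * d ^ 2 * V (l - 2) - (1 - a/2) * d * V l - a^2/2 * V (l + 2))"
    by (rule seq.approxI) (simp add: sum_binomial_split_last_two r_def Let_def)
qed simp

lemma rel_moment_recurrence_order_2:
  "seq.approx (int l + 2) (\<lambda>n. (1 + alpha n) * rel_moment (l + 1) n)
    (\<lambda>n. real l * (1 / cen n) * rel_moment (l - 1) n)"
proof (rule seq.approx_trans[OF seq.approx_mono[OF rel_moment_recurrence_order_3]])
  let ?M = "\<lambda>h q j n. h n * (1 / cen n) ^ q * rel_moment j n"
  define r where "r n = ?M (\<lambda>_. real (l choose 2)) 2 (l - 2) n - ?M (\<lambda>n. 1 - alpha n / 2) 1 l n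
    - ?M (\<lambda>n. alpha n ^ 2 / 2) 0 (l + 2) n" for n
  have "seq.of_order (int l + 2) r"
    unfolding r_def by (intro seq.of_order_diff seq_of_order_monomial seq_of_order_0_intros) auto
  then show "seq.approx (int l + 2) (\<lambda>n. let a = alpha n; d = 1 / cen n; V = \<lambda>j. rel_moment j n in
      real l * d * V (l - 1) + real (l choose 2) * d ^ 2 * V (l - 2) - (1 - a/2) * d * V l - a^2/2 * V (l + 2))
    (\<lambda>n. real l * (1 / cen n) * rel_moment (l - 1) n)"
    by (rule seq.approxI) (simp add: r_def Let_def)
qed simp

text \<open>The powers of \<open>cen n\<close> are chosen so that all scaled moments turn out to be of order 0. For odd
  moments this is one half power better than the bound in \<open>seq_of_order_rel_moment\<close>.\<close>

definition scaled_moment :: "nat \<Rightarrow> nat \<Rightarrow> real" where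
  "scaled_moment j n = cen n ^ ((j + 1) div 2) * rel_moment j n"

lemma scaled_moment_even_recurrence:
  "seq.approx 1 (\<lambda>n. (1 + alpha n) * scaled_moment (2 * Suc m) n) (\<lambda>n. real (2 * m + 1) * scaled_moment (2 * m) n)"
  by (rule approx_cen_power_mult[OF rel_moment_recurrence_order_2[of "2 * m + 1"], of _ "Suc m"])
     (simp_all add: scaled_moment_def cen_nonzero)

lemma scaled_moment_odd_recurrence:
  "seq.approx 1 (\<lambda>n. (1 + alpha n) * scaled_moment (2 * m + 1) n)
    (\<lambda>n. real (2 * m) * scaled_moment (2 * m - 1) n + real (2 * m choose 2) * scaled_moment (2 * m - 2) n
      - (1 - alpha n / 2) * scaled_moment (2 * m) n - alpha n ^ 2 / 2 * scaled_moment (2 * m + 2) n)"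
proof (rule approx_cen_power_mult[OF rel_moment_recurrence_order_3[of "2 * m"], of _ "Suc m"], unfold Let_def)
  show "cen n ^ Suc m * (real (2 * m) * (1 / cen n) * rel_moment (2 * m - 1) n
      + real (2 * m choose 2) * (1 / cen n)\<^sup>2 * rel_moment (2 * m - 2) n
      - (1 - alpha n / 2) * (1 / cen n) * rel_moment (2 * m) n - alpha n ^ 2 / 2 * rel_moment (2 * m + 2) n) =
    real (2 * m) * scaled_moment (2 * m - 1) n + real (2 * m choose 2) * scaled_moment (2 * m - 2) n
      - (1 - alpha n / 2) * scaled_moment (2 * m) n - alpha n ^ 2 / 2 * scaled_moment (2 * m + 2) n" for n
    using cen_gt_1[of n] by (cases m) (simp_all add: scaled_moment_def power2_eq_square field_simps)
qed (simp_all add: scaled_moment_def)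

definition normal_moment :: "nat \<Rightarrow> real" where
  "normal_moment m = fact (2 * m) / (2 ^ m * fact m)"

lemma normal_moment_Suc: "normal_moment (Suc m) = real (2 * m + 1) * normal_moment m"
proof -
  have "2 * Suc m = Suc (Suc (2 * m))" by simp
  then show ?thesis unfolding normal_moment_def by (simp add: divide_simps)
qed

definition moment_coeff :: "nat \<Rightarrow> real \<Rightarrow> real" where
  "moment_coeff j r = (let m = j div 2 in if even j then normal_moment m * r ^ m
     else normal_moment (Suc m) * r ^ Suc m * ((4 * real m - 3) - (2 * real m + 3) * r) / 6)"

lemma moment_coeff_even: "moment_coeff (2 * m) r = normal_moment m * r ^ m"
  and moment_coeff_odd: "moment_coeff (2 * m + 1) r =
    normal_moment (Suc m) * r ^ Suc m * ((4 * real m - 3) - (2 * real m + 3) * r) / 6"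
  by (simp_all add: moment_coeff_def)

lemma moment_coeff_upto_6:
  "moment_coeff 0 r = 1" "moment_coeff 1 r = - r / 2 - r^2 / 2" "moment_coeff 2 r = r"
  "moment_coeff 3 r = r^2 / 2 - 5/2 * r^3" "moment_coeff 4 r = 3 * r^2"
  "moment_coeff 5 r = 25/2 * r^3 - 35/2 * r^4" "moment_coeff 6 r = 15 * r^3"
  using moment_coeff_even[of 0 r] moment_coeff_even[of 1 r] moment_coeff_even[of 2 r] moment_coeff_even[of 3 r]
    moment_coeff_odd[of 0 r] moment_coeff_odd[of 1 r] moment_coeff_odd[of 2 r]
  by (simp_all add: normal_moment_def fact_numeral field_simps power2_eq_square power3_eq_cube power4_eq_xxxx
      del: One_nat_def)

lemma moment_coeff_even_recurrence:
  assumes "a > 0"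
  shows "real (2 * m + 1) * moment_coeff (2 * m) (rel_var a) = (1 + a) * moment_coeff (2 * Suc m) (rel_var a)"
  using rel_var_eq[OF assms] unfolding moment_coeff_even normal_moment_Suc power_Suc by simp

lemma moment_coeff_odd_recurrence:
  assumes "a > 0"
  shows "real (2 * m) * moment_coeff (2 * m - 1) (rel_var a)
      + real (2 * m choose 2) * moment_coeff (2 * m - 2) (rel_var a)
      - (1 - a / 2) * moment_coeff (2 * m) (rel_var a) - a ^ 2 / 2 * moment_coeff (2 * m + 2) (rel_var a) =
    (1 + a) * moment_coeff (2 * m + 1) (rel_var a)"
proof (cases m)
  case 0
  have "- (1 - a / 2) - a ^ 2 / 2 * moment_coeff 2 (rel_var a) = (1 + a) * moment_coeff 1 (rel_var a)"
    using rel_var_eq[OF assms] unfolding moment_coeff_upto_6 by algebra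
  moreover have "real 0 * x + real (0 choose 2) * y = 0" for x y by (simp add: numeral_2_eq_2)
  ultimately show ?thesis by (simp only: 0 mult_0_right add_0 diff_0 mult_1_right moment_coeff_upto_6(1))
next
  case (Suc k)
  define q where "q = rel_var a ^ k"
  have indices: "2 * Suc k - 1 = 2 * k + 1" "2 * Suc k - 2 = 2 * k" "2 * Suc k + 2 = 2 * Suc (Suc k)" by simp_all
  have "2 * Suc k choose 2 = Suc k * (2 * k + 1)" by (simp add: choose_two)
  then have choose: "real (2 * Suc k choose 2) = real (Suc k) * real (2 * k + 1)" by (simp only: of_nat_mult)
  show ?thesis
    using rel_var_eq[OF assms]
    unfolding Suc indices choose moment_coeff_even moment_coeff_odd normal_moment_Suc power_Suc of_nat_mult
      of_nat_add of_nat_Suc of_nat_numeral of_nat_1 q_def[symmetric] by algebra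
qed

lemma one_term_scaled_moment_even: "one_term (scaled_moment (2 * m)) (\<lambda>a. moment_coeff (2 * m) (rel_var a))"
proof (induction m)
  case 0
  then show ?case by (simp add: scaled_moment_def[abs_def] rel_moment_0 moment_coeff_upto_6 one_term_const)
next
  case (Suc m)
  show ?case
    by (rule one_term_solve[OF scaled_moment_even_recurrence _ moment_coeff_even_recurrence])
       (intro one_term_intros Suc)
qed

lemma one_term_scaled_moment_odd_step:
  assumes "one_term (scaled_moment (2 * m - 1)) (\<lambda>a. moment_coeff (2 * m - 1) (rel_var a))"
  shows "one_term (scaled_moment (2 * m + 1)) (\<lambda>a. moment_coeff (2 * m + 1) (rel_var a))"
proof (rule one_term_solve[OF scaled_moment_odd_recurrence _ moment_coeff_odd_recurrence])
  have "2 * (m - 1) = 2 * m - 2" "2 * (m + 1) = 2 * m + 2" by simp_all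
  note even = one_term_scaled_moment_even[of "m - 1", unfolded this] one_term_scaled_moment_even[of m]
    one_term_scaled_moment_even[of "m + 1", unfolded this]
  show "one_term (\<lambda>n. real (2 * m) * scaled_moment (2 * m - 1) n
      + real (2 * m choose 2) * scaled_moment (2 * m - 2) n
      - (1 - alpha n / 2) * scaled_moment (2 * m) n - alpha n ^ 2 / 2 * scaled_moment (2 * m + 2) n)
    (\<lambda>a. real (2 * m) * moment_coeff (2 * m - 1) (rel_var a)
      + real (2 * m choose 2) * moment_coeff (2 * m - 2) (rel_var a)
      - (1 - a / 2) * moment_coeff (2 * m) (rel_var a) - a ^ 2 / 2 * moment_coeff (2 * m + 2) (rel_var a))"
    by (intro one_term_intros assms even)
qed

lemma one_term_scaled_moment_odd:
  "one_term (scaled_moment (2 * m + 1)) (\<lambda>a. moment_coeff (2 * m + 1) (rel_var a))"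
proof (induction m)
  case 0
  show ?case by (rule one_term_scaled_moment_odd_step) (use one_term_scaled_moment_even[of 0] in simp)
next
  case (Suc m)
  then show ?case by (intro one_term_scaled_moment_odd_step) simp
qed

lemma one_term_scaled_moment: "one_term (scaled_moment j) (\<lambda>a. moment_coeff j (rel_var a))"
  by (cases "even j") (auto elim!: evenE oddE intro: one_term_scaled_moment_even one_term_scaled_moment_odd
      simp del: One_nat_def add_2_eq_Suc')

text \<open>The corrections of relative order \<open>1 / cen n\<close> in the recurrences for the even and for the odd moments.\<close>

definition even_correction :: "real \<Rightarrow> (nat \<Rightarrow> real) \<Rightarrow> nat \<Rightarrow> real" where
  "even_correction a \<mu> l = (1 - a/2) * \<mu> l + (3/2*a - a^2/2) * \<mu> (l + 1) + a^2/2 * \<mu> (l + 2)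
     + (a^3/6 - a^2/2) * \<mu> (l + 3)"

definition odd_correction :: "real \<Rightarrow> (nat \<Rightarrow> real) \<Rightarrow> nat \<Rightarrow> real" where
  "odd_correction a \<mu> l = (1 - 5/6*a + a^2/8) * \<mu> l + (3/2*a - a^2/2) * \<mu> (l + 1)
     + (3/2*a^2 - 3/2*a - a^3/4) * \<mu> (l + 2) + (a^3/6 - a^2/2) * \<mu> (l + 3)
     + (a^4/24 - a^3/3 + a^2/2) * \<mu> (l + 4)"

lemma one_term_even_correction:
  "one_term (\<lambda>n. even_correction (alpha n) (\<lambda>j. scaled_moment j n) l)
      (\<lambda>a. even_correction a (\<lambda>j. moment_coeff j (rel_var a)) l)"
  unfolding even_correction_def by (intro one_term_intros one_term_scaled_moment)

lemma one_term_odd_correction: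
  "one_term (\<lambda>n. odd_correction (alpha n) (\<lambda>j. scaled_moment j n) l)
      (\<lambda>a. odd_correction a (\<lambda>j. moment_coeff j (rel_var a)) l)"
  unfolding odd_correction_def by (intro one_term_intros one_term_scaled_moment)

lemma rel_moment_eq_scaled_moment: "rel_moment j n = (1 / cen n) ^ ((j + 1) div 2) * scaled_moment j n"
  by (simp add: scaled_moment_def power_divide cen_nonzero)

lemma rel_moment_upto_6:
  "rel_moment 1 n = 1 / cen n * scaled_moment 1 n" "rel_moment 2 n = 1 / cen n * scaled_moment 2 n"
  "rel_moment 3 n = (1 / cen n) ^ 2 * scaled_moment 3 n" "rel_moment 4 n = (1 / cen n) ^ 2 * scaled_moment 4 n"
  "rel_moment 5 n = (1 / cen n) ^ 3 * scaled_moment 5 n" "rel_moment 6 n = (1 / cen n) ^ 3 * scaled_moment 6 n"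
  by (simp_all add: rel_moment_eq_scaled_moment del: power_one_over)

lemma scaled_moment_0: "scaled_moment 0 n = 1"
  by (simp add: scaled_moment_def rel_moment_0)

lemma cen_mult_inverse: "cen n * (1 / cen n) = 1"
  by (simp add: cen_nonzero)

lemma scaled_moment_1_recurrence:
  "seq.approx 3 (\<lambda>n. (1 + alpha n) * scaled_moment 1 n)
    (\<lambda>n. - (1 - alpha n / 2) - alpha n ^ 2 / 2 * scaled_moment 2 n
      - odd_correction (alpha n) (\<lambda>j. scaled_moment j n) 0 / cen n)"
proof (rule approx_cen_power_mult[OF rel_moment_recurrence[of 0], of _ 1])
  fix n
  note c = cen_mult_inverse[of n]
  show "cen n ^ 1 * ((1 + alpha n) * rel_moment (0 + 1) n) = (1 + alpha n) * scaled_moment 1 n"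
    using c unfolding add_0 rel_moment_upto_6 by algebra
  have "cen n ^ 1 * recurrence_rhs 0 (alpha n) (1 / cen n) (\<lambda>j. rel_moment j n) =
      - (1 - alpha n / 2) - alpha n ^ 2 / 2 * scaled_moment 2 n
      - odd_correction (alpha n) (\<lambda>j. scaled_moment j n) 0 * (1 / cen n)"
    using c scaled_moment_0[of n]
    unfolding recurrence_rhs_def odd_correction_def lessThan_0 sum.empty add_0 rel_moment_upto_6 rel_moment_0
    by algebra
  then show "cen n ^ 1 * recurrence_rhs 0 (alpha n) (1 / cen n) (\<lambda>j. rel_moment j n) =
      - (1 - alpha n / 2) - alpha n ^ 2 / 2 * scaled_moment 2 n
      - odd_correction (alpha n) (\<lambda>j. scaled_moment j n) 0 / cen n" by simp
qed simp

lemma scaled_moment_2_recurrence: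
  "seq.approx 3 (\<lambda>n. (1 + alpha n) * scaled_moment 2 n)
    (\<lambda>n. 1 - even_correction (alpha n) (\<lambda>j. scaled_moment j n) 1 / cen n)"
proof (rule approx_cen_power_mult[OF rel_moment_recurrence_order_4[of 1], of _ 1], unfold Let_def)
  fix n
  let ?a = "alpha n" and ?V = "\<lambda>j. rel_moment j n" and ?d = "1 / cen n"
  note c = cen_mult_inverse[of n]
  have indices: "1 + 1 = (2::nat)" "1 + 2 = (3::nat)" "1 + 3 = (4::nat)" by simp_all
  show "cen n ^ 1 * ((1 + ?a) * ?V (1 + 1)) = (1 + ?a) * scaled_moment 2 n"
    using c unfolding indices rel_moment_upto_6 by algebra
  have "cen n ^ 1 * (?d * ?V 0 - (1 - ?a/2) * ?d * ?V 1 - (3/2*?a - ?a^2/2) * ?d * ?V (1 + 1)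
      - ?a^2/2 * ?V (1 + 2) - (?a^3/6 - ?a^2/2) * ?V (1 + 3)) =
    1 - even_correction ?a (\<lambda>j. scaled_moment j n) 1 * ?d"
    using c unfolding even_correction_def indices rel_moment_upto_6 rel_moment_0 by algebra
  then show "cen n ^ 1 * ((\<Sum>i<1. real (1 choose i) * ?d ^ (1 - i) * ?V i) - (1 - ?a/2) * ?d * ?V 1
      - (3/2*?a - ?a^2/2) * ?d * ?V (1 + 1) - ?a^2/2 * ?V (1 + 2) - (?a^3/6 - ?a^2/2) * ?V (1 + 3)) =
    1 - even_correction ?a (\<lambda>j. scaled_moment j n) 1 / cen n" by simp
qed simp

lemma scaled_moment_3_recurrence:
  "seq.approx 3 (\<lambda>n. (1 + alpha n) * scaled_moment 3 n)
    (\<lambda>n. 2 * scaled_moment 1 n + 1 - (1 - alpha n / 2) * scaled_moment 2 n - alpha n ^ 2 / 2 * scaled_moment 4 n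
      - odd_correction (alpha n) (\<lambda>j. scaled_moment j n) 2 / cen n)"
proof (rule approx_cen_power_mult[OF rel_moment_recurrence[of 2], of _ 2])
  fix n
  note c = cen_mult_inverse[of n]
  have indices: "2 + 1 = (3::nat)" "2 + 2 = (4::nat)" "2 + 3 = (5::nat)" "2 + 4 = (6::nat)" by simp_all
  show "cen n ^ 2 * ((1 + alpha n) * rel_moment (2 + 1) n) = (1 + alpha n) * scaled_moment 3 n"
    using c unfolding indices rel_moment_upto_6 by algebra
  have sum: "(\<Sum>i<2. real (2 choose i) * d ^ (2 - i) * V i) = d ^ 2 * V 0 + 2 * d * V 1" for d :: real and V
    by (simp add: numeral_2_eq_2)
  have "cen n ^ 2 * recurrence_rhs 2 (alpha n) (1 / cen n) (\<lambda>j. rel_moment j n) =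
      2 * scaled_moment 1 n + 1 - (1 - alpha n / 2) * scaled_moment 2 n - alpha n ^ 2 / 2 * scaled_moment 4 n
      - odd_correction (alpha n) (\<lambda>j. scaled_moment j n) 2 * (1 / cen n)"
    using c unfolding recurrence_rhs_def odd_correction_def sum indices rel_moment_upto_6 rel_moment_0 by algebra
  then show "cen n ^ 2 * recurrence_rhs 2 (alpha n) (1 / cen n) (\<lambda>j. rel_moment j n) =
      2 * scaled_moment 1 n + 1 - (1 - alpha n / 2) * scaled_moment 2 n - alpha n ^ 2 / 2 * scaled_moment 4 n
      - odd_correction (alpha n) (\<lambda>j. scaled_moment j n) 2 / cen n" by simp
qed simp

lemma scaled_moment_4_recurrence:
  "seq.approx 3 (\<lambda>n. (1 + alpha n) * scaled_moment 4 n)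
    (\<lambda>n. 3 * scaled_moment 2 n
      + (3 * scaled_moment 1 n + 1 - even_correction (alpha n) (\<lambda>j. scaled_moment j n) 3) / cen n)"
proof (rule approx_cen_power_mult[OF rel_moment_recurrence_order_4[of 3], of _ 2], unfold Let_def)
  fix n
  let ?a = "alpha n" and ?V = "\<lambda>j. rel_moment j n" and ?d = "1 / cen n"
  note c = cen_mult_inverse[of n]
  have indices: "3 + 1 = (4::nat)" "3 + 2 = (5::nat)" "3 + 3 = (6::nat)" by simp_all
  have sum: "(\<Sum>i<3. real (3 choose i) * d ^ (3 - i) * V i) = d ^ 3 * V 0 + 3 * d ^ 2 * V 1 + 3 * d * V 2"
    for d :: real and V by (simp add: numeral_3_eq_3 numeral_2_eq_2)
  show "cen n ^ 2 * ((1 + ?a) * ?V (3 + 1)) = (1 + ?a) * scaled_moment 4 n"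
    using c unfolding indices rel_moment_upto_6 by algebra
  have "cen n ^ 2 * ((\<Sum>i<3. real (3 choose i) * ?d ^ (3 - i) * ?V i) - (1 - ?a/2) * ?d * ?V 3
      - (3/2*?a - ?a^2/2) * ?d * ?V (3 + 1) - ?a^2/2 * ?V (3 + 2) - (?a^3/6 - ?a^2/2) * ?V (3 + 3)) =
    3 * scaled_moment 2 n + (3 * scaled_moment 1 n + 1 - even_correction ?a (\<lambda>j. scaled_moment j n) 3) * ?d"
    using c unfolding even_correction_def sum indices rel_moment_upto_6 rel_moment_0 by algebra
  then show "cen n ^ 2 * ((\<Sum>i<3. real (3 choose i) * ?d ^ (3 - i) * ?V i) - (1 - ?a/2) * ?d * ?V 3
      - (3/2*?a - ?a^2/2) * ?d * ?V (3 + 1) - ?a^2/2 * ?V (3 + 2) - (?a^3/6 - ?a^2/2) * ?V (3 + 3)) =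
    3 * scaled_moment 2 n + (3 * scaled_moment 1 n + 1 - even_correction ?a (\<lambda>j. scaled_moment j n) 3) / cen n"
    by simp
qed simp

lemma two_term_scaled_moment_2:
  "two_term (scaled_moment 2) (\<lambda>a. moment_coeff 2 (rel_var a)) (\<lambda>a. - 1/4 * rel_var a ^ 2 + 5/4 * rel_var a ^ 4)"
proof (rule two_term_solve[OF scaled_moment_2_recurrence
  two_term_diff_divide_cen[OF two_term_const one_term_even_correction]])
  fix a :: real assume a: "a > 0"
  show "1 = (1 + a) * moment_coeff 2 (rel_var a)"
    unfolding moment_coeff_upto_6 by (simp add: mult_rel_var[OF a] expand_polynomial)
  have indices: "1 + 1 = (2::nat)" "1 + 2 = (3::nat)" "1 + 3 = (4::nat)" by simp_all
  show "0 - even_correction a (\<lambda>j. moment_coeff j (rel_var a)) 1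
      = (1 + a) * (- 1/4 * rel_var a ^ 2 + 5/4 * rel_var a ^ 4)"
    unfolding even_correction_def indices moment_coeff_upto_6 by (simp add: mult_rel_var[OF a] expand_polynomial)
qed

lemma two_term_scaled_moment_1:
  "two_term (scaled_moment 1) (\<lambda>a. moment_coeff 1 (rel_var a))
    (\<lambda>a. 1/12 * rel_var a - 1/24 * rel_var a ^ 3 - 5/12 * rel_var a ^ 4 - 5/8 * rel_var a ^ 5)"
proof (rule two_term_solve[OF scaled_moment_1_recurrence two_term_diff_divide_cen[OF two_term_diff[OF
      two_term_coeff two_term_coeff_mult[OF _ two_term_scaled_moment_2]] one_term_odd_correction]])
  show "poly_growth (\<lambda>a. - (1 - a / 2))" "poly_growth (\<lambda>a. a ^ 2 / 2)" by (intro poly_growth_intros)+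
  fix a :: real assume a: "a > 0"
  show "- (1 - a / 2) - a^2 / 2 * moment_coeff 2 (rel_var a) = (1 + a) * moment_coeff 1 (rel_var a)"
    unfolding moment_coeff_upto_6 by (simp add: mult_rel_var[OF a] expand_polynomial)
  show "0 - a^2 / 2 * (- 1/4 * rel_var a ^ 2 + 5/4 * rel_var a ^ 4)
      - odd_correction a (\<lambda>j. moment_coeff j (rel_var a)) 0 =
    (1 + a) * (1/12 * rel_var a - 1/24 * rel_var a ^ 3 - 5/12 * rel_var a ^ 4 - 5/8 * rel_var a ^ 5)"
    unfolding odd_correction_def add_0 moment_coeff_upto_6 by (simp add: mult_rel_var[OF a] expand_polynomial)
qed

lemma two_term_scaled_moment_4:
  "two_term (scaled_moment 4) (\<lambda>a. moment_coeff 4 (rel_var a))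
    (\<lambda>a. 1/2 * rel_var a ^ 3 - 10 * rel_var a ^ 4 + 25/2 * rel_var a ^ 5)"
proof -
  have "one_term (\<lambda>n. 3 * scaled_moment 1 n + 1 - even_correction (alpha n) (\<lambda>j. scaled_moment j n) 3)
      (\<lambda>a. 3 * moment_coeff 1 (rel_var a) + 1 - even_correction a (\<lambda>j. moment_coeff j (rel_var a)) 3)"
    by (intro one_term_intros one_term_scaled_moment one_term_even_correction)
  note two_term_add[OF two_term_coeff_mult[OF growth.of_order_const two_term_scaled_moment_2]
    one_term_divide_cen[OF this]]
  from scaled_moment_4_recurrence this show ?thesis
  proof (rule two_term_solve)
    fix a :: real assume a: "a > 0"
    show "3 * moment_coeff 2 (rel_var a) + 0 = (1 + a) * moment_coeff 4 (rel_var a)"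
      unfolding moment_coeff_upto_6 by (simp add: mult_rel_var[OF a] expand_polynomial)
    have indices: "3 + 1 = (4::nat)" "3 + 2 = (5::nat)" "3 + 3 = (6::nat)" by simp_all
    show "3 * (- 1/4 * rel_var a ^ 2 + 5/4 * rel_var a ^ 4)
        + (3 * moment_coeff 1 (rel_var a) + 1 - even_correction a (\<lambda>j. moment_coeff j (rel_var a)) 3) =
      (1 + a) * (1/2 * rel_var a ^ 3 - 10 * rel_var a ^ 4 + 25/2 * rel_var a ^ 5)"
      unfolding even_correction_def indices moment_coeff_upto_6 by (simp add: mult_rel_var[OF a] expand_polynomial)
  qed
qed

lemma two_term_scaled_moment_3:
  "two_term (scaled_moment 3) (\<lambda>a. moment_coeff 3 (rel_var a))
    (\<lambda>a. 1/4 * rel_var a ^ 2 - 3/8 * rel_var a ^ 3 + 1/2 * rel_var a ^ 4 + 25/8 * rel_var a ^ 5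
      - 15/2 * rel_var a ^ 6)"
proof -
  have growth: "poly_growth (\<lambda>a. 1 - a / 2)" "poly_growth (\<lambda>a. a ^ 2 / 2)" by (intro poly_growth_intros)+
  note mults = two_term_coeff_mult[OF growth.of_order_const two_term_scaled_moment_1]
    two_term_coeff_mult[OF growth(1) two_term_scaled_moment_2]
      two_term_coeff_mult[OF growth(2) two_term_scaled_moment_4]
  note two_term_diff[OF two_term_diff[OF two_term_add[OF mults(1) two_term_const] mults(2)] mults(3)]
  from scaled_moment_3_recurrence two_term_diff_divide_cen[OF this one_term_odd_correction] show ?thesis
  proof (rule two_term_solve)
    fix a :: real assume a: "a > 0"
    show "2 * moment_coeff 1 (rel_var a) + 1 - (1 - a / 2) * moment_coeff 2 (rel_var a)
        - a^2 / 2 * moment_coeff 4 (rel_var a) = (1 + a) * moment_coeff 3 (rel_var a)"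
      unfolding moment_coeff_upto_6 by (simp add: mult_rel_var[OF a] expand_polynomial)
    have indices: "2 + 1 = (3::nat)" "2 + 2 = (4::nat)" "2 + 3 = (5::nat)" "2 + 4 = (6::nat)" by simp_all
    show "2 * (1/12 * rel_var a - 1/24 * rel_var a ^ 3 - 5/12 * rel_var a ^ 4 - 5/8 * rel_var a ^ 5) + 0
        - (1 - a / 2) * (- 1/4 * rel_var a ^ 2 + 5/4 * rel_var a ^ 4)
        - a^2 / 2 * (1/2 * rel_var a ^ 3 - 10 * rel_var a ^ 4 + 25/2 * rel_var a ^ 5)
        - odd_correction a (\<lambda>j. moment_coeff j (rel_var a)) 2 =
      (1 + a) * (1/4 * rel_var a ^ 2 - 3/8 * rel_var a ^ 3 + 1/2 * rel_var a ^ 4 + 25/8 * rel_var a ^ 5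
        - 15/2 * rel_var a ^ 6)"
      unfolding odd_correction_def indices moment_coeff_upto_6 by (simp add: mult_rel_var[OF a] expand_polynomial)
  qed
qed

section \<open>Central moments of the dimension exponent\<close>

lemma real_eq_cen: "real n = cen n * (alpha n - 1 / cen n)"
  using real_eq_alpha_cen[of n] cen_mult_inverse[of n] by algebra

definition lin_coeff :: "nat \<Rightarrow> real" where
  "lin_coeff n = alpha n - 4 + 3 * (1 / cen n)"

definition mean_shift :: "nat \<Rightarrow> real" where
  "mean_shift n = lin_coeff n * scaled_moment 1 n - 2 * scaled_moment 2 n"

lemma dim_cumulant_1_rel_dev:
  "dim_cumulant_1 n x = cen n ^ 2 *
    (alpha n - 2 + 3 * (1 / cen n) + lin_coeff n * rel_dev n x ^ 1 - 2 * rel_dev n x ^ 2)"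
  using eq_cen_rel_dev[of x n] real_eq_cen[of n] cen_mult_inverse[of n]
  unfolding dim_cumulant_1_def lin_coeff_def by algebra

lemma dim_cumulant_2_rel_dev:
  "dim_cumulant_2 n x = cen n ^ 3 * ((1 + rel_dev n x) ^ 3 - 7 * (1 / cen n) * (1 + rel_dev n x) ^ 2
    - (4 * alpha n - 1 / cen n) * (1 / cen n) * (1 + rel_dev n x) + (1 / cen n) ^ 2 * (alpha n - 1 / cen n))"
  using eq_cen_rel_dev[of x n] real_eq_cen[of n] cen_mult_inverse[of n] unfolding dim_cumulant_2_def by algebra

lemma dim_cumulant_3_rel_dev:
  "dim_cumulant_3 n x = cen n ^ 4 * (- 5/3 * (1 + rel_dev n x) ^ 4 + 20 * (1 / cen n) * (1 + rel_dev n x) ^ 3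
    + (18 * alpha n + 62/3 * (1 / cen n)) * (1 / cen n) * (1 + rel_dev n x) ^ 2
    - (6 * alpha n - 17/3 * (1 / cen n)) * (1 / cen n) ^ 2 * (1 + rel_dev n x)
    + (1 / cen n) ^ 3 * (alpha n - 1 / cen n))"
  using eq_cen_rel_dev[of x n] real_eq_cen[of n] cen_mult_inverse[of n] unfolding dim_cumulant_3_def by algebra

lemma mean_dim_cumulant_1:
  "mean n (dim_cumulant_1 n) = cen n ^ 2 * (alpha n - 2 + 1 / cen n * (3 + mean_shift n))"
proof -
  have "mean n (dim_cumulant_1 n) = cen n ^ 2 * (alpha n - 2 + 3 * (1 / cen n)
      + lin_coeff n * rel_moment 1 n - 2 * rel_moment 2 n)"
    unfolding dim_cumulant_1_rel_dev[abs_def] rel_moment_def by (simp only: mean_linear poly_bounded_moment_intros)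
  then show ?thesis unfolding rel_moment_upto_6 mean_shift_def by algebra
qed

lemma dim_dev_rel_dev:
  "dim_dev n x = cen n ^ 2 * (lin_coeff n * rel_dev n x ^ 1 - 2 * rel_dev n x ^ 2 - 1 / cen n * mean_shift n)"
  unfolding dim_dev_def mean_dim_cumulant_1 dim_cumulant_1_rel_dev by algebra

lemma mean_dim_dev_square:
  "mean n (\<lambda>x. dim_dev n x ^ 2) = cen n ^ 3 * (lin_coeff n ^ 2 * scaled_moment 2 n
    + 1 / cen n * (4 * scaled_moment 4 n - 4 * lin_coeff n * scaled_moment 3 n - mean_shift n ^ 2))"
proof -
  define b e where "b = lin_coeff n" and "e = 1 / cen n * mean_shift n"
  have "dim_dev n x ^ 2 = cen n ^ 4 * (b^2 * rel_dev n x ^ 2 - 4 * b * rel_dev n x ^ 3 + 4 * rel_dev n x ^ 4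
      - 2 * e * b * rel_dev n x ^ 1 + 4 * e * rel_dev n x ^ 2 + e ^ 2)" for x
    unfolding dim_dev_rel_dev b_def e_def by algebra
  then have "mean n (\<lambda>x. dim_dev n x ^ 2) = cen n ^ 4 * (b^2 * rel_moment 2 n - 4 * b * rel_moment 3 n
      + 4 * rel_moment 4 n - 2 * e * b * rel_moment 1 n + 4 * e * rel_moment 2 n + e ^ 2)"
    unfolding rel_moment_def by (simp only: mean_linear poly_bounded_moment_intros)
  then show ?thesis
    using cen_mult_inverse[of n] unfolding rel_moment_upto_6 mean_shift_def e_def b_def by algebra
qed

lemma mean_dim_cumulant_2:
  "mean n (dim_cumulant_2 n) = cen n ^ 3 * (1 + 1 / cen n * (3 * scaled_moment 1 n + 3 * scaled_moment 2 n
    + 1 / cen n * scaled_moment 3 n - 7 * (1 + 1 / cen n * (2 * scaled_moment 1 n + scaled_moment 2 n))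
    - (4 * alpha n - 1 / cen n) * (1 + 1 / cen n * scaled_moment 1 n)
    + 1 / cen n * (alpha n - 1 / cen n)))"
proof -
  define a d where "a = alpha n" and "d = 1 / cen n"
  have "mean n (dim_cumulant_2 n) = mean n (\<lambda>x. cen n ^ 3 * (1 - 7 * d - (4 * a - d) * d + d ^ 2 * (a - d)
      + (3 - 14 * d - (4 * a - d) * d) * rel_dev n x ^ 1 + (3 - 7 * d) * rel_dev n x ^ 2 + 1 * rel_dev n x ^ 3))"
    unfolding dim_cumulant_2_rel_dev[abs_def] a_def d_def by (rule arg_cong[of _ _ "mean n"], rule ext) algebra
  also have "\<dots> = cen n ^ 3 * (1 - 7 * d - (4 * a - d) * d + d ^ 2 * (a - d)
      + (3 - 14 * d - (4 * a - d) * d) * rel_moment 1 n + (3 - 7 * d) * rel_moment 2 n + 1 * rel_moment 3 n)"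
    unfolding rel_moment_def by (simp only: mean_linear poly_bounded_moment_intros)
  finally show ?thesis unfolding rel_moment_upto_6 a_def d_def by algebra
qed

lemma mean_dim_dev_cube:
  "mean n (\<lambda>x. dim_dev n x ^ 3) = cen n ^ 4 * (lin_coeff n ^ 3 * scaled_moment 3 n
      - 6 * lin_coeff n ^ 2 * scaled_moment 4 n
    - 3 * mean_shift n * lin_coeff n ^ 2 * scaled_moment 2 n
    + 1 / cen n * (12 * lin_coeff n * scaled_moment 5 n - 8 * scaled_moment 6 n
      + 12 * mean_shift n * (lin_coeff n * scaled_moment 3 n - scaled_moment 4 n) + 2 * mean_shift n ^ 3))"
proof -
  define b e where "b = lin_coeff n" and "e = 1 / cen n * mean_shift n"
  have "mean n (\<lambda>x. dim_dev n x ^ 3) = mean n (\<lambda>x. cen n ^ 6 * (b^3 * rel_dev n x ^ 3 - 6 * b^2 * rel_dev n x ^ 4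
      + 12 * b * rel_dev n x ^ 5 - 8 * rel_dev n x ^ 6 - 3 * e * b^2 * rel_dev n x ^ 2
      + 12 * e * b * rel_dev n x ^ 3
      - 12 * e * rel_dev n x ^ 4 + 3 * e^2 * b * rel_dev n x ^ 1 - 6 * e^2 * rel_dev n x ^ 2 - e ^ 3))"
    unfolding dim_dev_rel_dev b_def e_def by (rule arg_cong[of _ _ "mean n"], rule ext) algebra
  also have "\<dots> = cen n ^ 6 * (b^3 * rel_moment 3 n - 6 * b^2 * rel_moment 4 n
      + 12 * b * rel_moment 5 n - 8 * rel_moment 6 n - 3 * e * b^2 * rel_moment 2 n + 12 * e * b * rel_moment 3 n
      - 12 * e * rel_moment 4 n + 3 * e^2 * b * rel_moment 1 n - 6 * e^2 * rel_moment 2 n - e ^ 3)"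
    unfolding rel_moment_def by (simp only: mean_linear poly_bounded_moment_intros)
  finally show ?thesis
    using cen_mult_inverse[of n] unfolding rel_moment_upto_6 mean_shift_def e_def b_def by algebra
qed

lemma mean_dim_dev_mult_dim_cumulant_2:
  "mean n (\<lambda>x. dim_dev n x * dim_cumulant_2 n x) = cen n ^ 4 *
    (lin_coeff n * (3 - 1 / cen n * (14 + 4 * alpha n - 1 / cen n)) * scaled_moment 2 n
    + 1 / cen n * ((lin_coeff n * (3 - 7 * (1 / cen n))
        - 2 * (3 - 1 / cen n * (14 + 4 * alpha n - 1 / cen n))) * scaled_moment 3 n
      + (lin_coeff n - 2 * (3 - 7 * (1 / cen n))) * scaled_moment 4 n - 1 / cen n * (2 * scaled_moment 5 n)
      - mean_shift n * ((3 - 1 / cen n * (14 + 4 * alpha n - 1 / cen n)) * scaled_moment 1 n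
        + (3 - 7 * (1 / cen n)) * scaled_moment 2 n + 1 / cen n * scaled_moment 3 n)))"
proof -
  define a d b e where "a = alpha n" and "d = 1 / cen n" and "b = lin_coeff n" and "e = 1 / cen n * mean_shift n"
  define k0 k1 k2 where "k0 = 1 - 7 * d - (4 * a - d) * d + d ^ 2 * (a - d)"
    and "k1 = 3 - d * (14 + 4 * a - d)" and "k2 = 3 - 7 * d"
  have "dim_dev n x * dim_cumulant_2 n x = cen n ^ 5 * (b * k1 * rel_dev n x ^ 2 + b * k2 * rel_dev n x ^ 3
      + b * rel_dev n x ^ 4 - 2 * k1 * rel_dev n x ^ 3 - 2 * k2 * rel_dev n x ^ 4 - 2 * rel_dev n x ^ 5
      + (b * k0 - e * k1) * rel_dev n x ^ 1 - (2 * k0 + e * k2) * rel_dev n x ^ 2 - e * rel_dev n x ^ 3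
      - e * k0)" for x
    unfolding dim_dev_rel_dev dim_cumulant_2_rel_dev k0_def k1_def k2_def a_def b_def d_def e_def by algebra
  then have "mean n (\<lambda>x. dim_dev n x * dim_cumulant_2 n x) =
      cen n ^ 5 * (b * k1 * rel_moment 2 n + b * k2 * rel_moment 3 n
      + b * rel_moment 4 n - 2 * k1 * rel_moment 3 n - 2 * k2 * rel_moment 4 n - 2 * rel_moment 5 n
      + (b * k0 - e * k1) * rel_moment 1 n - (2 * k0 + e * k2) * rel_moment 2 n - e * rel_moment 3 n - e * k0)"
    unfolding rel_moment_def by (simp only: mean_linear poly_bounded_moment_intros)
  also have "\<dots> = cen n ^ 4 * (b * k1 * scaled_moment 2 n + d * ((b * k2 - 2 * k1) * scaled_moment 3 n
      + (b - 2 * k2) * scaled_moment 4 n - d * (2 * scaled_moment 5 n)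
      - mean_shift n * (k1 * scaled_moment 1 n + k2 * scaled_moment 2 n + d * scaled_moment 3 n)))"
    using cen_mult_inverse[of n] unfolding rel_moment_upto_6 mean_shift_def e_def b_def d_def by algebra
  finally show ?thesis unfolding k1_def k2_def a_def b_def d_def .
qed

lemma mean_dim_cumulant_3:
  "mean n (dim_cumulant_3 n) = cen n ^ 4 * (- 5/3 + 1 / cen n *
    (- 5/3 * (4 * scaled_moment 1 n + 6 * scaled_moment 2 n
      + 1 / cen n * (4 * scaled_moment 3 n + scaled_moment 4 n))
     + 20 * (1 + 1 / cen n * (3 * scaled_moment 1 n + 3 * scaled_moment 2 n + 1 / cen n * scaled_moment 3 n))
     + (18 * alpha n + 62/3 * (1 / cen n)) * (1 + 1 / cen n * (2 * scaled_moment 1 n + scaled_moment 2 n))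
     - 1 / cen n * ((6 * alpha n - 17/3 * (1 / cen n)) * (1 + 1 / cen n * scaled_moment 1 n)
       - 1 / cen n * (alpha n - 1 / cen n))))"
proof -
  define d p q s where "d = 1 / cen n" and "p = (18 * alpha n + 62/3 * d) * d"
    and "q = (6 * alpha n - 17/3 * d) * d ^ 2" and "s = d ^ 3 * (alpha n - d)"
  have "mean n (dim_cumulant_3 n) = mean n (\<lambda>x. cen n ^ 4 * ((- 5/3 + 20 * d + p - q + s)
      + (- 20/3 + 60 * d + 2 * p - q) * rel_dev n x ^ 1 + (- 10 + 60 * d + p) * rel_dev n x ^ 2
      + (- 20/3 + 20 * d) * rel_dev n x ^ 3 - 5/3 * rel_dev n x ^ 4))"
    unfolding dim_cumulant_3_rel_dev[abs_def] d_def p_def q_def s_def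
    by (rule arg_cong[of _ _ "mean n"], rule ext) algebra
  also have "\<dots> = cen n ^ 4 * ((- 5/3 + 20 * d + p - q + s)
      + (- 20/3 + 60 * d + 2 * p - q) * rel_moment 1 n + (- 10 + 60 * d + p) * rel_moment 2 n
      + (- 20/3 + 20 * d) * rel_moment 3 n - 5/3 * rel_moment 4 n)"
    unfolding rel_moment_def by (simp only: mean_linear poly_bounded_moment_intros)
  finally show ?thesis unfolding rel_moment_upto_6 d_def p_def q_def s_def by algebra
qed

lemmas expansion_intros = two_term_inverse_cen_mult two_term_inverse_cen two_term_alpha two_term_const two_term_add
  two_term_diff two_term_mult two_term_power two_term_scaled_moment_1 two_term_scaled_moment_2
  two_term_scaled_moment_3 two_term_scaled_moment_4
  two_term_inverse_cen[THEN two_term_imp_one_term] one_term_intros one_term_scaled_moment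

lemma two_term_lin_coeff: "two_term lin_coeff (\<lambda>a. a - 4) (\<lambda>_. 3)"
  unfolding lin_coeff_def[abs_def] by (rule two_term_cong, (rule expansion_intros)+) simp_all

lemma two_term_mean_shift:
  "two_term mean_shift (\<lambda>a. 5/2 * rel_var a ^ 2 - 1/2)
    (\<lambda>a. 1/12 - 23/12 * rel_var a - 25/24 * rel_var a ^ 2 - 5/24 * rel_var a ^ 3
      - 25/24 * rel_var a ^ 4 + 25/8 * rel_var a ^ 5)"
  unfolding mean_shift_def[abs_def]
  by (rule two_term_cong, (rule expansion_intros two_term_lin_coeff)+)
    (unfold moment_coeff_upto_6, simp_all add: mult_rel_var expand_polynomial)

lemmas dim_expansion_intros = expansion_intros two_term_lin_coeff two_term_mean_shift
  two_term_lin_coeff[THEN two_term_imp_one_term] two_term_mean_shift[THEN two_term_imp_one_term]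

lemma cen_power_cancel: "cen n ^ k * x / cen n ^ k = x"
  by (simp add: cen_nonzero)

lemma two_term_mean_dim_cumulant_1:
  "two_term (\<lambda>n. mean n (dim_cumulant_1 n) / cen n ^ 2) (\<lambda>a. a - 2) (\<lambda>a. 5/2 + 5/2 * rel_var a ^ 2)"
  unfolding mean_dim_cumulant_1 cen_power_cancel
  by (rule two_term_cong, (rule dim_expansion_intros)+) simp_all

lemma two_term_mean_dim_dev_square:
  "two_term (\<lambda>n. mean n (\<lambda>x. dim_dev n x ^ 2) / cen n ^ 3) (\<lambda>a. a - 9 + 25 * rel_var a)
    (\<lambda>a. 11/2 - 59/2 * rel_var a + 59/2 * rel_var a ^ 2 - 125/2 * rel_var a ^ 3 + 25 * rel_var a ^ 4)"
  unfolding mean_dim_dev_square cen_power_cancel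
  by (rule two_term_cong, (rule dim_expansion_intros)+)
    (unfold moment_coeff_upto_6, simp_all add: mult_rel_var expand_polynomial)

lemma two_term_mean_dim_cumulant_2:
  "two_term (\<lambda>n. mean n (dim_cumulant_2 n) / cen n ^ 3) (\<lambda>_. 1)
    (\<lambda>a. 3/2 * rel_var a - 3/2 * rel_var a ^ 2 - 7 - 4 * a)"
  unfolding mean_dim_cumulant_2 cen_power_cancel
  by (rule two_term_cong, (rule dim_expansion_intros)+)
    (unfold moment_coeff_upto_6, simp_all add: mult_rel_var expand_polynomial)

lemma two_term_mean_dim_dev_cube:
  "two_term (\<lambda>n. mean n (\<lambda>x. dim_dev n x ^ 3) / cen n ^ 4)
    (\<lambda>a. 2 * a - 41 + 285 * rel_var a - 625 * rel_var a ^ 2 + 125 * rel_var a ^ 3)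
    (\<lambda>a. 17 - 517/2 * rel_var a + 1168 * rel_var a ^ 2 - 2160 * rel_var a ^ 3 + 3385 * rel_var a ^ 4
      - 4375/2 * rel_var a ^ 5 + 500 * rel_var a ^ 6)"
  unfolding mean_dim_dev_cube cen_power_cancel
  by (rule two_term_cong, (rule dim_expansion_intros)+)
    (unfold moment_coeff_upto_6, simp_all add: mult_rel_var expand_polynomial)

lemma two_term_mean_dim_dev_mult_dim_cumulant_2:
  "two_term (\<lambda>n. mean n (\<lambda>x. dim_dev n x * dim_cumulant_2 n x) / cen n ^ 4) (\<lambda>a. 3 - 15 * rel_var a)
    (\<lambda>a. 6 - 4 * a + 127/2 * rel_var a - 48 * rel_var a ^ 2 + 105/2 * rel_var a ^ 3 - 15 * rel_var a ^ 4)"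
  unfolding mean_dim_dev_mult_dim_cumulant_2 cen_power_cancel
  by (rule two_term_cong, (rule dim_expansion_intros)+)
    (unfold moment_coeff_upto_6, simp_all add: mult_rel_var expand_polynomial)

lemma two_term_mean_dim_cumulant_3:
  "two_term (\<lambda>n. mean n (dim_cumulant_3 n) / cen n ^ 4) (\<lambda>_. - 5/3)
    (\<lambda>a. 20 + 18 * a - 20/3 * rel_var a + 10/3 * rel_var a ^ 2)"
  unfolding mean_dim_cumulant_3 cen_power_cancel
  by (rule two_term_cong, (rule dim_expansion_intros)+)
    (unfold moment_coeff_upto_6, simp_all add: mult_rel_var expand_polynomial)

lemma two_term_expect_dim_exponent:
  "two_term (\<lambda>n. expect_partitions n (\<lambda>P. real_of_int (dim_exponent n P)) / cen n ^ 2)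
    (\<lambda>a. a - 2) (\<lambda>a. 5/2 + 5/2 * rel_var a ^ 2)"
  unfolding expect_dim_exponent by (rule two_term_mean_dim_cumulant_1)

lemma two_term_central_moment_2:
  "two_term (\<lambda>n. central_moment 2 dim_exponent n / cen n ^ 3) (\<lambda>a. (a^2 - 7 * a + 17) * rel_var a)
    (\<lambda>a. 5/2 - 4 * (1 + a) - 28 * rel_var a + 28 * rel_var a ^ 2 - 125/2 * rel_var a ^ 3 + 25 * rel_var a ^ 4)"
  unfolding central_moment_dim_exponent add_divide_distrib
  by (rule two_term_cong[OF two_term_add[OF two_term_mean_dim_dev_square two_term_mean_dim_cumulant_2]])
    (simp_all add: mult_rel_var expand_polynomial)

lemma two_term_central_moment_3:
  "two_term (\<lambda>n. central_moment 3 dim_exponent n / cen n ^ 4)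
    (\<lambda>a. (- (881 / 3) - 244 * a + 145 * a^2 - (83 / 3) * a^3 + 2 * a^4) * rel_var a ^ 3)
    (\<lambda>a. 6 * (1 + a) + 49 - 224/3 * rel_var a + 3082/3 * rel_var a ^ 2 - 4005/2 * rel_var a ^ 3
      + 3340 * rel_var a ^ 4 - 4375/2 * rel_var a ^ 5 + 500 * rel_var a ^ 6)"
  unfolding central_moment_dim_exponent add_divide_distrib times_divide_eq_right[symmetric]
  by (rule two_term_cong[OF two_term_add[OF two_term_add[OF two_term_mean_dim_dev_cube
      two_term_mult[OF two_term_const two_term_mean_dim_dev_mult_dim_cumulant_2]] two_term_mean_dim_cumulant_3]])
    (simp_all add: mult_rel_var expand_polynomial)

lemma expect_dim_exponent_asymptotics:
  "(\<lambda>n. expect_partitions n (\<lambda>P. real_of_int (dim_exponent n P)) - (alpha n - 2) * (real n / alpha n) ^ 2)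
    \<in> O(\<lambda>n. real n ^ (2 - 1) * inverse (alpha n))"
proof (rule two_term_bigo[OF two_term_expect_dim_exponent])
  show "(\<lambda>a. 5/2 + 5/2 * rel_var a ^ 2 + real 2 * (a - 2) / a) \<in> O(\<lambda>a. a ^ (2 - 2))"
    unfolding rel_var_def by real_asymp
qed simp

lemma central_moment_2_asymptotics:
  "(\<lambda>n. central_moment 2 dim_exponent n
      - ((alpha n)^2 - 7 * alpha n + 17) * rel_var (alpha n) * (real n / alpha n) ^ 3)
    \<in> O(\<lambda>n. real n ^ (3 - 1) * inverse (alpha n))"
proof (rule two_term_bigo[OF two_term_central_moment_2])
  show "(\<lambda>a. 5/2 - 4 * (1 + a) - 28 * rel_var a + 28 * rel_var a ^ 2 - 125/2 * rel_var a ^ 3 + 25 * rel_var a ^ 4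
      + real 3 * ((a^2 - 7 * a + 17) * rel_var a) / a) \<in> O(\<lambda>a. a ^ (3 - 2))"
    unfolding rel_var_def by real_asymp
qed simp

lemma central_moment_3_asymptotics:
  "(\<lambda>n. central_moment 3 dim_exponent n
      - (- (881 / 3) - 244 * alpha n + 145 * (alpha n)^2 - (83 / 3) * (alpha n)^3 + 2 * (alpha n)^4)
        * rel_var (alpha n) ^ 3 * (real n / alpha n) ^ 4)
    \<in> O(\<lambda>n. real n ^ (4 - 1) * inverse (alpha n))"
proof (rule two_term_bigo[OF two_term_central_moment_3])
  show "(\<lambda>a. 6 * (1 + a) + 49 - 224/3 * rel_var a + 3082/3 * rel_var a ^ 2 - 4005/2 * rel_var a ^ 3
      + 3340 * rel_var a ^ 4 - 4375/2 * rel_var a ^ 5 + 500 * rel_var a ^ 6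
      + real 4 * ((- (881 / 3) - 244 * a + 145 * a^2 - (83 / 3) * a^3 + 2 * a^4) * rel_var a ^ 3) / a)
    \<in> O(\<lambda>a. a ^ (4 - 2))"
    unfolding rel_var_def by real_asymp
qed simp

theorem theorem3p3:
  shows "((\<lambda>n. alpha n - (ln (real n) - ln (ln (real n)))) \<longlonglongrightarrow> 0) \<and>
    (\<lambda>n. expect_partitions n (\<lambda>P. real_of_int (dim_exponent n P))
          - ((alpha n - 2) / (alpha n)^2) * (real n)^2)
      \<in> O(\<lambda>n. real n * inverse (alpha n)) \<and>
    (\<lambda>n. central_moment 2 dim_exponent n
          - (((alpha n)^2 - 7 * alpha n + 17) / ((alpha n)^3 * (alpha n + 1))) * (real n)^3)
      \<in> O(\<lambda>n. (real n)^2 * inverse (alpha n)) \<and>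
    (\<lambda>n. central_moment 3 dim_exponent n
          - (- (881 / 3) - 244 * alpha n + 145 * (alpha n)^2 - (83 / 3) * (alpha n)^3
               + 2 * (alpha n)^4)
            * ((real n)^4 / ((alpha n)^4 * (alpha n + 1)^3)))
      \<in> O(\<lambda>n. (real n)^3 * inverse (alpha n))"
proof (intro conjI)
  show "(\<lambda>n. alpha n - (ln (real n) - ln (ln (real n)))) \<longlonglongrightarrow> 0"
    by (rule alpha_asymptotics)
  show "(\<lambda>n. expect_partitions n (\<lambda>P. real_of_int (dim_exponent n P))
          - ((alpha n - 2) / (alpha n)^2) * (real n)^2) \<in> O(\<lambda>n. real n * inverse (alpha n))"
    using expect_dim_exponent_asymptotics by (simp add: power_divide)
  show "(\<lambda>n. central_moment 2 dim_exponent n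
          - (((alpha n)^2 - 7 * alpha n + 17) / ((alpha n)^3 * (alpha n + 1))) * (real n)^3)
      \<in> O(\<lambda>n. (real n)^2 * inverse (alpha n))"
    using central_moment_2_asymptotics by (simp add: power_divide rel_var_def add.commute mult.commute)
  show "(\<lambda>n. central_moment 3 dim_exponent n
          - (- (881 / 3) - 244 * alpha n + 145 * (alpha n)^2 - (83 / 3) * (alpha n)^3
               + 2 * (alpha n)^4)
            * ((real n)^4 / ((alpha n)^4 * (alpha n + 1)^3)))
      \<in> O(\<lambda>n. (real n)^3 * inverse (alpha n))"
    using central_moment_3_asymptotics by (simp add: power_divide rel_var_def add.commute mult.commute)
qed

end
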